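(* Let $d\ge2$. Let $\tilde\mu$ and $\tilde\nu$ be nonnegative sequences in $\ell_1(\mathbb{N}_0)$, and let $\tilde\Lambda=\{\tilde\lambda_k\}_{k\ge0}=\tilde\mu*\tilde\mu+\tilde\nu*\tilde\nu$. Assume $\sum_\ell\tilde\lambda_\ell>0$. Then for every $n\in\mathbb{N}$, $$e_n(\mathrm{H}_{\tilde\Lambda})^2\ge\tilde\lambda_0\Big(1-\frac{n\tilde\lambda_0}{\sum_{\ell\ge0}\tilde\lambda_\ell}\Big).$$
   Context: Let $\mathbb{S}^d$ be the unit sphere in $\mathbb{R}^{d+1}$ with normalized surface measure $\sigma_d$. Let $w_0(t)=c_0(1-t^2)^{(d-2)/2}$ be the probability weight on $[-1,1]$, and write $\langle f\rangle=\int_{-1}^1fw_0$. Let $G_\ell$ be the Gegenbauer polynomials of index $(d-1)/2$ normalized by $G_\ell(1)=1$, let $h_k^2=\langle G_k^2\rangle$, and let $C^{\ell,s}_k=\langle G_\ell G_sG_k\rangle/h_k^2$. For nonnegative $\tilde\mu,\tilde\nu\in\ell_1(\mathbb{N}_0)$ define the convolution $(\tilde\mu*\tilde\nu)_k=\sum_{\ell\ge0}\sum_{s\ge0}C^{\ell,s}_k\tilde\mu_\ell\tilde\nu_s$. For a nonnegative $\tilde\Lambda\in\ell_1(\mathbb{N}_0)$, let $\mathrm{H}_{\tilde\Lambda}$ be the reproducing kernel Hilbert space on $\mathbb{S}^d$ with kernel $K_{\tilde\Lambda}(x,y)=\sum_{\ell\ge0}\tilde\lambda_\ell G_\ell(x\cdot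 y)$. When all $\tilde\lambda_\ell>0$, it consists of $f\in L_2$ with $\sum_\ell N(d,\ell)\tilde\lambda_\ell^{-1}\|H_\ell(f)\|^2_{L_2}<\infty$, where $N(d,\ell)$ is the dimension of the space of spherical harmonics of degree $\ell$ and $H_\ell$ is the projection onto it. The optimal quadrature error is $$e_n(H)=\inf_{c\in\mathbb{R}^n,\ x_j\in\mathbb{S}^d}\sup_{\|f\|_H\le1}\Big|\int f\,d\sigma_d-\sum_{j=1}^nc_jf(x_j)\Big|.$$ *)

theory Defs
  imports "HOL-Analysis.Analysis" "HOL-Library.Function_Algebras"
begin

section \<open>Normalized surface measure on the unit sphere of real^'n (d = CARD('n) - 1)\<close>

text \<open>Normalized surface measure: push-forward of the uniform (probability) measure on the
  punctured unit ball under radial projection y \<mapsto> y / |y|.\<close>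
definition sigma_d :: "'n::finite itself \<Rightarrow> (real^'n) measure" where
  "sigma_d _ = distr (uniform_measure lborel (ball 0 1 - {0}))
                     (restrict_space borel (sphere (0::real^'n) 1)) sgn"

fun gegenbauer :: "real \<Rightarrow> nat \<Rightarrow> real \<Rightarrow> real" where
  "gegenbauer a 0 t = 1"
| "gegenbauer a (Suc 0) t = 2 * a * t"
| "gegenbauer a (Suc (Suc n)) t =
     (2 * t * (real n + 1 + a) * gegenbauer a (Suc n) t - (real n + 2 * a) * gegenbauer a n t)
     / (real n + 2)"

definition G :: "nat \<Rightarrow> nat \<Rightarrow> real \<Rightarrow> real" where
  "G d l t = gegenbauer ((real d - 1) / 2) l t / gegenbauer ((real d - 1) / 2) l 1"

definition c0 :: "nat \<Rightarrow> real" where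
  "c0 d = 1 / (LBINT t=-1..1. (1 - t\<^sup>2) powr ((real d - 2) / 2))"

definition w0 :: "nat \<Rightarrow> real \<Rightarrow> real" where
  "w0 d t = c0 d * (1 - t\<^sup>2) powr ((real d - 2) / 2)"

definition avg :: "nat \<Rightarrow> (real \<Rightarrow> real) \<Rightarrow> real" where
  "avg d f = (LBINT t=-1..1. f t * w0 d t)"

definition hsq :: "nat \<Rightarrow> nat \<Rightarrow> real" where
  "hsq d k = avg d (\<lambda>t. (G d k t)\<^sup>2)"

definition Ccoef :: "nat \<Rightarrow> nat \<Rightarrow> nat \<Rightarrow> nat \<Rightarrow> real" where
  "Ccoef d l s k = avg d (\<lambda>t. G d l t * G d s t * G d k t) / hsq d k"

definition conv :: "nat \<Rightarrow> (nat \<Rightarrow> real) \<Rightarrow> (nat \<Rightarrow> real) \<Rightarrow> nat \<Rightarrow> real" where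
  "conv d \<mu> \<nu> k = (\<Sum>l. \<Sum>s. Ccoef d l s k * \<mu> l * \<nu> s)"

definition hom_harm_poly :: "nat \<Rightarrow> (real^'n::finite \<Rightarrow> real) set" where
  "hom_harm_poly l = {p.
     (\<exists>(A :: ('n \<Rightarrow> nat) set) c. finite A \<and> (\<forall>\<alpha>\<in>A. (\<Sum>i\<in>UNIV. \<alpha> i) = l) \<and>
        p = (\<lambda>x. \<Sum>\<alpha>\<in>A. c \<alpha> * (\<Prod>i\<in>UNIV. (x $ i) ^ \<alpha> i))) \<and>
     (\<forall>x. (\<Sum>i\<in>UNIV. deriv (deriv (\<lambda>t. p (x + t *\<^sub>R axis i 1))) 0) = 0)}"

definition sph_harm :: "nat \<Rightarrow> (real^'n::finite \<Rightarrow> real) set" where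
  "sph_harm l = {g. \<exists>p\<in>hom_harm_poly l. g = (\<lambda>x. if x \<in> sphere 0 1 then p x else 0)}"

definition Ndim :: "'n::finite itself \<Rightarrow> nat \<Rightarrow> nat" where
  "Ndim _ l = vector_space.dim (\<lambda>(c::real) (f::real^'n \<Rightarrow> real) x. c * f x) (sph_harm l :: (real^'n \<Rightarrow> real) set)"

definition Hproj :: "nat \<Rightarrow> (real^'n::finite \<Rightarrow> real) \<Rightarrow> (real^'n \<Rightarrow> real)" where
  "Hproj l f = (THE g. g \<in> sph_harm l \<and>
      (\<forall>h\<in>sph_harm l. (LINT x|sigma_d TYPE('n). (f x - g x) * h x) = 0))"

definition L2normsq :: "(real^'n::finite \<Rightarrow> real) \<Rightarrow> real" where
  "L2normsq f = (LINT x|sigma_d TYPE('n). (f x)\<^sup>2)"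

text \<open>Squared norm of H_\<Lambda> (value \<infinity> if f is not in the space); components with
  \<lambda>_l = 0 must vanish.\<close>
definition Hnormsq :: "(nat \<Rightarrow> real) \<Rightarrow> (real^'n::finite \<Rightarrow> real) \<Rightarrow> ereal" where
  "Hnormsq lam f = (\<Sum>l. (if lam l = 0 then (if L2normsq (Hproj l f) = 0 then 0 else \<infinity>)
      else ereal (real (Ndim TYPE('n) l) / lam l * L2normsq (Hproj l f))))"

text \<open>Unit ball of H_\<Lambda>; elements are represented by their continuous representatives.\<close>
definition Hball :: "(nat \<Rightarrow> real) \<Rightarrow> (real^'n::finite \<Rightarrow> real) set" where
  "Hball lam = {f. continuous_on (sphere 0 1) f \<and> Hnormsq lam f \<le> 1}"

definition quad_err :: "'n::finite itself \<Rightarrow> (nat \<Rightarrow> real) \<Rightarrow> nat \<Rightarrow> ereal" where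
  "quad_err _ lam n =
     (INF cx \<in> {(c :: nat \<Rightarrow> real, x :: nat \<Rightarrow> real^'n). \<forall>j<n. x j \<in> sphere 0 1}.
        SUP f \<in> (Hball lam :: (real^'n \<Rightarrow> real) set).
          ereal \<bar>(LINT y|sigma_d TYPE('n). f y) - (\<Sum>j<n. fst cx j * f (snd cx j))\<bar>)"

end

theory Submission
  imports Defs "HOL-Computational_Algebra.Polynomial"
begin

text \<open>The squared error of a quadrature rule with weights $c_j$ and nodes $x_j$ is
  $\tilde\lambda_0 - 2 \tilde\lambda_0 \sum_j c_j + \sum_{i,j} c_i c_j K_{\tilde\Lambda}(x_i, x_j)$. The linearization
  $G_l G_s = \sum_k C^{l,s}_k G_k$ turns the convolution of coefficients into the product of kernels,
  so $K_{\tilde\Lambda} = K_{\tilde\mu}^2 + K_{\tilde\nu}^2$, and Vyb\'iral's lower bound for the Schur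
  square of a Gram matrix gives
  $\sum_{i,j} c_i c_j K_{\tilde\Lambda}(x_i, x_j) \ge \frac1n (\sum_j c_j)^2 \sum_k \tilde\lambda_k$.
  Minimizing over $\sum_j c_j$ yields the claim.

  The harmonic analysis rests on a single identity: a homogeneous polynomial $p$ of degree $m$ on
  $R^N$ satisfies $m (m + N - 2) \int p = \int \Delta p$ on the sphere, a consequence of rotation
  invariance. Applied to $(x \cdot y)^m q(x)$ with $q$ harmonic, it gives the Funk--Hecke formula by
  recursion, from which orthogonality and the addition theorem follow.\<close>

section \<open>Rotation invariance of the surface measure\<close>

text \<open>For a fixed rule it is enough to exhibit one function of the unit ball. The obstacle is
  that \<open>Hball\<close> is defined through \<open>Hproj\<close>, a definite description, and
  \<open>Ndim\<close>, an abstract dimension; both have to be computed for that function, and this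
  is what the theory of spherical harmonics serves.

  No infinite kernel series occurs. If K is the sum of mu_l G_l over l \<le> M, then K^2 has degree
  at most 2M, and its coefficients are at most those of the convolution of mu with itself, since all
  C^{l,s}_k are nonnegative. Each G_k is a positive definite kernel, so enlarging coefficients only
  enlarges the quadratic form, and M tends to infinity only in numerical sums.

  The factor 1/n is Cauchy-Schwarz for the trace of an n x n matrix. The diagonal of K tends to the
  sum of mu, and (sum mu)^2 + (sum nu)^2 bounds the sum of lambda from above, because the C^{l,s}_k
  add up to 1 over k, as evaluation at t = 1 shows.\<close>

definition shear :: "real \<Rightarrow> 'n::finite \<Rightarrow> 'n \<Rightarrow> real^'n \<Rightarrow> real^'n" where
  "shear c m k x = (\<chi> i. if i = m then x $ m + c * x $ k else x $ i)"

lemma linear_shear: "linear (shear c m k)"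
  unfolding shear_def by (rule linearI) (auto simp: vec_eq_iff algebra_simps)

lemma shear_inverse: "m \<noteq> k \<Longrightarrow> shear (- c) m k (shear c m k x) = x"
  by (simp add: shear_def vec_eq_iff)

lemma measure_shear_one_cbox:
  fixes a b :: "real^'n::finite"
  assumes "m \<noteq> k"
  shows "measure lebesgue (shear 1 m k ` cbox a b) = measure lebesgue (cbox a b)"
proof (cases "cbox a b = {}")
  case False
  \<comment> \<open>\<open>measure_shear_interval\<close> asks for a lower corner that is
    nonnegative in coordinate \<open>k\<close>. Translating by \<open>w\<close> moves that
    coordinate to 0, and by linearity the image is only translated as well.\<close>
  define w where "w = axis k (a $ k)"
  have tr: "cbox a b = (+) w ` cbox (a - w) (b - w)"
    by (simp flip: cbox_translation)
  then have ne: "cbox (a - w) (b - w) \<noteq> {}"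
    using False by force
  have "shear 1 m k ` cbox a b = (+) (shear 1 m k w) ` (shear 1 m k ` cbox (a - w) (b - w))"
    unfolding tr image_image using linear_shear[of 1 m k] by (simp add: linear_add)
  then have "measure lebesgue (shear 1 m k ` cbox a b)
      = measure lebesgue (shear 1 m k ` cbox (a - w) (b - w))"
    by (simp add: measure_translation)
  also have "\<dots> = measure lebesgue (cbox (a - w) (b - w))"
  proof -
    have "shear 1 m k = (\<lambda>x. \<chi> i. if i = m then x $ m + x $ k else x $ i)"
      by (simp add: shear_def fun_eq_iff vec_eq_iff)
    then show ?thesis
      using measure_shear_interval[OF assms ne] by (simp add: w_def)
  qed
  also have "\<dots> = measure lebesgue (cbox a b)"
    unfolding tr by (simp add: measure_translation)
  finally show ?thesis .
qed simp

text \<open>Conjugation with the stretch of coordinate \<open>m\<close> by \<open>c\<close> reduces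
  a general shear to factor 1, and the two volume factors |c| and 1/|c| cancel. For
  \<open>c = 0\<close>, where the stretch is not invertible, the shear is the identity.\<close>

lemma measure_shear:
  fixes S :: "(real^'n::finite) set"
  assumes "m \<noteq> k" and S: "S \<in> lmeasurable"
  shows "shear c m k ` S \<in> lmeasurable \<and> measure lebesgue (shear c m k ` S) = measure lebesgue S"
proof (cases "c = 0")
  case True
  then have "shear c m k = (\<lambda>x. x)" by (simp add: shear_def fun_eq_iff vec_eq_iff)
  then show ?thesis using S by simp
next
  case False
  define D :: "real \<Rightarrow> real^'n \<Rightarrow> real^'n" where "D t = (\<lambda>x. \<chi> i. (if i = m then t else 1) * x $ i)" for t
  have D: "D t ` T \<in> lmeasurable \<and> measure lebesgue (D t ` T) = \<bar>t\<bar> * measure lebesgue T"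
    if "T \<in> lmeasurable" for t T
    using measurable_stretch[OF that, of "\<lambda>i. if i = m then t else 1"]
      measure_stretch[OF that, of "\<lambda>i. if i = m then t else 1"]
    by (simp add: D_def prod.delta)
  have one: "shear 1 m k ` T \<in> lmeasurable \<and> measure lebesgue (shear 1 m k ` T) = measure lebesgue T"
    if "T \<in> lmeasurable" for T
    using measure_linear_sufficient[OF linear_shear[of 1 m k] that, where m = 1]
      measure_shear_one_cbox[OF assms(1)] by simp
  have "shear c m k x = D c (shear 1 m k (D (inverse c) x))" for x
    using False assms(1) by (simp add: shear_def D_def vec_eq_iff algebra_simps)
  then have "shear c m k ` S = D c ` shear 1 m k ` D (inverse c) ` S"
    by (simp add: image_image)
  with False show ?thesis
    using D one S by (simp add: abs_mult[symmetric])
qed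

text \<open>Boxes determine the measure, and the preimage of a box is its image under the inverse
  shear, the one with factor \<open>- c\<close>.\<close>

lemma distr_lborel_shear:
  fixes m k :: "'n::finite"
  assumes "m \<noteq> k"
  shows "distr lborel borel (shear c m k) = lborel"
proof (rule sym, rule lborel_eqI)
  fix l u :: "real^'n" assume lu: "\<And>b. b \<in> Basis \<Longrightarrow> l \<bullet> b \<le> u \<bullet> b"
  have meas[measurable]: "(shear c m k :: real^'n \<Rightarrow> _) \<in> borel_measurable borel" for c
    using linear_shear[of c m k]
    by (intro borel_measurable_continuous_onI linear_continuous_on) (simp add: linear_conv_bounded_linear)
  have vim: "shear c m k -` box l u = shear (- c) m k ` box l u"
    using shear_inverse[OF assms, of c] shear_inverse[OF assms, of "- c"]
    by (auto simp: image_iff intro!: bexI[of _ "shear c m k _"])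
  have *: "shear (- c) m k ` box l u \<in> lmeasurable"
    "measure lebesgue (shear (- c) m k ` box l u) = measure lebesgue (box l u)"
    using measure_shear[OF assms, of "box l u"] by auto
  have "shear c m k -` box l u \<in> sets borel"
    using measurable_sets[OF meas, of "box l u"] by simp
  then have "emeasure lborel (shear c m k -` box l u) = emeasure lebesgue (shear c m k -` box l u)"
    by simp
  also have "\<dots> = emeasure lebesgue (box l u)"
    unfolding vim using * by (metis emeasure_eq_measure2 lmeasurable_box)
  also have "\<dots> = emeasure lborel (box l u)" by simp
  finally show "emeasure (distr lborel borel (shear c m k)) (box l u) = (\<Prod>b\<in>Basis. (u - l) \<bullet> b)"
    using lu by (simp add: emeasure_distr emeasure_lborel_box_eq)
qed simp

section \<open>Rotations in a coordinate plane\<close>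

definition rot :: "'n::finite \<Rightarrow> 'n \<Rightarrow> real \<Rightarrow> real^'n \<Rightarrow> real^'n" where
  "rot i j \<theta> x = (\<chi> l. if l = i then cos \<theta> * x $ i - sin \<theta> * x $ j
                     else if l = j then sin \<theta> * x $ i + cos \<theta> * x $ j else x $ l)"

lemma rot_0 [simp]: "rot i j 0 x = x"
  by (simp add: rot_def vec_eq_iff)

lemma linear_rot: "linear (rot i j \<theta>)"
  unfolding rot_def by (rule linearI) (auto simp: vec_eq_iff algebra_simps)

lemma norm_rot:
  fixes x :: "real^'n::finite"
  assumes "i \<noteq> j"
  shows "norm (rot i j \<theta> x) = norm x"
proof -
  have "(\<Sum>l\<in>UNIV. (rot i j \<theta> x $ l)\<^sup>2) = (\<Sum>l\<in>UNIV. (x $ l)\<^sup>2)"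
  proof -
    have split: "sum f UNIV = f i + f j + sum f (UNIV - {i, j})" for f :: "'n \<Rightarrow> real"
      using assms by (simp add: sum.remove[of UNIV i] sum.remove[of "UNIV - {i}" j] Diff_insert[symmetric] insert_commute)
    have "(cos \<theta> * x $ i - sin \<theta> * x $ j)\<^sup>2 + (sin \<theta> * x $ i + cos \<theta> * x $ j)\<^sup>2
        = ((sin \<theta>)\<^sup>2 + (cos \<theta>)\<^sup>2) * ((x $ i)\<^sup>2 + (x $ j)\<^sup>2)"
      by algebra
    moreover have "(\<Sum>l\<in>UNIV - {i, j}. (rot i j \<theta> x $ l)\<^sup>2) = (\<Sum>l\<in>UNIV - {i, j}. (x $ l)\<^sup>2)"
      by (rule sum.cong) (auto simp: rot_def)
    ultimately show ?thesis
      using assms unfolding split by (simp add: rot_def)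
  qed
  then show ?thesis
    by (simp add: norm_vec_def L2_set_def)
qed

text \<open>The classical factorization of a plane rotation into three shears. It needs a finite
  tangent of the half angle, hence the condition on the cosine; the infinitesimal argument later
  uses only angles near 0.\<close>

lemma rot_eq_shears:
  assumes "i \<noteq> j" "cos (\<theta> / 2) \<noteq> 0"
  shows "rot i j \<theta> = shear (- tan (\<theta> / 2)) i j \<circ> shear (sin \<theta>) j i \<circ> shear (- tan (\<theta> / 2)) i j"
proof
  fix x :: "real^'a"
  define s c where "s = sin (\<theta> / 2)" and "c = cos (\<theta> / 2)"
  have sc: "s\<^sup>2 + c\<^sup>2 = 1" "c \<noteq> 0"
    using assms by (auto simp: s_def c_def)
  have sin: "sin \<theta> = 2 * s * c" and cos: "cos \<theta> = 1 - 2 * s\<^sup>2"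
    using sin_double[of "\<theta> / 2"] cos_double_sin[of "\<theta> / 2"] by (auto simp: s_def c_def)
  have tan: "tan (\<theta> / 2) = s / c" by (simp add: tan_def s_def c_def)
  have 1: "1 - s / c * (2 * s * c) = 1 - 2 * s\<^sup>2"
    using sc by (simp add: power2_eq_square)
  have "s / c + (1 - 2 * s\<^sup>2) * (s / c) = 2 * s * (1 - s\<^sup>2) / c"
    by (simp add: power2_eq_square algebra_simps add_divide_distrib diff_divide_distrib)
  also have "1 - s\<^sup>2 = c\<^sup>2" using sc by simp
  finally have 2: "s / c + (1 - 2 * s\<^sup>2) * (s / c) = 2 * s * c"
    using sc by (simp add: power2_eq_square)
  have "x $ i - s / c * x $ j - s / c * (x $ j + 2 * s * c * (x $ i - s / c * x $ j))
      = (1 - s / c * (2 * s * c)) * x $ i - (s / c + (1 - s / c * (2 * s * c)) * (s / c)) * x $ j"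
    by (simp add: algebra_simps)
  also have "\<dots> = (1 - 2 * s\<^sup>2) * x $ i - 2 * s * c * x $ j"
    unfolding 1 2 ..
  finally have A: "x $ i - s / c * x $ j - s / c * (x $ j + 2 * s * c * (x $ i - s / c * x $ j))
     = (1 - 2 * s\<^sup>2) * x $ i - 2 * s * c * x $ j" .
  have "x $ j + 2 * s * c * (x $ i - s / c * x $ j) = (1 - s / c * (2 * s * c)) * x $ j + 2 * s * c * x $ i"
    by (simp add: algebra_simps)
  then have B: "x $ j + 2 * s * c * (x $ i - s / c * x $ j) = 2 * s * c * x $ i + (1 - 2 * s\<^sup>2) * x $ j"
    unfolding 1 by simp
  show "rot i j \<theta> x = (shear (- tan (\<theta> / 2)) i j \<circ> shear (sin \<theta>) j i \<circ> shear (- tan (\<theta> / 2)) i j) x"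
    using assms A B by (auto simp: rot_def shear_def vec_eq_iff sin cos tan)
qed

lemma measurable_shear [measurable]: "shear c m k \<in> borel_measurable borel"
  using linear_shear[of c m k]
  by (intro borel_measurable_continuous_onI linear_continuous_on) (simp add: linear_conv_bounded_linear)

lemma measurable_rot [measurable]: "rot i j \<theta> \<in> borel_measurable borel"
  using linear_rot[of i j \<theta>]
  by (intro borel_measurable_continuous_onI linear_continuous_on) (simp add: linear_conv_bounded_linear)

lemma distr_lborel_rot:
  assumes "i \<noteq> j" "cos (\<theta> / 2) \<noteq> 0"
  shows "distr lborel borel (rot i j \<theta>) = lborel"
proof -
  let ?S = "shear (- tan (\<theta> / 2)) i j" and ?T = "shear (sin \<theta>) j i"
  have "distr lborel borel (rot i j \<theta>) = distr (distr (distr lborel borel ?S) borel ?T) borel ?S"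
    unfolding rot_eq_shears[OF assms] by (simp add: distr_distr comp_assoc)
  then show ?thesis
    using assms by (simp add: distr_lborel_shear)
qed

section \<open>The surface measure as an image of the uniform measure on the ball\<close>

definition radial :: "real^'n::finite \<Rightarrow> real^'n" where
  "radial x = (if x = 0 then axis undefined 1 else sgn x)"

lemma norm_radial [simp]: "norm (radial x) = 1"
  by (simp add: radial_def norm_sgn)

definition unif_ball :: "'n::finite itself \<Rightarrow> (real^'n) measure" where
  "unif_ball _ = uniform_measure lborel (ball 0 1 - {0})"

lemma punctured_ball_measure:
  shows "emeasure lborel (ball (0::'a::euclidean_space) 1 - {0}) \<noteq> 0"
    and "emeasure lborel (ball (0::'a::euclidean_space) 1 - {0}) < \<infinity>"
proof -
  have fin: "emeasure lborel (ball (0::'a) 1) < \<infinity>"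
    using emeasure_lborel_ball_finite by blast
  have "emeasure lborel (ball (0::'a) 1 - {0}) = emeasure lborel (ball (0::'a) 1)"
    by (subst emeasure_Diff) auto
  moreover have "emeasure lborel (ball (0::'a) 1) \<noteq> 0"
    using open_not_negligible[of "ball (0::'a) 1"]
    by (auto simp: negligible_iff_null_sets null_sets_def)
  ultimately show "emeasure lborel (ball (0::'a) 1 - {0}) \<noteq> 0"
    and "emeasure lborel (ball (0::'a) 1 - {0}) < \<infinity>"
    using fin by auto
qed

lemma AE_unif_ball: "(AE x in unif_ball TYPE('n::finite). P x) \<longleftrightarrow> (AE x in lborel. x \<in> ball 0 1 - {0} \<longrightarrow> P x)"
  unfolding unif_ball_def by (rule AE_uniform_measure) (use punctured_ball_measure in auto)

lemma space_unif_ball [simp]: "space (unif_ball TYPE('n::finite)) = UNIV"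
  and sets_unif_ball [measurable_cong, simp]: "sets (unif_ball TYPE('n)) = sets borel"
  by (auto simp: unif_ball_def)

lemma emeasure_unif_ball: "A \<in> sets borel \<Longrightarrow> emeasure (unif_ball TYPE('n::finite)) A
    = emeasure lborel ((ball 0 1 - {0}) \<inter> A) / emeasure lborel (ball (0::real^'n) 1 - {0})"
  unfolding unif_ball_def by (rule emeasure_uniform_measure) auto

lemma emeasure_unif_ball_UNIV: "emeasure (unif_ball TYPE('n::finite)) UNIV = 1"
  using punctured_ball_measure[where 'a = "real^'n"]
  by (subst emeasure_unif_ball) (auto simp: less_top intro!: ennreal_divide_self)

lemma distr_unif_ball_rot:
  assumes "i \<noteq> j" "cos (\<theta> / 2) \<noteq> 0"
  shows "distr (unif_ball TYPE('n::finite)) borel (rot i j \<theta>) = unif_ball TYPE('n)"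
proof (rule measure_eqI)
  fix A assume "A \<in> sets (distr (unif_ball TYPE('n)) borel (rot i j \<theta>))"
  then have A [measurable]: "A \<in> sets borel" by simp
  have "rot i j \<theta> -` (ball 0 1 - {0} :: (real^'n) set) = ball 0 1 - {0}"
    using norm_rot[OF assms(1), of \<theta>] by (auto, metis norm_eq_zero, metis norm_eq_zero)
  then have "emeasure lborel ((ball 0 1 - {0}) \<inter> rot i j \<theta> -` A)
      = emeasure lborel (rot i j \<theta> -` ((ball 0 1 - {0}) \<inter> A))"
    by (simp add: vimage_Int)
  also have "\<dots> = emeasure (distr lborel borel (rot i j \<theta>)) ((ball 0 1 - {0}) \<inter> A)"
    by (subst emeasure_distr) auto
  finally have "emeasure lborel ((ball 0 1 - {0}) \<inter> rot i j \<theta> -` A) = emeasure lborel ((ball 0 1 - {0}) \<inter> A)"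
    unfolding distr_lborel_rot[OF assms] .
  moreover have "rot i j \<theta> -` A \<in> sets borel"
    using measurable_sets[OF measurable_rot A] by simp
  ultimately show "emeasure (distr (unif_ball TYPE('n)) borel (rot i j \<theta>)) A = emeasure (unif_ball TYPE('n)) A"
    by (simp add: emeasure_distr emeasure_unif_ball)
qed simp

lemma measurable_radial [measurable]: "radial \<in> borel \<rightarrow>\<^sub>M restrict_space borel (sphere (0::real^'n::finite) 1)"
proof (rule measurable_restrict_space2)
  show "radial \<in> borel \<rightarrow>\<^sub>M (borel :: (real^'n) measure)"
    unfolding radial_def[abs_def] sgn_div_norm by measurable
qed simp

text \<open>\<^term>\<open>sgn\<close> leaves the sphere at the origin, so it is not a measurable map into the target space
  of the push-forward, and the general lemmas about \<^const>\<open>distr\<close> only apply after redefining it there.\<close>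
lemma sigma_d_eq_distr_radial:
  "sigma_d TYPE('n::finite) = distr (unif_ball TYPE('n)) (restrict_space borel (sphere (0::real^'n) 1)) radial"
  unfolding sigma_d_def distr_def unif_ball_def[of "TYPE('n)", symmetric]
proof (rule measure_of_eq)
  let ?N = "restrict_space borel (sphere (0::real^'n) 1)"
  show "sets ?N \<subseteq> Pow (space ?N)" by (rule sets.space_closed)
  fix A assume "A \<in> sigma_sets (space ?N) (sets ?N)"
  then have A: "A \<in> sets ?N" by (simp only: sets.sigma_sets_eq)
  then have A': "A \<in> sets borel"
    by (subst (asm) sets_restrict_space_iff) auto
  have "sgn -` A \<in> sets (borel :: (real^'n) measure)"
    using measurable_sets[OF _ A', of sgn borel] unfolding sgn_div_norm[abs_def] by auto
  moreover have "radial -` A \<in> sets (borel :: (real^'n) measure)"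
    using measurable_sets[OF measurable_radial A] by simp
  moreover have "(ball 0 1 - {0}) \<inter> sgn -` A = (ball 0 1 - {0}) \<inter> (radial -` A :: (real^'n) set)"
    by (auto simp: radial_def)
  ultimately show "emeasure (unif_ball TYPE('n)) (sgn -` A \<inter> space (unif_ball TYPE('n)))
      = emeasure (unif_ball TYPE('n)) (radial -` A \<inter> space (unif_ball TYPE('n)))"
    by (simp add: emeasure_unif_ball)
qed

lemma space_sigma_d [simp]: "space (sigma_d TYPE('n::finite)) = sphere 0 1"
  and sets_sigma_d: "sets (sigma_d TYPE('n::finite)) = sets (restrict_space borel (sphere 0 1))"
  by (auto simp: sigma_d_def space_restrict_space)

lemma emeasure_sigma_d_space: "emeasure (sigma_d TYPE('n::finite)) (sphere 0 1) = 1"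
proof -
  have "radial -` sphere 0 1 = (UNIV :: (real^'n) set)" by auto
  then show ?thesis
    unfolding sigma_d_eq_distr_radial
    by (subst emeasure_distr) (auto simp: emeasure_unif_ball_UNIV sets_restrict_space_iff)
qed

lemma finite_measure_sigma_d: "finite_measure (sigma_d TYPE('n::finite))"
  by standard (simp add: emeasure_sigma_d_space)

lemma measure_sigma_d_space [simp]: "measure (sigma_d TYPE('n::finite)) (sphere 0 1) = 1"
  by (simp add: measure_def emeasure_sigma_d_space)

lemma integrable_sigma_d:
  fixes f :: "real^'n::finite \<Rightarrow> real"
  assumes "continuous_on (sphere 0 1) f"
  shows "integrable (sigma_d TYPE('n)) f"
proof -
  interpret finite_measure "sigma_d TYPE('n)" by (rule finite_measure_sigma_d)
  have "f \<in> borel_measurable (sigma_d TYPE('n))"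
    unfolding measurable_cong_sets[OF sets_sigma_d refl]
    using assms by (rule borel_measurable_continuous_on_restrict)
  moreover have "bounded (f ` sphere 0 1)"
    using assms compact_continuous_image compact_imp_bounded compact_sphere by blast
  then obtain B where "\<forall>x\<in>sphere 0 1. norm (f x) \<le> B"
    by (auto simp: bounded_iff)
  ultimately show ?thesis
    by (intro integrable_const_bound[where B = B]) (auto intro!: AE_I2)
qed

lemma integral_sigma_d:
  fixes f :: "real^'n::finite \<Rightarrow> real"
  assumes "continuous_on (sphere 0 1) f"
  shows "(LINT x|sigma_d TYPE('n). f x) = (LINT x|unif_ball TYPE('n). f (radial x))"
  unfolding sigma_d_eq_distr_radial using assms
  by (intro integral_distr borel_measurable_continuous_on_restrict) auto

text \<open>A rotation is linear and preserves the norm, so it commutes with \<open>radial\<close>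
  off the origin, and \<open>unif_ball\<close> lives on the punctured ball. Invariance thus passes
  from the ball to the sphere.\<close>

lemma integral_sigma_d_rot:
  fixes f :: "real^'n::finite \<Rightarrow> real"
  assumes cont: "continuous_on (sphere 0 1) f" and ij: "i \<noteq> j" "cos (\<theta> / 2) \<noteq> 0"
  shows "(LINT x|sigma_d TYPE('n). f (rot i j \<theta> x)) = (LINT x|sigma_d TYPE('n). f x)"
proof -
  have im: "rot i j \<theta> ` sphere 0 1 \<subseteq> sphere 0 1"
    using norm_rot[OF ij(1)] by auto
  have "continuous_on (sphere 0 1) (rot i j \<theta>)"
    using linear_rot[of i j \<theta>] by (intro linear_continuous_on) (simp add: linear_conv_bounded_linear)
  then have "continuous_on (sphere 0 1) (\<lambda>x. f (rot i j \<theta> x))"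
    using continuous_on_compose2[OF cont _ im] by blast
  then have "(LINT x|sigma_d TYPE('n). f (rot i j \<theta> x)) = (LINT x|unif_ball TYPE('n). f (rot i j \<theta> (radial x)))"
    by (rule integral_sigma_d)
  also have "\<dots> = (LINT x|unif_ball TYPE('n). f (radial (rot i j \<theta> x)))"
  proof (rule integral_cong_AE)
    have f': "f \<in> borel_measurable (restrict_space borel (sphere 0 1))"
      using cont by (rule borel_measurable_continuous_on_restrict)
    have "(\<lambda>x. f (radial x)) \<in> borel_measurable borel"
      using measurable_compose[OF measurable_radial f'] .
    from measurable_compose[OF measurable_rot this]
    show "(\<lambda>x. f (radial (rot i j \<theta> x))) \<in> borel_measurable (unif_ball TYPE('n))" 
      by (simp cong: measurable_cong_sets)
    have "rot i j \<theta> \<in> restrict_space borel (sphere 0 1) \<rightarrow>\<^sub>M restrict_space borel (sphere 0 1)"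
      using im by (intro measurable_restrict_space2 measurable_restrict_space1) (auto simp: space_restrict_space)
    from measurable_compose[OF measurable_radial measurable_compose[OF this f']]
    show "(\<lambda>x. f (rot i j \<theta> (radial x))) \<in> borel_measurable (unif_ball TYPE('n))"
      by (simp cong: measurable_cong_sets)
    have "rot i j \<theta> (radial x) = radial (rot i j \<theta> x)" if "x \<noteq> 0" for x
    proof -
      have "rot i j \<theta> x \<noteq> 0" using that norm_rot[OF ij(1), of \<theta> x] by (metis norm_eq_zero)
      then show ?thesis
        using that norm_rot[OF ij(1), of \<theta> x] linear_rot[of i j \<theta>]
        by (simp add: radial_def sgn_div_norm linear_scale)
    qed
    then show "AE x in unif_ball TYPE('n). f (rot i j \<theta> (radial x)) = f (radial (rot i j \<theta> x))"
      unfolding AE_unif_ball by auto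
  qed
  also have "\<dots> = (LINT x|distr (unif_ball TYPE('n)) borel (rot i j \<theta>). f (radial x))"
    using measurable_compose[OF measurable_radial borel_measurable_continuous_on_restrict[OF cont]]
    by (subst integral_distr) auto
  also have "\<dots> = (LINT x|sigma_d TYPE('n). f x)"
    unfolding distr_unif_ball_rot[OF ij] using integral_sigma_d[OF cont] by simp
  finally show ?thesis .
qed

text \<open>The measure has full support: if \<open>f\<close> did not vanish at \<open>x\<close>,
  then \<open>f\<close> after \<open>radial\<close> would be nonzero on an open set around x/2 in
  the punctured ball, which has positive volume. This turns integral identities into pointwise
  ones.\<close>

lemma sigma_d_integral_zero_imp:
  fixes f :: "real^'n::finite \<Rightarrow> real"
  assumes cont: "continuous_on (sphere 0 1) f" and nonneg: "\<And>x. x \<in> sphere 0 1 \<Longrightarrow> f x \<ge> 0"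
    and zero: "(LINT x|sigma_d TYPE('n). f x) = 0" and x: "x \<in> sphere 0 1"
  shows "f x = 0"
proof (rule ccontr)
  assume fx: "f x \<noteq> 0"
  let ?B = "ball 0 1 - {0} :: (real^'n) set"
  have meas: "(\<lambda>x. f (radial x)) \<in> borel_measurable borel"
    using measurable_compose[OF measurable_radial borel_measurable_continuous_on_restrict[OF cont]] .
  have "AE x in unif_ball TYPE('n). f (radial x) = 0"
  proof (subst integral_nonneg_eq_0_iff_AE[symmetric])
    show "integrable (unif_ball TYPE('n)) (\<lambda>x. f (radial x))"
      using integrable_sigma_d[OF cont] unfolding sigma_d_eq_distr_radial
      by (subst (asm) integrable_distr_eq) (auto intro: borel_measurable_continuous_on_restrict[OF cont])
  qed (use nonneg zero integral_sigma_d[OF cont] in auto)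
  then have AE: "AE x in lborel. x \<notin> {x \<in> ?B. f (radial x) \<noteq> 0}"
    unfolding AE_unif_ball by (rule AE_mp) auto
  have "continuous_on ?B radial"
    unfolding radial_def[abs_def]
    by (rule continuous_on_eq[of _ sgn]) (auto simp: sgn_div_norm[abs_def] intro!: continuous_intros)
  then have c: "continuous_on ?B (\<lambda>x. f (radial x))"
    by (intro continuous_on_compose2[OF cont]) auto
  have op: "open {x \<in> ?B. f (radial x) \<noteq> 0}"
    using continuous_open_preimage[OF c _ open_Compl[OF closed_singleton[of 0]]]
    by (simp add: vimage_def Int_def open_delete)
  have "(1/2) *\<^sub>R x \<in> {x \<in> ?B. f (radial x) \<noteq> 0}"
    using x fx by (auto simp: radial_def sgn_div_norm)
  then have "\<not> negligible {x \<in> ?B. f (radial x) \<noteq> 0}"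
    using open_not_negligible[OF op] by blast
  moreover have "{x \<in> ?B. f (radial x) \<noteq> 0} \<in> null_sets lborel"
    using AE_iff_null_sets[of "{x \<in> ?B. f (radial x) \<noteq> 0}" lborel] AE op by auto
  ultimately show False
    by (simp add: negligible_iff_null_sets null_sets_completionI)
qed

section \<open>Polynomial functions and directional derivatives\<close>

lemmas rpf_linear = real_polynomial_function.intros(1)
  and rpf_const = real_polynomial_function.intros(2)
  and rpf_add = real_polynomial_function.intros(3)
  and rpf_mult = real_polynomial_function.intros(4)

text \<open>Taken along a line with \<open>deriv\<close>, so that for polynomial functions iterating
  it in direction \<open>axis i 1\<close> gives the second derivatives of
  \<open>hom_harm_poly\<close>.\<close>

definition dir_deriv :: "'a::real_normed_vector \<Rightarrow> ('a \<Rightarrow> real) \<Rightarrow> 'a \<Rightarrow> real" where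
  "dir_deriv v f x = deriv (\<lambda>t. f (x + t *\<^sub>R v)) 0"

lemma dir_deriv_eq:
  assumes "(f has_derivative f') (at x)"
  shows "dir_deriv v f x = f' v"
proof -
  have "((\<lambda>t. x + t *\<^sub>R v) has_derivative (\<lambda>t. t *\<^sub>R v)) (at 0)"
    by (auto intro!: derivative_eq_intros)
  moreover have "(f has_derivative f') (at (x + 0 *\<^sub>R v))" using assms by simp
  ultimately have "((\<lambda>t. f (x + t *\<^sub>R v)) has_derivative (\<lambda>t. f' (t *\<^sub>R v))) (at 0)"
    using has_derivative_compose by blast
  moreover have "f' (t *\<^sub>R v) = f' v * t" for t
    using linear_scale[OF has_derivative_linear[OF assms]] by simp
  ultimately have "((\<lambda>t. f (x + t *\<^sub>R v)) has_real_derivative f' v) (at 0)"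
    by (simp add: has_field_derivative_def)
  then show ?thesis unfolding dir_deriv_def by (rule DERIV_imp_deriv)
qed

lemma has_derivative_dir_deriv:
  fixes f :: "'a::real_normed_vector \<Rightarrow> real"
  assumes "real_polynomial_function f"
  shows "(f has_derivative (\<lambda>v. dir_deriv v f x)) (at x)"
proof -
  obtain f' where f': "(f has_derivative f') (at x)"
    using differentiable_at_real_polynomial_function[OF assms, of x] unfolding differentiable_def by auto
  moreover have "(\<lambda>v. dir_deriv v f x) = f'" using dir_deriv_eq[OF f'] by auto
  ultimately show ?thesis by simp
qed

lemma DERIV_dir_deriv:
  fixes f :: "'a::real_normed_vector \<Rightarrow> real"
  assumes f: "real_polynomial_function f" and g: "(g has_vector_derivative g') (at t)"
  shows "((\<lambda>t. f (g t)) has_real_derivative dir_deriv g' f (g t)) (at t)"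
proof -
  have "((\<lambda>t. f (g t)) has_derivative (\<lambda>s. dir_deriv (s *\<^sub>R g') f (g t))) (at t)"
    using has_derivative_compose[OF g[unfolded has_vector_derivative_def] has_derivative_dir_deriv[OF f]] .
  moreover have "dir_deriv (s *\<^sub>R g') f (g t) = dir_deriv g' f (g t) * s" for s
    using linear_scale[OF has_derivative_linear[OF has_derivative_dir_deriv[OF f]]] by simp
  ultimately show ?thesis by (simp add: has_field_derivative_def)
qed

lemma linear_dir_deriv: "real_polynomial_function f \<Longrightarrow> linear (\<lambda>v. dir_deriv v f x)"
  using has_derivative_linear[OF has_derivative_dir_deriv] .

lemma dir_deriv_const [simp]: "dir_deriv v (\<lambda>x. c) x = 0"
  by (simp add: dir_deriv_def)

lemma dir_deriv_bounded_linear: "bounded_linear f \<Longrightarrow> dir_deriv v f x = f v"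
  by (rule dir_deriv_eq) (rule bounded_linear_imp_has_derivative)

lemma dir_deriv_add:
  "\<lbrakk>real_polynomial_function f; real_polynomial_function g\<rbrakk>
   \<Longrightarrow> dir_deriv v (\<lambda>x. f x + g x) x = dir_deriv v f x + dir_deriv v g x"
  by (rule dir_deriv_eq[OF has_derivative_add[OF has_derivative_dir_deriv has_derivative_dir_deriv]])

lemma dir_deriv_mult:
  "\<lbrakk>real_polynomial_function f; real_polynomial_function g\<rbrakk>
   \<Longrightarrow> dir_deriv v (\<lambda>x. f x * g x) x = f x * dir_deriv v g x + dir_deriv v f x * g x"
  by (rule dir_deriv_eq[OF has_derivative_mult[OF has_derivative_dir_deriv has_derivative_dir_deriv]])

lemma dir_deriv_cmult: "real_polynomial_function f \<Longrightarrow> dir_deriv v (\<lambda>x. c * f x) x = c * dir_deriv v f x"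
  using dir_deriv_mult[OF rpf_const, of f v c x] by simp

lemma real_polynomial_function_cmult: "real_polynomial_function f \<Longrightarrow> real_polynomial_function (\<lambda>x. c * f x)"
  by (rule rpf_mult[OF rpf_const])

lemma dir_deriv_sum:
  assumes "finite I" "\<And>i. i \<in> I \<Longrightarrow> real_polynomial_function (f i)"
  shows "dir_deriv v (\<lambda>x. \<Sum>i\<in>I. f i x) x = (\<Sum>i\<in>I. dir_deriv v (f i) x)"
  using assms
proof (induction I rule: finite_induct)
  case (insert i I)
  moreover have "real_polynomial_function (\<lambda>x. \<Sum>i\<in>I. f i x)"
    using insert by (intro real_polynomial_function_sum) auto
  ultimately show ?case by (simp add: dir_deriv_add)
qed simp

lemma real_polynomial_function_dir_deriv:
  assumes "real_polynomial_function f"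
  shows "real_polynomial_function (dir_deriv v f)"
  using assms
proof (induction rule: real_polynomial_function.induct)
  case (linear f)
  then have "dir_deriv v f = (\<lambda>x. f v)" by (simp add: fun_eq_iff dir_deriv_bounded_linear)
  then show ?case by auto
next
  case (const c)
  have "dir_deriv v (\<lambda>x. c) = (\<lambda>x::'a. 0)" by (simp add: fun_eq_iff)
  then show ?case by auto
next
  case (add f g)
  then have "dir_deriv v (\<lambda>x. f x + g x) = (\<lambda>x. dir_deriv v f x + dir_deriv v g x)"
    by (simp add: fun_eq_iff dir_deriv_add)
  with add show ?case by auto
next
  case (mult f g)
  then have "dir_deriv v (\<lambda>x. f x * g x) = (\<lambda>x. f x * dir_deriv v g x + dir_deriv v f x * g x)"
    by (simp add: fun_eq_iff dir_deriv_mult)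
  with mult show ?case by auto
qed

text \<open>Structural induction over polynomial functions: the mixed terms of the iterated product
  rule are symmetric in \<open>u\<close> and \<open>v\<close>.\<close>

lemma dir_deriv_commute:
  assumes "real_polynomial_function f"
  shows "dir_deriv u (dir_deriv v f) x = dir_deriv v (dir_deriv u f) x"
  using assms
proof (induction arbitrary: x rule: real_polynomial_function.induct)
  case (linear f)
  have "dir_deriv w f = (\<lambda>x. f w)" for w using linear by (simp add: fun_eq_iff dir_deriv_bounded_linear)
  then show ?case by simp
next
  case (const c)
  have "dir_deriv w (\<lambda>x. c) = (\<lambda>x::'a. 0)" for w by (simp add: fun_eq_iff)
  then show ?case by simp
next
  case (add f g)
  then have "dir_deriv w (\<lambda>x. f x + g x) = (\<lambda>x. dir_deriv w f x + dir_deriv w g x)" for w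
    by (simp add: fun_eq_iff dir_deriv_add)
  with add show ?case by (simp add: dir_deriv_add real_polynomial_function_dir_deriv)
next
  case (mult f g)
  then have "dir_deriv w (\<lambda>x. f x * g x) = (\<lambda>x. f x * dir_deriv w g x + dir_deriv w f x * g x)" for w
    by (simp add: fun_eq_iff dir_deriv_mult)
  with mult show ?case
    by (simp add: dir_deriv_add dir_deriv_mult real_polynomial_function_dir_deriv rpf_mult)
qed

lemma continuous_on_rpf: "real_polynomial_function f \<Longrightarrow> continuous_on S f"
  by (rule differentiable_imp_continuous_on) (rule differentiable_on_real_polynomial_function)

lemma rpf_inner: "real_polynomial_function (\<lambda>x::'a::real_inner. x \<bullet> y)"
  by (intro rpf_linear bounded_linear_inner_left)

lemma rpf_nth: "real_polynomial_function (\<lambda>x::real^'n::finite. x $ i)"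
  by (intro rpf_linear bounded_linear_vec_nth)

lemma rpf_norm2: "real_polynomial_function (\<lambda>x::'a::euclidean_space. x \<bullet> x)"
proof -
  have "(\<lambda>x::'a. x \<bullet> x) = (\<lambda>x. \<Sum>b\<in>Basis. (x \<bullet> b) * (x \<bullet> b))"
    by (rule ext) (rule euclidean_inner)
  then show ?thesis
    by (simp add: real_polynomial_function_sum rpf_mult rpf_inner)
qed

lemma dir_deriv_inner: "dir_deriv v (\<lambda>x. x \<bullet> y) x = v \<bullet> y"
  by (rule dir_deriv_bounded_linear) (rule bounded_linear_inner_left)

lemma dir_deriv_nth: "dir_deriv v (\<lambda>x::real^'n::finite. x $ i) x = v $ i"
  by (rule dir_deriv_bounded_linear) (rule bounded_linear_vec_nth)

lemma dir_deriv_norm2: "dir_deriv v (\<lambda>x::'a::real_inner. x \<bullet> x) x = 2 * (x \<bullet> v)"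
  by (subst dir_deriv_eq[OF has_derivative_inner[OF has_derivative_ident has_derivative_ident]])
     (simp add: inner_commute)

lemma dir_deriv_eq_sum_axis:
  fixes f :: "real^'n::finite \<Rightarrow> real"
  assumes "real_polynomial_function f"
  shows "dir_deriv v f x = (\<Sum>i\<in>UNIV. v $ i * dir_deriv (axis i 1) f x)"
proof -
  have "v = (\<Sum>i\<in>UNIV. v $ i *\<^sub>R axis i 1)"
    using basis_expansion[of v] by (simp add: scalar_mult_eq_scaleR)
  then have "dir_deriv v f x = dir_deriv (\<Sum>i\<in>UNIV. v $ i *\<^sub>R axis i 1) f x" by simp
  also have "\<dots> = (\<Sum>i\<in>UNIV. v $ i * dir_deriv (axis i 1) f x)"
    by (simp add: linear_sum[OF linear_dir_deriv[OF assms], unfolded o_def] linear_scale[OF linear_dir_deriv[OF assms]])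
  finally show ?thesis .
qed

section \<open>The Laplacian\<close>

definition lap :: "(real^'n::finite \<Rightarrow> real) \<Rightarrow> real^'n \<Rightarrow> real" where
  "lap f x = (\<Sum>i\<in>UNIV. dir_deriv (axis i 1) (dir_deriv (axis i 1) f) x)"

lemma rpf_lap: "real_polynomial_function f \<Longrightarrow> real_polynomial_function (lap f)"
  unfolding lap_def[abs_def]
  by (intro real_polynomial_function_sum real_polynomial_function_dir_deriv) auto

lemma lap_add:
  assumes "real_polynomial_function f" "real_polynomial_function g"
  shows "lap (\<lambda>x. f x + g x) x = lap f x + lap g x"
proof -
  have "dir_deriv v (\<lambda>x. f x + g x) = (\<lambda>x. dir_deriv v f x + dir_deriv v g x)" for v
    using assms by (simp add: fun_eq_iff dir_deriv_add)
  with assms show ?thesis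
    by (simp add: lap_def dir_deriv_add real_polynomial_function_dir_deriv sum.distrib)
qed

lemma lap_cmult:
  assumes "real_polynomial_function f"
  shows "lap (\<lambda>x. c * f x) x = c * lap f x"
proof -
  have "dir_deriv v (\<lambda>x. c * f x) = (\<lambda>x. c * dir_deriv v f x)" for v
    using assms by (simp add: fun_eq_iff dir_deriv_cmult)
  with assms show ?thesis
    by (simp add: lap_def dir_deriv_cmult real_polynomial_function_dir_deriv sum_distrib_left)
qed

lemma lap_mult:
  assumes "real_polynomial_function f" "real_polynomial_function g"
  shows "lap (\<lambda>x. f x * g x) x = f x * lap g x
    + 2 * (\<Sum>i\<in>UNIV. dir_deriv (axis i 1) f x * dir_deriv (axis i 1) g x) + lap f x * g x"
proof -
  have "dir_deriv v (\<lambda>x. f x * g x) = (\<lambda>x. f x * dir_deriv v g x + dir_deriv v f x * g x)" for v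
    using assms by (simp add: fun_eq_iff dir_deriv_mult)
  with assms show ?thesis
    by (simp add: lap_def dir_deriv_add dir_deriv_mult real_polynomial_function_dir_deriv rpf_mult sum.distrib
        sum_distrib_left sum_distrib_right algebra_simps)
qed

lemma lap_dir_deriv:
  assumes "real_polynomial_function f"
  shows "lap (dir_deriv v f) x = dir_deriv v (lap f) x"
proof -
  have "dir_deriv (axis i 1) (dir_deriv v f) = dir_deriv v (dir_deriv (axis i 1) f)" for i :: 'a
    using dir_deriv_commute[OF assms] by (simp add: fun_eq_iff)
  then have "lap (dir_deriv v f) x = (\<Sum>i\<in>UNIV. dir_deriv v (dir_deriv (axis i 1) (dir_deriv (axis i 1) f)) x)"
    using dir_deriv_commute[OF real_polynomial_function_dir_deriv[OF assms]] by (simp add: lap_def)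
  also have "\<dots> = dir_deriv v (lap f) x"
    unfolding lap_def[abs_def] using assms by (simp add: dir_deriv_sum real_polynomial_function_dir_deriv)
  finally show ?thesis .
qed

section \<open>Homogeneity and Euler's identity\<close>

definition homog :: "nat \<Rightarrow> ('a::real_vector \<Rightarrow> real) \<Rightarrow> bool" where
  "homog m f \<longleftrightarrow> (\<forall>t>0. \<forall>x. f (t *\<^sub>R x) = t ^ m * f x)"

lemma homogD: "homog m f \<Longrightarrow> t > 0 \<Longrightarrow> f (t *\<^sub>R x) = t ^ m * f x"
  by (simp add: homog_def)

lemma homog_mult: "homog k f \<Longrightarrow> homog l g \<Longrightarrow> homog (k + l) (\<lambda>x. f x * g x)"
  by (simp add: homog_def power_add)

text \<open>Both sides are the derivative at s = 0 of f(t x + s t v) = t^m f(x + s v). The factor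
  \<open>t\<close> on the left replaces a degree m - 1, so \<open>m = 0\<close> is covered.\<close>

lemma homog_dir_deriv:
  assumes "real_polynomial_function f" "homog m f" "t > 0"
  shows "t * dir_deriv v f (t *\<^sub>R x) = t ^ m * dir_deriv v f x"
proof -
  have 1: "((\<lambda>s. f (t *\<^sub>R x + s *\<^sub>R (t *\<^sub>R v))) has_real_derivative dir_deriv (t *\<^sub>R v) f (t *\<^sub>R x + 0 *\<^sub>R (t *\<^sub>R v))) (at 0)"
    by (rule DERIV_dir_deriv[OF assms(1)]) (auto intro!: derivative_eq_intros)
  have "((\<lambda>s. f (x + s *\<^sub>R v)) has_real_derivative dir_deriv v f (x + 0 *\<^sub>R v)) (at 0)"
    by (rule DERIV_dir_deriv[OF assms(1)]) (auto intro!: derivative_eq_intros)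
  from DERIV_cmult[OF this, of "t ^ m"]
  have 2: "((\<lambda>s. t ^ m * f (x + s *\<^sub>R v)) has_real_derivative t ^ m * dir_deriv v f x) (at 0)" by simp
  have "f (t *\<^sub>R x + s *\<^sub>R (t *\<^sub>R v)) = t ^ m * f (x + s *\<^sub>R v)" for s
    using homogD[OF assms(2,3), of "x + s *\<^sub>R v"] by (simp add: algebra_simps)
  with 1 2 have "dir_deriv (t *\<^sub>R v) f (t *\<^sub>R x) = t ^ m * dir_deriv v f x"
    using DERIV_unique by fastforce
  then show ?thesis
    using linear_scale[OF linear_dir_deriv[OF assms(1)]] by simp
qed

lemma homog_dir_deriv_Suc:
  assumes "real_polynomial_function f" "homog (Suc m) f"
  shows "homog m (dir_deriv v f)"
  unfolding homog_def
proof (intro allI impI)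
  fix t :: real and x assume "t > 0"
  then show "dir_deriv v f (t *\<^sub>R x) = t ^ m * dir_deriv v f x"
    using homog_dir_deriv[OF assms, of t v x] by simp
qed

lemma euler_homog:
  assumes "real_polynomial_function f" "homog m f"
  shows "dir_deriv x f x = real m * f x"
proof -
  have "((\<lambda>s. f (s *\<^sub>R x)) has_real_derivative dir_deriv x f (1 *\<^sub>R x)) (at 1)"
    by (rule DERIV_dir_deriv[OF assms(1)]) (auto intro!: derivative_eq_intros)
  moreover have "((\<lambda>s. f (s *\<^sub>R x)) has_real_derivative real m * f x) (at 1)"
  proof (rule DERIV_cong_ev[THEN iffD2])
    show "\<forall>\<^sub>F s in nhds 1. f (s *\<^sub>R x) = s ^ m * f x"
      using eventually_nhds_in_open[of "{0<..}" "1::real"]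
      by (auto elim!: eventually_mono simp: homogD[OF assms(2)])
    show "((\<lambda>s. s ^ m * f x) has_real_derivative real m * f x) (at 1)"
      by (auto intro!: derivative_eq_intros)
  qed auto
  ultimately show ?thesis using DERIV_unique by fastforce
qed

text \<open>Differentiate s g(s x) = s^m g(x) at s = 1, where g is the directional derivative. The
  subtraction is one of real numbers, so nothing is truncated at \<open>m = 0\<close>.\<close>

lemma euler_homog_dir_deriv:
  assumes "real_polynomial_function f" "homog m f"
  shows "dir_deriv x (dir_deriv v f) x = (real m - 1) * dir_deriv v f x"
proof -
  let ?g = "dir_deriv v f"
  have "((\<lambda>s. ?g (s *\<^sub>R x)) has_real_derivative dir_deriv x ?g (1 *\<^sub>R x)) (at 1)"
    by (rule DERIV_dir_deriv[OF real_polynomial_function_dir_deriv[OF assms(1)]]) (auto intro!: derivative_eq_intros)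
  then have "((\<lambda>s. s * ?g (s *\<^sub>R x)) has_real_derivative ?g x + dir_deriv x ?g x) (at 1)"
    by (auto intro!: derivative_eq_intros)
  moreover have "((\<lambda>s. s * ?g (s *\<^sub>R x)) has_real_derivative real m * ?g x) (at 1)"
  proof (rule DERIV_cong_ev[THEN iffD2])
    show "\<forall>\<^sub>F s in nhds 1. s * ?g (s *\<^sub>R x) = s ^ m * ?g x"
      using eventually_nhds_in_open[of "{0<..}" "1::real"]
      by (auto elim!: eventually_mono simp: homog_dir_deriv[OF assms])
    show "((\<lambda>s. s ^ m * ?g x) has_real_derivative real m * ?g x) (at 1)"
      by (auto intro!: derivative_eq_intros)
  qed auto
  ultimately have "?g x + dir_deriv x ?g x = real m * ?g x" using DERIV_unique by blast
  then show ?thesis by (simp add: algebra_simps)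
qed

section \<open>Integration of homogeneous polynomials over the sphere\<close>

definition rot_gen :: "'n::finite \<Rightarrow> 'n \<Rightarrow> real^'n \<Rightarrow> real^'n" where
  "rot_gen i j x = x $ i *\<^sub>R axis j 1 - x $ j *\<^sub>R axis i 1"

lemma rot_has_vector_derivative:
  assumes "i \<noteq> j"
  shows "((\<lambda>\<theta>. rot i j \<theta> x) has_vector_derivative rot_gen i j (rot i j \<theta> x)) (at \<theta>)"
proof -
  have eq: "rot i j \<theta> x = x + (cos \<theta> - 1) *\<^sub>R (x $ i *\<^sub>R axis i 1 + x $ j *\<^sub>R axis j 1)
      + sin \<theta> *\<^sub>R (x $ i *\<^sub>R axis j 1 - x $ j *\<^sub>R axis i 1)" for \<theta>
    using assms by (auto simp: vec_eq_iff rot_def axis_def algebra_simps)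
  have "((\<lambda>\<theta>. x + (cos \<theta> - 1) *\<^sub>R (x $ i *\<^sub>R axis i 1 + x $ j *\<^sub>R axis j 1)
      + sin \<theta> *\<^sub>R (x $ i *\<^sub>R axis j 1 - x $ j *\<^sub>R axis i 1)) has_vector_derivative
     - sin \<theta> *\<^sub>R (x $ i *\<^sub>R axis i 1 + x $ j *\<^sub>R axis j 1)
      + cos \<theta> *\<^sub>R (x $ i *\<^sub>R axis j 1 - x $ j *\<^sub>R axis i 1)) (at \<theta>)"
    by (auto intro!: derivative_eq_intros simp: has_real_derivative_iff_has_vector_derivative[symmetric])
  moreover have "rot_gen i j (rot i j \<theta> x) = - sin \<theta> *\<^sub>R (x $ i *\<^sub>R axis i 1 + x $ j *\<^sub>R axis j 1)
      + cos \<theta> *\<^sub>R (x $ i *\<^sub>R axis j 1 - x $ j *\<^sub>R axis i 1)"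
    using assms by (auto simp: vec_eq_iff rot_def rot_gen_def axis_def algebra_simps)
  ultimately show ?thesis unfolding eq[abs_def] by (simp only: eq)
qed

lemma dir_deriv_rot_gen:
  assumes "real_polynomial_function f"
  shows "dir_deriv (rot_gen i j x) f x = x $ i * dir_deriv (axis j 1) f x - x $ j * dir_deriv (axis i 1) f x"
  by (simp add: rot_gen_def linear_diff[OF linear_dir_deriv[OF assms]] linear_scale[OF linear_dir_deriv[OF assms]])

text \<open>Rotation invariance differentiated at angle 0: the difference quotients integrate to 0,
  and dominated convergence passes to the derivative.\<close>

lemma integral_rot_generator:
  fixes f :: "real^'n::finite \<Rightarrow> real"
  assumes f: "real_polynomial_function f"
  shows "(LINT x|sigma_d TYPE('n). dir_deriv (rot_gen i j x) f x) = 0"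
proof (cases "i = j")
  case True
  then show ?thesis using linear_0[OF linear_dir_deriv[OF f]] by (simp add: rot_gen_def)
next
  case False
  define L where "L x = dir_deriv (rot_gen i j x) f x" for x
  have rpL: "real_polynomial_function L"
    unfolding L_def dir_deriv_rot_gen[OF f] using f
    by (intro real_polynomial_function_diff rpf_mult rpf_nth real_polynomial_function_dir_deriv)
  have contL: "continuous_on (sphere 0 1) L" using continuous_on_rpf[OF rpL] .
  then have "bounded (L ` sphere 0 1)"
    using compact_continuous_image compact_imp_bounded compact_sphere by blast
  then obtain B where "\<forall>x\<in>sphere 0 1. norm (L x) \<le> B"
    by (auto simp: bounded_iff)
  then have B: "norm (L x) \<le> B" if "x \<in> sphere 0 1" for x
    using that by blast
  \<comment> \<open>Positive angles of at most 1 keep cos(h/2) nonzero, so rotation invariance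
    applies to each of them.\<close>
  define h where "h k = 1 / real (Suc k)" for k
  have h: "h k > 0" "h k \<le> 1" "cos (h k / 2) \<noteq> 0" for k
  proof -
    show pos: "h k > 0" and le: "h k \<le> 1" by (auto simp: h_def)
    have "h k / 2 < pi / 2" using le pi_gt3 by simp
    then show "cos (h k / 2) \<noteq> 0" using cos_gt_zero[of "h k / 2"] pos by simp
  qed
  define s where "s k x = (f (rot i j (h k) x) - f x) / h k" for k x
  have der: "((\<lambda>\<theta>. f (rot i j \<theta> x)) has_real_derivative L (rot i j \<theta> x)) (at \<theta>)" for \<theta> x
    unfolding L_def by (rule DERIV_dir_deriv[OF f rot_has_vector_derivative[OF False]])
  have contf: "continuous_on (sphere 0 1) f" using continuous_on_rpf[OF f] .
  have contr: "continuous_on (sphere 0 1) (\<lambda>x. f (rot i j \<theta> x))" for \<theta>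
  proof -
    have "continuous_on (sphere 0 1) (rot i j \<theta>)"
      using linear_rot[of i j \<theta>] by (intro linear_continuous_on) (simp add: linear_conv_bounded_linear)
    then show ?thesis
      using continuous_on_compose2[OF continuous_on_rpf[OF f, of UNIV]] by blast
  qed
  have lim: "(\<lambda>k. LINT x|sigma_d TYPE('n). s k x) \<longlonglongrightarrow> (LINT x|sigma_d TYPE('n). L x)"
  proof (rule integral_dominated_convergence[where w = "\<lambda>x. B"])
    show "L \<in> borel_measurable (sigma_d TYPE('n))"
      using integrable_sigma_d[OF contL] by (rule borel_measurable_integrable)
    show "s k \<in> borel_measurable (sigma_d TYPE('n))" for k
      using h[of k] unfolding s_def
      by (intro borel_measurable_integrable integrable_sigma_d continuous_intros contf contr) auto
    show "integrable (sigma_d TYPE('n)) (\<lambda>x. B)"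
      by (rule integrable_sigma_d) auto
    show "AE x in sigma_d TYPE('n). (\<lambda>k. s k x) \<longlonglongrightarrow> L x"
    proof (rule AE_I2)
      fix x :: "real^'n"
      have "((\<lambda>\<theta>. (f (rot i j \<theta> x) - f x) / \<theta>) \<longlongrightarrow> L x) (at 0)"
        using der[of x 0] by (simp add: has_field_derivative_iff)
      moreover have "filterlim h (at 0) sequentially"
        unfolding filterlim_at h_def
        using LIMSEQ_inverse_real_of_nat by (auto simp: inverse_eq_divide)
      ultimately show "(\<lambda>k. s k x) \<longlonglongrightarrow> L x"
        unfolding s_def by (rule filterlim_compose)
    qed
    show "AE x in sigma_d TYPE('n). norm (s k x) \<le> B" for k
    proof (rule AE_I2)
      fix x :: "real^'n" assume "x \<in> space (sigma_d TYPE('n))"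
      then have x: "norm x = 1" by simp
      \<comment> \<open>By the mean value theorem the quotient is the value of \<open>L\<close> at a
        rotated point, again on the sphere, so the bound \<open>B\<close> of \<open>L\<close>
        dominates all quotients.\<close>
      have "\<exists>z>0. z < h k \<and> f (rot i j (h k) x) - f (rot i j 0 x) = (h k - 0) * L (rot i j z x)"
        using h[of k] der[of x] by (intro MVT2) auto
      then obtain z where "s k x = L (rot i j z x)"
        using h[of k] by (auto simp: s_def)
      then show "norm (s k x) \<le> B"
        using B[of "rot i j z x"] norm_rot[OF False, of z x] x by simp
    qed
  qed
  have "(LINT x|sigma_d TYPE('n). s k x) = 0" for k
  proof -
    have "(LINT x|sigma_d TYPE('n). s k x)
        = ((LINT x|sigma_d TYPE('n). f (rot i j (h k) x)) - (LINT x|sigma_d TYPE('n). f x)) / h k"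
      unfolding s_def using integrable_sigma_d[OF contf] integrable_sigma_d[OF contr] by simp
    then show ?thesis
      using integral_sigma_d_rot[OF contf False h(3)] by simp
  qed
  with lim have "(\<lambda>k. 0 :: real) \<longlonglongrightarrow> (LINT x|sigma_d TYPE('n). L x)" by simp
  then show ?thesis
    unfolding L_def using LIMSEQ_unique tendsto_const by blast
qed

lemma integrable_rpf: "real_polynomial_function f \<Longrightarrow> integrable (sigma_d TYPE('n::finite)) f"
  by (intro integrable_sigma_d continuous_on_rpf)

text \<open>The rotation generator $x_i \partial_j - x_j \partial_i$ integrates to zero; apply it to
  $x_i \partial_j p$ and sum over $i, j$.\<close>
lemma integral_homog:
  fixes p :: "real^'n::finite \<Rightarrow> real"
  assumes p: "real_polynomial_function p" and hom: "homog m p"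
  shows "real m * (real m + real CARD('n) - 2) * (LINT x|sigma_d TYPE('n). p x)
    = (LINT x|sigma_d TYPE('n). lap p x)"
proof -
  define e where "e i = (axis i 1 :: real^'n)" for i
  define F where "F i j x = x $ i * dir_deriv (e j) p x" for i j x
  have rpd: "real_polynomial_function (dir_deriv v p)" for v using p by (rule real_polynomial_function_dir_deriv)
  have rpF: "real_polynomial_function (F i j)" for i j
    unfolding F_def by (intro rpf_mult rpf_nth rpd)
  have rpG: "real_polynomial_function (\<lambda>x. dir_deriv (rot_gen i j x) (F i j) x)" for i j
    unfolding dir_deriv_rot_gen[OF rpF]
    by (intro real_polynomial_function_diff rpf_mult rpf_nth real_polynomial_function_dir_deriv rpF)
  \<comment> \<open>Here |x| = 1 enters. Euler's identity for \<open>p\<close> and for its partial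
    derivatives collapses the first-order terms to m p and N m p and the mixed second-order terms to
    m (m - 1) p, where N is \<open>CARD('n)\<close>.\<close>
  have pt: "(\<Sum>i\<in>UNIV. \<Sum>j\<in>UNIV. dir_deriv (rot_gen i j x) (F i j) x)
      = lap p x - real m * (real m + real CARD('n) - 2) * p x" if x: "x \<in> sphere 0 1" for x
  proof -
    have ax: "e j $ i = (if i = j then 1 else 0)" for i j by (simp add: e_def axis_def)
    have ddF: "dir_deriv v (F i j) x = x $ i * dir_deriv v (dir_deriv (e j) p) x + v $ i * dir_deriv (e j) p x" for v i j
      unfolding F_def by (simp add: dir_deriv_mult[OF rpf_nth rpd] dir_deriv_nth)
    have "dir_deriv (rot_gen i j x) (F i j) x = (x $ i)\<^sup>2 * dir_deriv (e j) (dir_deriv (e j) p) x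
        + (if i = j then x $ i * dir_deriv (e j) p x else 0)
        - x $ j * dir_deriv (e j) p x - x $ j * (x $ i * dir_deriv (e i) (dir_deriv (e j) p) x)" for i j
      unfolding dir_deriv_rot_gen[OF rpF] e_def[symmetric]
      unfolding ddF ax by (simp add: power2_eq_square algebra_simps)
    then have "(\<Sum>i\<in>UNIV. \<Sum>j\<in>UNIV. dir_deriv (rot_gen i j x) (F i j) x)
      = (\<Sum>i\<in>UNIV. (x $ i)\<^sup>2) * (\<Sum>j\<in>UNIV. dir_deriv (e j) (dir_deriv (e j) p) x)
        + (\<Sum>i\<in>UNIV. x $ i * dir_deriv (e i) p x)
        - real CARD('n) * (\<Sum>j\<in>UNIV. x $ j * dir_deriv (e j) p x)
        - (\<Sum>i\<in>UNIV. \<Sum>j\<in>UNIV. x $ j * (x $ i * dir_deriv (e i) (dir_deriv (e j) p) x))"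
      by (simp add: sum.distrib sum_subtractf sum_product)
    also have "(\<Sum>i\<in>UNIV. (x $ i)\<^sup>2) = 1"
      using x by (simp add: norm_vec_def L2_set_def)
    also have "(\<Sum>i\<in>UNIV. x $ i * dir_deriv (e i) p x) = real m * p x"
      using dir_deriv_eq_sum_axis[OF p, of x x] euler_homog[OF p hom] by (simp add: e_def)
    also have "(\<Sum>i\<in>UNIV. \<Sum>j\<in>UNIV. x $ j * (x $ i * dir_deriv (e i) (dir_deriv (e j) p) x))
        = (\<Sum>j\<in>UNIV. x $ j * (\<Sum>i\<in>UNIV. x $ i * dir_deriv (e i) (dir_deriv (e j) p) x))"
      by (subst sum.swap) (simp add: sum_distrib_left)
    also have "\<dots> = (\<Sum>j\<in>UNIV. x $ j * ((real m - 1) * dir_deriv (e j) p x))"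
      using dir_deriv_eq_sum_axis[OF rpd, of x _ x] euler_homog_dir_deriv[OF p hom, of x] by (simp add: e_def)
    also have "\<dots> = (real m - 1) * (\<Sum>j\<in>UNIV. x $ j * dir_deriv (e j) p x)"
      by (simp add: sum_distrib_left mult_ac)
    also have "(\<Sum>i\<in>UNIV. x $ i * dir_deriv (e i) p x) = real m * p x"
      using dir_deriv_eq_sum_axis[OF p, of x x] euler_homog[OF p hom] by (simp add: e_def)
    finally show ?thesis
      by (simp add: lap_def e_def algebra_simps)
  qed
  have "0 = (\<Sum>i\<in>UNIV. \<Sum>j\<in>UNIV. LINT x|sigma_d TYPE('n). dir_deriv (rot_gen i j x) (F i j) x)"
    using integral_rot_generator[OF rpF] by simp
  also have "\<dots> = (LINT x|sigma_d TYPE('n). (\<Sum>i\<in>UNIV. \<Sum>j\<in>UNIV. dir_deriv (rot_gen i j x) (F i j) x))"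
    using integrable_rpf[OF rpG] by simp
  also have "\<dots> = (LINT x|sigma_d TYPE('n). lap p x - real m * (real m + real CARD('n) - 2) * p x)"
    by (rule Bochner_Integration.integral_cong) (use pt in auto)
  also have "\<dots> = (LINT x|sigma_d TYPE('n). lap p x)
      - real m * (real m + real CARD('n) - 2) * (LINT x|sigma_d TYPE('n). p x)"
    using integrable_rpf[OF rpf_lap[OF p]] integrable_rpf[OF p] by simp
  finally show ?thesis by simp
qed

section \<open>The Funk--Hecke formula for polynomials\<close>

definition harmonic :: "nat \<Rightarrow> (real^'n::finite \<Rightarrow> real) \<Rightarrow> bool" where
  "harmonic l q \<longleftrightarrow> real_polynomial_function q \<and> homog l q \<and> (\<forall>x. lap q x = 0)"

text \<open>Shrinking \<open>x\<close> to the origin keeps the value, by degree 0, and continuity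
  identifies the limit.\<close>

lemma homog_0_const:
  fixes q :: "'a::real_normed_vector \<Rightarrow> real"
  assumes "real_polynomial_function q" "homog 0 q"
  shows "q x = q 0"
proof -
  have "isCont q 0"
    using has_derivative_continuous[OF has_derivative_dir_deriv[OF assms(1)]] .
  moreover have "(\<lambda>k. (1 / real (Suc k)) *\<^sub>R x) \<longlonglongrightarrow> 0"
    using tendsto_scaleR[OF LIMSEQ_inverse_real_of_nat tendsto_const[of x]] by (simp add: inverse_eq_divide)
  ultimately have "(\<lambda>k. q ((1 / real (Suc k)) *\<^sub>R x)) \<longlonglongrightarrow> q 0"
    by (rule isCont_tendsto_compose)
  moreover have "q ((1 / real (Suc k)) *\<^sub>R x) = q x" for k
    using homogD[OF assms(2), of "1 / real (Suc k)" x] by simp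
  ultimately show ?thesis
    by (simp add: LIMSEQ_const_iff)
qed

lemma dir_deriv_homog_0:
  assumes "real_polynomial_function q" "homog 0 q"
  shows "dir_deriv v q x = 0"
proof -
  have "q = (\<lambda>x. q 0)" using homog_0_const[OF assms] by blast
  then show ?thesis using dir_deriv_const by metis
qed

lemma harmonic_dir_deriv:
  assumes "harmonic (Suc l) q"
  shows "harmonic l (dir_deriv v q)"
proof -
  have q: "real_polynomial_function q" "homog (Suc l) q" "lap q = (\<lambda>x. 0)"
    using assms by (auto simp: harmonic_def)
  then show ?thesis
    by (auto simp: harmonic_def real_polynomial_function_dir_deriv homog_dir_deriv_Suc lap_dir_deriv)
qed

lemma rpf_inner_power: "real_polynomial_function (\<lambda>x::'a::real_inner. (x \<bullet> y) ^ m)"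
  by (intro real_polynomial_function_power rpf_inner)

lemma dir_deriv_inner_power: "dir_deriv v (\<lambda>x. (x \<bullet> y) ^ m) x = real m * (x \<bullet> y) ^ (m - 1) * (v \<bullet> y)"
proof -
  have "((\<lambda>x. (x \<bullet> y) ^ m) has_derivative (\<lambda>v. real m * (x \<bullet> y) ^ (m - 1) * (v \<bullet> y))) (at x)"
    by (auto intro!: derivative_eq_intros)
  then show ?thesis by (rule dir_deriv_eq)
qed

lemma lap_inner_power:
  fixes y :: "real^'n::finite"
  assumes y: "norm y = 1"
  shows "lap (\<lambda>x. (x \<bullet> y) ^ m) x = real m * real (m - 1) * (x \<bullet> y) ^ (m - 2)"
proof -
  have "dir_deriv v (\<lambda>x. (x \<bullet> y) ^ m) = (\<lambda>x. real m * (v \<bullet> y) * (x \<bullet> y) ^ (m - 1))" for v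
    by (simp add: fun_eq_iff dir_deriv_inner_power)
  moreover have "dir_deriv v (\<lambda>x. real m * (v \<bullet> y) * (x \<bullet> y) ^ (m - 1)) x
      = real m * real (m - 1) * (x \<bullet> y) ^ (m - 2) * (v \<bullet> y)\<^sup>2" for v
    unfolding dir_deriv_cmult[OF rpf_inner_power] dir_deriv_inner_power
    by (simp add: power2_eq_square numeral_2_eq_2 mult_ac)
  ultimately have "lap (\<lambda>x. (x \<bullet> y) ^ m) x
      = (\<Sum>i\<in>UNIV. real m * real (m - 1) * (x \<bullet> y) ^ (m - 2) * (y $ i)\<^sup>2)"
    by (simp only: lap_def) (simp add: inner_axis')
  also have "\<dots> = real m * real (m - 1) * (x \<bullet> y) ^ (m - 2) * (\<Sum>i\<in>UNIV. (y $ i)\<^sup>2)"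
    by (simp add: sum_distrib_left)
  also have "(\<Sum>i\<in>UNIV. (y $ i)\<^sup>2) = 1"
    using y by (simp add: norm_vec_def L2_set_def)
  finally show ?thesis by simp
qed

lemma homog_inner_power: "homog m (\<lambda>x. (x \<bullet> y) ^ m)"
  by (simp add: homog_def power_mult_distrib)

text \<open>The gradient of (x . y)^m points along \<open>y\<close>, so the cross term of the
  product rule is a single derivative of \<open>q\<close>, again harmonic and of one degree less.
  Truncated exponents occur only next to factors that vanish.\<close>

lemma lap_inner_power_mult:
  fixes y :: "real^'n::finite"
  assumes y: "norm y = 1" and q: "harmonic l q"
  shows "lap (\<lambda>x. (x \<bullet> y) ^ m * q x) x
    = real m * real (m - 1) * ((x \<bullet> y) ^ (m - 2) * q x) + 2 * real m * ((x \<bullet> y) ^ (m - 1) * dir_deriv y q x)"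
proof -
  have rq: "real_polynomial_function q" and lq: "lap q x = 0"
    using q by (auto simp: harmonic_def)
  have "(\<Sum>i\<in>UNIV. dir_deriv (axis i 1) (\<lambda>x. (x \<bullet> y) ^ m) x * dir_deriv (axis i 1) q x)
    = real m * (x \<bullet> y) ^ (m - 1) * dir_deriv y q x"
    unfolding dir_deriv_eq_sum_axis[OF rq, of y x]
    by (simp add: dir_deriv_inner_power inner_axis' sum_distrib_left mult_ac)
  then show ?thesis
    unfolding lap_mult[OF rpf_inner_power rq] lap_inner_power[OF y] lq by simp
qed

text \<open>The Funk--Hecke multiplier of $t^m$ on spherical harmonics of degree $l$ in $R^N$.\<close>
fun fh_coeff :: "real \<Rightarrow> nat \<Rightarrow> nat \<Rightarrow> real" where
  "fh_coeff N 0 l = (if l = 0 then 1 else 0)"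
| "fh_coeff N (Suc m) l =
     (real (Suc m) * real m * fh_coeff N (m - 1) l + 2 * real (Suc m) * real l * fh_coeff N m (l - 1))
     / ((real (Suc m) + real l) * (real (Suc m) + real l + N - 2))"

lemma fh_coeff_less: "m < l \<Longrightarrow> fh_coeff N m l = 0"
  by (induction N m l rule: fh_coeff.induct) auto

lemma funk_hecke_power:
  fixes q :: "real^'n::finite \<Rightarrow> real"
  assumes n: "CARD('n) \<ge> 3" and y: "norm y = 1" and q: "harmonic l q"
  shows "(LINT x|sigma_d TYPE('n). (x \<bullet> y) ^ m * q x) = fh_coeff (real CARD('n)) m l * q y"
  using q
proof (induction "real CARD('n)" m l arbitrary: q rule: fh_coeff.induct)
  case (1 l q)
  then have q: "real_polynomial_function q" "homog l q" "lap q = (\<lambda>x. 0)"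
    by (auto simp: harmonic_def)
  show ?case
  proof (cases "l = 0")
    case True
    then have "q x = q 0" for x using homog_0_const q by blast
    then have "q = (\<lambda>x. q y)" by metis
    then have "(LINT x|sigma_d TYPE('n). q x) = (LINT x|sigma_d TYPE('n). q y)" by metis
    then show ?thesis using True by simp
  next
    case False
    \<comment> \<open>For exponent 0 and positive \<open>l\<close>, the integral identity for
      \<open>q\<close> itself forces mean 0, since its Laplacian vanishes.\<close>
    have "real l * (real l + real CARD('n) - 2) * (LINT x|sigma_d TYPE('n). q x) = 0"
      using integral_homog[OF q(1,2)] q(3) by simp
    then show ?thesis using False n by simp
  qed
next
  case (2 m l q)
  let ?I = "\<lambda>f. LINT x|sigma_d TYPE('n). f x" and ?N = "real CARD('n)"
  have q: "real_polynomial_function q" "homog l q" "lap q = (\<lambda>x. 0)"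
    using 2(3) by (auto simp: harmonic_def)
  have int: "integrable (sigma_d TYPE('n)) (\<lambda>x. (x \<bullet> y) ^ k * q x)"
    "integrable (sigma_d TYPE('n)) (\<lambda>x. (x \<bullet> y) ^ k * dir_deriv y q x)" for k
    by (intro integrable_rpf rpf_mult rpf_inner_power q real_polynomial_function_dir_deriv)+
  \<comment> \<open>At \<open>l = 0\<close> the index \<open>l - 1\<close> is truncated, but then
    \<open>q\<close> is constant and both sides are 0. Otherwise Euler's identity at
    \<open>y\<close> turns the derivative of \<open>q\<close> into l q(y).\<close>
  have D: "real l * fh_coeff ?N m (l - 1) * q y = ?I (\<lambda>x. (x \<bullet> y) ^ m * dir_deriv y q x)"
  proof (cases l)
    case 0
    then show ?thesis using dir_deriv_homog_0[OF q(1)] q(2) by simp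
  next
    case (Suc k)
    with 2(3) have "harmonic (l - 1) (dir_deriv y q)" by (simp add: harmonic_dir_deriv)
    from 2(2)[OF this] euler_homog[OF q(1,2), of y]
    show ?thesis by simp
  qed
  have "(real (Suc m) + real l) * (real (Suc m) + real l + ?N - 2) * ?I (\<lambda>x. (x \<bullet> y) ^ Suc m * q x)
    = ?I (lap (\<lambda>x. (x \<bullet> y) ^ Suc m * q x))"
    using integral_homog[OF rpf_mult[OF rpf_inner_power q(1)] homog_mult[OF homog_inner_power q(2)], of "Suc m" y]
    by (simp only: of_nat_add)
  also have "\<dots> = ?I (\<lambda>x. real (Suc m) * real m * ((x \<bullet> y) ^ (m - 1) * q x)
       + 2 * real (Suc m) * ((x \<bullet> y) ^ m * dir_deriv y q x))"
    using lap_inner_power_mult[OF y 2(3), of "Suc m"] by (simp add: numeral_2_eq_2)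
  also have "\<dots> = real (Suc m) * real m * ?I (\<lambda>x. (x \<bullet> y) ^ (m - 1) * q x)
      + 2 * real (Suc m) * ?I (\<lambda>x. (x \<bullet> y) ^ m * dir_deriv y q x)"
    using int by simp
  also have "\<dots> = (real (Suc m) * real m * fh_coeff ?N (m - 1) l + 2 * real (Suc m) * real l * fh_coeff ?N m (l - 1)) * q y"
    unfolding 2(1)[OF 2(3)] D[symmetric] by (simp add: algebra_simps)
  finally have *: "(real (Suc m) + real l) * (real (Suc m) + real l + ?N - 2) * ?I (\<lambda>x. (x \<bullet> y) ^ Suc m * q x)
    = (real (Suc m) * real m * fh_coeff ?N (m - 1) l + 2 * real (Suc m) * real l * fh_coeff ?N m (l - 1)) * q y" .
  have "(real (Suc m) + real l) * (real (Suc m) + real l + ?N - 2) \<noteq> 0"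
    using n by simp
  moreover have "I = E / D * w" if "D * I = E * w" "D \<noteq> 0" for I E D w :: real
    using that by (simp add: field_simps)
  ultimately show ?case unfolding fh_coeff.simps using * by blast
qed

definition fh_multiplier :: "real \<Rightarrow> real poly \<Rightarrow> nat \<Rightarrow> real" where
  "fh_multiplier N p l = (\<Sum>i\<le>degree p. coeff p i * fh_coeff N i l)"

lemma fh_multiplier_degree_less: "degree p < l \<Longrightarrow> fh_multiplier N p l = 0"
  by (simp add: fh_multiplier_def fh_coeff_less)

lemma rpf_poly_inner: "real_polynomial_function (\<lambda>x::'a::real_inner. poly p (x \<bullet> y))"
  unfolding poly_altdef
  by (intro real_polynomial_function_sum rpf_mult rpf_const rpf_inner_power) simp

lemma funk_hecke:
  fixes q :: "real^'n::finite \<Rightarrow> real"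
  assumes n: "CARD('n) \<ge> 3" and y: "norm y = 1" and q: "harmonic l q"
  shows "(LINT x|sigma_d TYPE('n). poly p (x \<bullet> y) * q x) = fh_multiplier (real CARD('n)) p l * q y"
proof -
  have rq: "real_polynomial_function q" using q by (simp add: harmonic_def)
  have int: "integrable (sigma_d TYPE('n)) (\<lambda>x. coeff p i * ((x \<bullet> y) ^ i * q x))" for i
    by (intro integrable_rpf rpf_mult rpf_const rpf_inner_power rq)
  have "(LINT x|sigma_d TYPE('n). poly p (x \<bullet> y) * q x)
      = (LINT x|sigma_d TYPE('n). (\<Sum>i\<le>degree p. coeff p i * ((x \<bullet> y) ^ i * q x)))"
    by (simp only: poly_altdef sum_distrib_right mult.assoc)
  also have "\<dots> = (\<Sum>i\<le>degree p. LINT x|sigma_d TYPE('n). coeff p i * ((x \<bullet> y) ^ i * q x))"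
    using int by (rule Bochner_Integration.integral_sum)
  also have "\<dots> = fh_multiplier (real CARD('n)) p l * q y"
    by (simp only: integral_mult_right_zero funk_hecke_power[OF n y q] fh_multiplier_def sum_distrib_right mult.assoc)
  finally show ?thesis .
qed

lemma harmonic_one: "harmonic 0 (\<lambda>x. 1)"
proof -
  have "dir_deriv v (\<lambda>x::(real, 'a) vec. 1) = (\<lambda>x. 0)" for v by (simp add: fun_eq_iff)
  then show ?thesis
    by (simp add: harmonic_def homog_def lap_def rpf_const)
qed

lemma integral_poly_inner:
  fixes y :: "real^'n::finite"
  assumes "CARD('n) \<ge> 3" "norm y = 1"
  shows "(LINT x|sigma_d TYPE('n). poly p (x \<bullet> y)) = fh_multiplier (real CARD('n)) p 0"
  using funk_hecke[OF assms harmonic_one, of p] by simp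

section \<open>The average on the interval\<close>

lemma avg_eq: "avg d f = c0 d * (LINT t:{-1<..<1}|lborel. f t * (1 - t\<^sup>2) powr ((real d - 2) / 2))"
proof -
  have "einterval (-1) 1 = {-1<..<1::real}" "(-1::ereal) \<le> 1"
    by (simp_all add: einterval_def set_eq_iff one_ereal_def)
  then have "avg d f = (LINT t:{-1<..<1}|lborel. c0 d * (f t * (1 - t\<^sup>2) powr ((real d - 2) / 2)))"
    by (simp add: avg_def w0_def interval_lebesgue_integral_def mult_ac)
  then show ?thesis by simp
qed

lemma set_integrable_power_weight:
  assumes "d \<ge> 2"
  shows "set_integrable lborel {-1<..<1} (\<lambda>t::real. t ^ m * (1 - t\<^sup>2) powr ((real d - 2) / 2))"
  unfolding set_integrable_def
proof (rule integrableI_bounded_set_indicator[where B = 1])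
  show "AE t in lborel. t \<in> {-1<..<1} \<longrightarrow> norm (t ^ m * (1 - t\<^sup>2) powr ((real d - 2) / 2)) \<le> 1"
  proof (intro AE_I2 impI)
    fix t :: real assume "t \<in> {-1<..<1}"
    then have t: "\<bar>t\<bar> < 1" by auto
    then have t2: "t\<^sup>2 \<le> 1" "t\<^sup>2 \<ge> 0" by (auto simp: abs_square_le_1)
    have "\<bar>t\<bar> ^ m \<le> 1" using t by (simp add: power_le_one)
    moreover have "(1 - t\<^sup>2) powr ((real d - 2) / 2) \<le> 1"
      using t2 assms by (intro powr_le1) auto
    ultimately show "norm (t ^ m * (1 - t\<^sup>2) powr ((real d - 2) / 2)) \<le> 1"
      by (simp add: abs_mult power_abs mult_le_one)
  qed
qed auto

text \<open>Guards \<open>c0\<close> against 1/0 = 0, so that the average of the constant 1 really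
  is 1.\<close>

lemma weight_integral_nonzero:
  assumes "d \<ge> 2"
  shows "(LINT t:{-1<..<1}|lborel. (1 - t\<^sup>2) powr ((real d - 2) / 2)) \<noteq> 0"
proof
  assume "(LINT t:{-1<..<1}|lborel. (1 - t\<^sup>2) powr ((real d - 2) / 2)) = 0"
  then have "AE t in lborel. indicator {-1<..<1} t *\<^sub>R (1 - t\<^sup>2) powr ((real d - 2) / 2) = 0"
    using set_integrable_power_weight[OF assms, of 0]
    by (subst integral_nonneg_eq_0_iff_AE[symmetric])
      (auto simp: set_lebesgue_integral_def set_integrable_def indicator_def)
  then have "AE t in lborel. t \<notin> {-1<..<1::real}"
  proof (rule AE_mp, intro AE_I2 impI)
    fix t :: real
    assume "indicator {-1<..<1} t *\<^sub>R (1 - t\<^sup>2) powr ((real d - 2) / 2) = 0"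
    moreover have "t\<^sup>2 < 1" if "t \<in> {-1<..<1}"
      using that by (auto simp: abs_square_less_1)
    ultimately show "t \<notin> {-1<..<1}" by (auto simp: indicator_def)
  qed
  then have "{-1<..<1::real} \<in> null_sets lborel"
    by (subst (asm) AE_iff_null_sets[symmetric]) auto
  then show False by (simp add: null_sets_def)
qed

text \<open>Integrate the derivative of $t^m (1-t^2)^{d/2}$.\<close>
lemma avg_power_rec:
  assumes d: "d \<ge> 2"
  shows "(real m + real d) * avg d (\<lambda>t. t ^ Suc m) = real m * avg d (\<lambda>t. t ^ (m - 1))"
proof -
  let ?w = "\<lambda>t::real. (1 - t\<^sup>2) powr ((real d - 2) / 2)"
  let ?F = "\<lambda>t::real. t ^ m * (1 - t\<^sup>2) powr (real d / 2)"
  let ?f = "\<lambda>t::real. real m * (t ^ (m - 1) * ?w t) - (real m + real d) * (t ^ Suc m * ?w t)"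
  have ei: "einterval (ereal (-1)) (ereal 1) = {-1<..<1::real}"
    by (simp add: einterval_def set_eq_iff)
  \<comment> \<open>The boundary terms vanish at both ends, because the exponent d/2 is
    positive.\<close>
  have lim: "((\<lambda>t. ?F t) \<longlongrightarrow> 0) (at s within A)" if "s\<^sup>2 = 1" "\<forall>\<^sub>F t in at s within A. t\<^sup>2 \<le> 1" for s A
  proof -
    have "((\<lambda>t::real. 1 - t\<^sup>2) \<longlongrightarrow> 1 - s\<^sup>2) (at s within A)"
      by (intro tendsto_intros)
    then have "((\<lambda>t::real. (1 - t\<^sup>2) powr (real d / 2)) \<longlongrightarrow> 0) (at s within A)"
      using that d by (intro tendsto_zero_powrI[OF _ tendsto_const]) auto
    from tendsto_mult[OF tendsto_power[OF tendsto_ident_at[of s A], of m] this]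
    show ?thesis by simp
  qed
  have "(LBINT t=ereal (-1)..ereal 1. ?f t) = 0 - 0"
  proof (rule interval_integral_FTC_integrable[where F = ?F])
    fix t :: real assume "ereal (-1) < ereal t" "ereal t < ereal 1"
    then have "t\<^sup>2 < 1" by (auto simp: abs_square_less_1)
    then have pos: "1 - t\<^sup>2 > 0" by simp
    have "(1 - t\<^sup>2) powr (real d / 2) = (1 - t\<^sup>2) powr (1 + (real d - 2) / 2)"
      by (simp add: diff_divide_distrib)
    also have "\<dots> = (1 - t\<^sup>2) * ?w t"
      using pos by (simp add: powr_add)
    finally have e: "(1 - t\<^sup>2) powr (real d / 2) = (1 - t\<^sup>2) * ?w t" .
    have e': "(1 - t\<^sup>2) powr (real d / 2 - 1) = ?w t"
      by (simp add: diff_divide_distrib)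
    have tm: "real m * t ^ (m - 1) * t\<^sup>2 = real m * t ^ Suc m"
      by (cases m) (auto simp: power2_eq_square)
    have "((\<lambda>t. 1 - t\<^sup>2) has_real_derivative - 2 * t) (at t)"
      by (auto intro!: derivative_eq_intros)
    from DERIV_fun_powr[OF this pos, of "real d / 2"]
    have "((\<lambda>t. (1 - t\<^sup>2) powr (real d / 2)) has_real_derivative
       real d / 2 * (1 - t\<^sup>2) powr (real d / 2 - 1) * (- 2 * t)) (at t)"
      by simp
    then have "(?F has_real_derivative
       real m * t ^ (m - 1) * (1 - t\<^sup>2) powr (real d / 2)
        + t ^ m * (real d / 2 * (1 - t\<^sup>2) powr (real d / 2 - 1) * (- 2 * t))) (at t)"
      by (intro DERIV_cong[OF DERIV_mult[OF DERIV_pow]]) auto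
    also have "real m * t ^ (m - 1) * (1 - t\<^sup>2) powr (real d / 2)
        + t ^ m * (real d / 2 * (1 - t\<^sup>2) powr (real d / 2 - 1) * (- 2 * t))
       = real m * t ^ (m - 1) * ?w t - (real m * t ^ (m - 1) * t\<^sup>2) * ?w t - real d * (t ^ Suc m * ?w t)"
      unfolding e e' by (simp add: algebra_simps)
    also have "\<dots> = ?f t"
      unfolding tm by (simp add: algebra_simps)
    finally show "(?F has_vector_derivative ?f t) (at t)"
      by (simp add: has_real_derivative_iff_has_vector_derivative)
    show "isCont ?f t"
      using pos by (auto intro!: continuous_intros)
  next
    show "set_integrable lborel (einterval (ereal (-1)) (ereal 1)) ?f"
      unfolding ei by (intro set_integral_diff set_integrable_mult_right set_integrable_power_weight d)
    {
      have "t\<^sup>2 \<le> 1" if "t \<in> {-1<..<1}" for t :: real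
        using that by (auto simp: abs_square_le_1)
      then have "\<forall>\<^sub>F t in at_right (-1). t\<^sup>2 \<le> (1::real)" "\<forall>\<^sub>F t in at_left 1. t\<^sup>2 \<le> (1::real)"
        using eventually_at_right_real[of "-1" 1] eventually_at_left_real[of "-1" 1]
        by (auto elim!: eventually_mono)
      then show "((?F \<circ> real_of_ereal) \<longlongrightarrow> 0) (at_right (ereal (-1)))"
        "((?F \<circ> real_of_ereal) \<longlongrightarrow> 0) (at_left (ereal 1))"
        unfolding ereal_tendsto_simps using lim[of "-1"] lim[of 1] by auto
    }
  qed simp
  moreover have "(LBINT t=ereal (-1)..ereal 1. ?f t) = (LINT t:{-1<..<1}|lborel. ?f t)"
    by (simp add: interval_lebesgue_integral_def ei)
  moreover have "(LINT t:{-1<..<1}|lborel. ?f t) = real m * (LINT t:{-1<..<1}|lborel. t ^ (m - 1) * ?w t)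
      - (real m + real d) * (LINT t:{-1<..<1}|lborel. t ^ Suc m * ?w t)"
    by (subst set_integral_diff)
      (intro set_integrable_mult_right set_integrable_power_weight d | simp only: set_integral_mult_right)+
  ultimately have "(real m + real d) * (LINT t:{-1<..<1}|lborel. t ^ Suc m * ?w t)
      = real m * (LINT t:{-1<..<1}|lborel. t ^ (m - 1) * ?w t)" by simp
  then have "c0 d * ((real m + real d) * (LINT t:{-1<..<1}|lborel. t ^ Suc m * ?w t))
      = c0 d * (real m * (LINT t:{-1<..<1}|lborel. t ^ (m - 1) * ?w t))" by simp
  then show ?thesis
    unfolding avg_eq by (simp only: mult_ac)
qed

text \<open>At \<open>l = 0\<close> and N = d + 1 the recursion of \<open>fh_coeff\<close> is, after
  cancelling the factor \<open>Suc k\<close>, exactly the moment recursion of \<open>w0\<close>.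
  Comparing moments takes the place of slicing the sphere by parallel hyperplanes.\<close>

lemma avg_power:
  assumes d: "d \<ge> 2"
  shows "avg d (\<lambda>t. t ^ m) = fh_coeff (real (d + 1)) m 0"
proof (induction m rule: less_induct)
  case (less m)
  show ?case
  proof (cases m)
    case 0
    have "c0 d = 1 / (LINT t:{-1<..<1}|lborel. (1 - t\<^sup>2) powr ((real d - 2) / 2))"
    proof -
      have "einterval (-1) 1 = {-1<..<1::real}" "(-1::ereal) \<le> 1"
        by (simp_all add: einterval_def set_eq_iff one_ereal_def)
      then show ?thesis by (simp add: c0_def interval_lebesgue_integral_def)
    qed
    then show ?thesis using weight_integral_nonzero[OF d] 0 by (simp add: avg_eq)
  next
    case (Suc k)
    have "(real k + real d) * avg d (\<lambda>t. t ^ Suc k) = real k * fh_coeff (real (d + 1)) (k - 1) 0"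
      using avg_power_rec[OF d, of k] less.IH[of "k - 1"] Suc by simp
    moreover have "real k + real d \<noteq> 0" using d by simp
    ultimately have "avg d (\<lambda>t. t ^ Suc k) = real k * fh_coeff (real (d + 1)) (k - 1) 0 / (real k + real d)"
      by (simp add: field_simps)
    also have "\<dots> = fh_coeff (real (d + 1)) (Suc k) 0"
    proof -
      have "real (Suc k) + real (d + 1) - 2 = real k + real d" by simp
      then show ?thesis by (simp add: mult.assoc del: of_nat_Suc of_nat_add)
    qed
    finally show ?thesis unfolding Suc .
  qed
qed

lemma avg_poly:
  assumes d: "d \<ge> 2"
  shows "avg d (poly p) = fh_multiplier (real (d + 1)) p 0"
proof -
  let ?w = "\<lambda>t::real. (1 - t\<^sup>2) powr ((real d - 2) / 2)"
  have int: "integrable lborel (\<lambda>t. indicator {-1<..<1} t *\<^sub>R (t ^ i * ?w t))" for i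
    using set_integrable_power_weight[OF d, of i] by (simp add: set_integrable_def)
  have "(LINT t:{-1<..<1}|lborel. poly p t * ?w t)
    = (LINT t|lborel. (\<Sum>i\<le>degree p. coeff p i * (indicator {-1<..<1} t *\<^sub>R (t ^ i * ?w t))))"
    unfolding set_lebesgue_integral_def
    by (rule Bochner_Integration.integral_cong)
      (auto simp: poly_altdef sum_distrib_left sum_distrib_right mult_ac)
  also have "\<dots> = (\<Sum>i\<le>degree p. LINT t|lborel. coeff p i * (indicator {-1<..<1} t *\<^sub>R (t ^ i * ?w t)))"
    by (rule Bochner_Integration.integral_sum) (use int in \<open>intro integrable_mult_right\<close>)
  also have "\<dots> = (\<Sum>i\<le>degree p. coeff p i * (LINT t:{-1<..<1}|lborel. t ^ i * ?w t))"
    by (simp add: set_lebesgue_integral_def)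
  finally have "avg d (poly p) = (\<Sum>i\<le>degree p. coeff p i * avg d (\<lambda>t. t ^ i))"
    unfolding avg_eq by (simp add: sum_distrib_left mult_ac)
  then show ?thesis by (simp add: avg_power[OF d] fh_multiplier_def)
qed

text \<open>Moves the averages in \<open>hsq\<close> and \<open>Ccoef\<close> to the sphere, where
  orthogonality and the addition theorem are available.\<close>

lemma avg_poly_eq_integral:
  fixes y :: "real^'n::finite"
  assumes "CARD('n) \<ge> 3" "norm y = 1"
  shows "avg (CARD('n) - 1) (poly p) = (LINT x|sigma_d TYPE('n). poly p (x \<bullet> y))"
proof -
  have "CARD('n) - 1 \<ge> 2" and e: "CARD('n) - 1 + 1 = CARD('n)"
    using assms(1) by auto
  then show ?thesis
    unfolding integral_poly_inner[OF assms] by (subst avg_poly) (simp_all only: e)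
qed

section \<open>Gegenbauer polynomials and zonal harmonics\<close>

fun gegen_poly :: "real \<Rightarrow> nat \<Rightarrow> real poly" where
  "gegen_poly a 0 = 1"
| "gegen_poly a (Suc 0) = [:0, 2 * a:]"
| "gegen_poly a (Suc (Suc n)) = smult (1 / (real n + 2))
     (smult (2 * (real n + 1 + a)) (pCons 0 (gegen_poly a (Suc n))) - smult (real n + 2 * a) (gegen_poly a n))"

lemma poly_gegen_poly: "poly (gegen_poly a n) t = gegenbauer a n t"
proof (induction a n rule: gegen_poly.induct)
  case (3 a n)
  then have "poly (gegen_poly a (Suc (Suc n))) t
      = 1 / (real n + 2) * (2 * (real n + 1 + a) * (t * gegenbauer a (Suc n) t) - (real n + 2 * a) * gegenbauer a n t)"
    by simp
  then show ?case by (simp add: mult_ac)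
qed auto

lemma degree_gegen_poly_le: "degree (gegen_poly a n) \<le> n"
proof (induction a n rule: gegen_poly.induct)
  case (3 a n)
  then have "degree (smult (2 * (real n + 1 + a)) (pCons 0 (gegen_poly a (Suc n)))) \<le> Suc (Suc n)"
    by (intro order.trans[OF degree_smult_le] order.trans[OF degree_pCons_le]) simp
  moreover have "degree (smult (real n + 2 * a) (gegen_poly a n)) \<le> Suc (Suc n)"
    using 3 by (intro order.trans[OF degree_smult_le]) simp
  ultimately show ?case
    by (simp only: gegen_poly.simps) (intro order.trans[OF degree_smult_le degree_diff_le])
qed auto

lemma coeff_gegen_poly_pos: "a > 0 \<Longrightarrow> coeff (gegen_poly a n) n > 0"
proof (induction a n rule: gegen_poly.induct)
  case (3 a n)
  have "coeff (gegen_poly a n) (Suc (Suc n)) = 0"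
    using degree_gegen_poly_le[of a n] by (intro coeff_eq_0) simp
  with 3 show ?case by simp
qed auto

lemma degree_gegen_poly: "a > 0 \<Longrightarrow> degree (gegen_poly a n) = n"
  using degree_gegen_poly_le[of a n] le_degree[of "gegen_poly a n" n] coeff_gegen_poly_pos[of a n] by fastforce

text \<open>Yields the value 2a (2a + 1) ... (2a + n - 1) / n! at 1 factor by factor; its positivity
  makes the normalization in \<open>G\<close> a division by a nonzero number.\<close>

lemma gegenbauer_Suc_one: "gegenbauer a (Suc n) 1 = gegenbauer a n 1 * (real n + 2 * a) / (real n + 1)"
proof (induction n)
  case (Suc n)
  then have "(real n + 2 * a) * gegenbauer a n 1 = (real n + 1) * gegenbauer a (Suc n) 1"
    by (simp add: field_simps)
  then have "gegenbauer a (Suc (Suc n)) 1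
      = (2 * (real n + 1 + a) * gegenbauer a (Suc n) 1 - (real n + 1) * gegenbauer a (Suc n) 1) / (real n + 2)"
    by simp
  also have "\<dots> = gegenbauer a (Suc n) 1 * (real (Suc n) + 2 * a) / (real (Suc n) + 1)"
    by (simp add: field_simps)
  finally show ?case .
qed simp

lemma gegenbauer_one_pos: "a > 0 \<Longrightarrow> gegenbauer a n 1 > 0"
proof (induction n)
  case (Suc n)
  then show ?case unfolding gegenbauer_Suc_one by (auto intro!: divide_pos_pos mult_pos_pos)
qed simp

definition Gpoly :: "nat \<Rightarrow> nat \<Rightarrow> real poly" where
  "Gpoly d l = smult (1 / gegenbauer ((real d - 1) / 2) l 1) (gegen_poly ((real d - 1) / 2) l)"

lemma poly_Gpoly: "poly (Gpoly d l) t = G d l t"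
  by (simp add: Gpoly_def G_def poly_gegen_poly)

lemma degree_Gpoly: "d \<ge> 2 \<Longrightarrow> degree (Gpoly d l) = l"
  using gegenbauer_one_pos[of "(real d - 1) / 2" l] by (simp add: Gpoly_def degree_gegen_poly)

lemma G_one: "d \<ge> 2 \<Longrightarrow> G d l 1 = 1"
  using gegenbauer_one_pos[of "(real d - 1) / 2" l] by (simp add: G_def)

text \<open>The solid zonal harmonic |x|^n C_n^a(x . y / |x|). In the three-term recursion the lower
  term is multiplied by |x|^2, which makes both summands homogeneous of the same degree.\<close>

fun zonal_poly :: "real \<Rightarrow> real^'n::finite \<Rightarrow> nat \<Rightarrow> real^'n \<Rightarrow> real" where
  "zonal_poly a y 0 x = 1"
| "zonal_poly a y (Suc 0) x = 2 * a * (x \<bullet> y)"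
| "zonal_poly a y (Suc (Suc n)) x =
     (2 * (real n + 1 + a)) / (real n + 2) * ((x \<bullet> y) * zonal_poly a y (Suc n) x)
     + (- (real n + 2 * a)) / (real n + 2) * ((x \<bullet> x) * zonal_poly a y n x)"

lemma zonal_poly_eq_gegenbauer: "norm x = 1 \<Longrightarrow> zonal_poly a y n x = gegenbauer a n (x \<bullet> y)"
proof (induction n rule: induct_nat_012)
  case (ge2 n)
  have "x \<bullet> x = 1" using ge2.prems by (simp add: norm_eq_1)
  with ge2 have "zonal_poly a y (Suc (Suc n)) x = (2 * (real n + 1 + a)) / (real n + 2) * ((x \<bullet> y) * gegenbauer a (Suc n) (x \<bullet> y))
     + (- (real n + 2 * a)) / (real n + 2) * gegenbauer a n (x \<bullet> y)"
    by simp
  also have "\<dots> = gegenbauer a (Suc (Suc n)) (x \<bullet> y)"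
  proof -
    have "A / M * (t * u) + (- B) / M * v = (t * A * u - B * v) / M" for A B M t u v :: real
      by (simp add: diff_divide_distrib)
    from this[of "2 * (real n + 1 + a)" "real n + 2" "x \<bullet> y" _ "real n + 2 * a"]
    show ?thesis by (simp only: gegenbauer.simps) (simp only: mult.commute mult.left_commute)
  qed
  finally show ?case .
qed auto

lemma rpf_zonal_poly: "real_polynomial_function (zonal_poly a y n)"
proof (induction n rule: less_induct)
  case (less n)
  consider "n = 0" | "n = Suc 0" | k where "n = Suc (Suc k)" by (metis not0_implies_Suc)
  then show ?case
  proof cases
    case 1
    then have "zonal_poly a y n = (\<lambda>x. 1)" by auto
    then show ?thesis by (simp add: rpf_const)
  next
    case 2
    then have "zonal_poly a y n = (\<lambda>x. 2 * a * (x \<bullet> y))" by auto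
    then show ?thesis by (simp add: rpf_mult rpf_const rpf_inner)
  next
    case 3
    have "real_polynomial_function (\<lambda>x. (2 * (real k + 1 + a)) / (real k + 2) * ((x \<bullet> y) * zonal_poly a y (Suc k) x)
        + (- (real k + 2 * a)) / (real k + 2) * ((x \<bullet> x) * zonal_poly a y k x))"
      using less 3 by (intro rpf_add rpf_mult rpf_const rpf_inner rpf_norm2) auto
    moreover have "zonal_poly a y n = (\<lambda>x. (2 * (real k + 1 + a)) / (real k + 2) * ((x \<bullet> y) * zonal_poly a y (Suc k) x)
        + (- (real k + 2 * a)) / (real k + 2) * ((x \<bullet> x) * zonal_poly a y k x))"
      using 3 by auto
    ultimately show ?thesis by simp
  qed
qed

lemma zonal_poly_Suc_Suc_fun: "zonal_poly a y (Suc (Suc n)) =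
  (\<lambda>x. (2 * (real n + 1 + a)) / (real n + 2) * ((x \<bullet> y) * zonal_poly a y (Suc n) x)
     + (- (real n + 2 * a)) / (real n + 2) * ((x \<bullet> x) * zonal_poly a y n x))"
  by auto

lemma dir_deriv_zonal_poly_Suc_Suc: "dir_deriv v (zonal_poly a y (Suc (Suc n))) x =
  (2 * (real n + 1 + a)) / (real n + 2) * ((x \<bullet> y) * dir_deriv v (zonal_poly a y (Suc n)) x + (v \<bullet> y) * zonal_poly a y (Suc n) x)
     + (- (real n + 2 * a)) / (real n + 2) * ((x \<bullet> x) * dir_deriv v (zonal_poly a y n) x + 2 * (x \<bullet> v) * zonal_poly a y n x)"
  unfolding zonal_poly_Suc_Suc_fun
  by (simp only: dir_deriv_add dir_deriv_cmult dir_deriv_mult dir_deriv_inner dir_deriv_norm2 rpf_mult rpf_const rpf_inner rpf_norm2 rpf_zonal_poly)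

text \<open>Supplies the cross term that arises when the Laplacian is applied to x . y times a zonal
  polynomial. In the induction the recursion is differentiated and then used once more to recombine
  the lower terms.\<close>

lemma dir_deriv_zonal_poly:
  assumes y: "norm y = 1"
  shows "dir_deriv y (zonal_poly a y (Suc n)) x = (real n + 2 * a) * zonal_poly a y n x"
proof (induction n rule: less_induct)
  case (less n)
  have yy: "y \<bullet> y = 1" using y by (simp add: norm_eq_1)
  have z0: "zonal_poly a y 0 = (\<lambda>x. 1)" and z1: "zonal_poly a y (Suc 0) = (\<lambda>x. 2 * a * (x \<bullet> y))" by auto
  have d0: "dir_deriv y (zonal_poly a y 0) x = 0" and d1: "dir_deriv y (zonal_poly a y (Suc 0)) x = 2 * a"
    unfolding z0 z1 dir_deriv_cmult[OF rpf_inner] dir_deriv_inner by (simp_all add: yy)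
  consider "n = 0" | "n = Suc 0" | k where "n = Suc (Suc k)" by (metis not0_implies_Suc)
  then show ?case
  proof cases
    case 1
    show ?thesis unfolding 1 d1 by simp
  next
    case 2
    then show ?thesis unfolding 2 dir_deriv_zonal_poly_Suc_Suc d0 d1
      by (simp add: yy field_simps)
  next
    case 3
    define A B C where "A = zonal_poly a y (Suc (Suc k)) x" and "B = zonal_poly a y (Suc k) x" and "C = zonal_poly a y k x"
    have A: "(real k + 2) * A = 2 * (real k + 1 + a) * ((x \<bullet> y) * B) - (real k + 2 * a) * ((x \<bullet> x) * C)"
      unfolding A_def B_def C_def by (simp add: divide_simps) (simp add: algebra_simps)
    have D1: "dir_deriv y (zonal_poly a y (Suc k)) x = (real k + 2 * a) * C"
      using less[of k] 3 by (simp add: C_def)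
    have D2: "dir_deriv y (zonal_poly a y (Suc (Suc k))) x = (real k + 1 + 2 * a) * B"
      using less[of "Suc k"] 3 by (simp add: B_def add_ac del: zonal_poly.simps)
    have "dir_deriv y (zonal_poly a y (Suc n)) x =
      (2 * (real k + 2 + a) * ((x \<bullet> y) * ((real k + 1 + 2 * a) * B) + A)
       - (real k + 1 + 2 * a) * ((x \<bullet> x) * ((real k + 2 * a) * C) + 2 * (x \<bullet> y) * B)) / (real k + 3)"
      unfolding 3 dir_deriv_zonal_poly_Suc_Suc[of _ _ _ "Suc k"] D1 D2
      by (simp add: yy A_def[symmetric] B_def[symmetric] C_def[symmetric] divide_simps del: zonal_poly.simps)
        (simp add: algebra_simps del: zonal_poly.simps)?
    also have "\<dots> = (2 * (real k + 2 + a) * A + (real k + 1 + 2 * a) *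
       (2 * (real k + 1 + a) * ((x \<bullet> y) * B) - (real k + 2 * a) * ((x \<bullet> x) * C))) / (real k + 3)"
      by (simp add: algebra_simps)
    also have "\<dots> = (2 * (real k + 2 + a) * A + (real k + 1 + 2 * a) * ((real k + 2) * A)) / (real k + 3)"
      unfolding A ..
    also have "\<dots> = (real k + 2 + 2 * a) * A"
      by (simp add: divide_simps) (simp add: algebra_simps)
    finally show ?thesis unfolding 3 A_def by (simp add: add_ac del: zonal_poly.simps)
  qed
qed

lemma lap_inner_mult:
  fixes y :: "real^'n::finite"
  assumes f: "real_polynomial_function f"
  shows "lap (\<lambda>x. (x \<bullet> y) * f x) x = (x \<bullet> y) * lap f x + 2 * dir_deriv y f x"
proof -
  have "dir_deriv v (\<lambda>x. x \<bullet> y) = (\<lambda>x. v \<bullet> y)" for v by (simp add: fun_eq_iff dir_deriv_inner)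
  then have "lap (\<lambda>x. x \<bullet> y) x = 0"
    by (simp add: lap_def)
  moreover have "(\<Sum>i\<in>UNIV. dir_deriv (axis i 1) (\<lambda>x. x \<bullet> y) x * dir_deriv (axis i 1) f x) = dir_deriv y f x"
    unfolding dir_deriv_eq_sum_axis[OF f, of y x] by (simp add: dir_deriv_inner inner_axis')
  ultimately show ?thesis
    by (simp add: lap_mult[OF rpf_inner f])
qed

lemma lap_norm2_mult:
  fixes f :: "real^'n::finite \<Rightarrow> real"
  assumes f: "real_polynomial_function f"
  shows "lap (\<lambda>x. (x \<bullet> x) * f x) x = (x \<bullet> x) * lap f x + 4 * dir_deriv x f x + 2 * real CARD('n) * f x"
proof -
  have d: "dir_deriv v (\<lambda>x. x \<bullet> x) = (\<lambda>x. 2 * (x \<bullet> v))" for v :: "real^'n"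
    by (simp add: fun_eq_iff dir_deriv_norm2)
  have "dir_deriv v (\<lambda>x. 2 * (x \<bullet> v)) x = 2 * (v \<bullet> v)" for v x :: "real^'n"
    by (simp add: dir_deriv_cmult[OF rpf_inner] dir_deriv_inner)
  then have "lap (\<lambda>x::real^'n. x \<bullet> x) x = 2 * real CARD('n)"
    unfolding lap_def d by (simp add: inner_axis_axis)
  moreover have "(\<Sum>i\<in>UNIV. dir_deriv (axis i 1) (\<lambda>x. x \<bullet> x) x * dir_deriv (axis i 1) f x) = 2 * dir_deriv x f x"
    unfolding dir_deriv_eq_sum_axis[OF f, of x x] d by (simp add: inner_axis sum_distrib_left mult_ac)
  ultimately show ?thesis
    by (simp add: lap_mult[OF rpf_norm2 f])
qed

lemma homog_zonal_poly: "homog n (zonal_poly a y n)"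
proof (induction n rule: less_induct)
  case (less n)
  consider "n = 0" | "n = Suc 0" | k where "n = Suc (Suc k)" by (metis not0_implies_Suc)
  then show ?case
  proof cases
    case 3
    then have "homog k (zonal_poly a y k)" "homog (Suc k) (zonal_poly a y (Suc k))" using less by auto
    then show ?thesis unfolding 3 homog_def by (simp add: algebra_simps)
  qed (auto simp: homog_def)
qed

text \<open>In the recursion, 4 (k + 1 + a) (k + 2a) from the first product has to cancel (k + 2a)
  (4k + 2N) from the second, and N = 2a + 2 makes them equal. This is where the index a = (d - 1)/2
  comes from.\<close>

lemma lap_zonal_poly:
  fixes y :: "real^'n::finite"
  assumes y: "norm y = 1" and a: "real CARD('n) = 2 * a + 2"
  shows "lap (zonal_poly a y n) x = 0"
proof (induction n arbitrary: x rule: less_induct)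
  case (less n)
  consider "n = 0" | "n = Suc 0" | k where "n = Suc (Suc k)" by (metis not0_implies_Suc)
  then show ?case
  proof cases
    case 1
    have "zonal_poly a y 0 = (\<lambda>x. 1)" by auto
    then show ?thesis unfolding 1 using harmonic_one[where 'a = 'n] by (simp only: harmonic_def)
  next
    case 2
    have "zonal_poly a y (Suc 0) = (\<lambda>x. 2 * a * ((x \<bullet> y) ^ 1))" by auto
    then show ?thesis unfolding 2 
      by (simp only: lap_cmult[OF rpf_inner_power] lap_inner_power[OF y]) simp
  next
    case 3
    have ih: "lap (zonal_poly a y (Suc k)) x = 0" "lap (zonal_poly a y k) x = 0" using less 3 by auto
    have r: "real_polynomial_function (\<lambda>x. (x \<bullet> y) * zonal_poly a y (Suc k) x)"
      "real_polynomial_function (\<lambda>x. (x \<bullet> x) * zonal_poly a y k x)"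
      by (intro rpf_mult rpf_inner rpf_norm2 rpf_zonal_poly)+
    have "lap (zonal_poly a y n) x
       = (2 * (real k + 1 + a)) / (real k + 2) * lap (\<lambda>x. (x \<bullet> y) * zonal_poly a y (Suc k) x) x
        + (- (real k + 2 * a)) / (real k + 2) * lap (\<lambda>x. (x \<bullet> x) * zonal_poly a y k x) x"
      unfolding 3 zonal_poly_Suc_Suc_fun by (simp only: lap_add lap_cmult rpf_mult rpf_const r)
    also have "\<dots> = (2 * (real k + 1 + a)) / (real k + 2) * (2 * ((real k + 2 * a) * zonal_poly a y k x))
        + (- (real k + 2 * a)) / (real k + 2) * ((4 * real k + 2 * (2 * a + 2)) * zonal_poly a y k x)"
      unfolding lap_inner_mult[OF rpf_zonal_poly] lap_norm2_mult[OF rpf_zonal_poly] ih dir_deriv_zonal_poly[OF y]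
        euler_homog[OF rpf_zonal_poly homog_zonal_poly] a by (simp add: algebra_simps)
    also have "\<dots> = 0" by (simp add: divide_simps) (simp add: algebra_simps)
    finally show ?thesis .
  qed
qed

section \<open>Homogeneous polynomials as sums of monomials\<close>

definition hpoly :: "nat \<Rightarrow> (real^'n::finite \<Rightarrow> real) set" where
  "hpoly l = {p. \<exists>(A :: ('n \<Rightarrow> nat) set) c. finite A \<and> (\<forall>\<alpha>\<in>A. (\<Sum>i\<in>UNIV. \<alpha> i) = l) \<and>
        p = (\<lambda>x. \<Sum>\<alpha>\<in>A. c \<alpha> * (\<Prod>i\<in>UNIV. (x $ i) ^ \<alpha> i))}"

lemma hpoly_monomial: "(\<Sum>i\<in>UNIV. \<alpha> i) = l \<Longrightarrow> (\<lambda>x. c * (\<Prod>i\<in>UNIV. (x $ i) ^ \<alpha> i)) \<in> hpoly l"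
  unfolding hpoly_def by (intro CollectI exI[of _ "{\<alpha>}"] exI[of _ "\<lambda>_. c"]) auto

lemma hpoly_zero: "(\<lambda>x. 0) \<in> hpoly l"
  unfolding hpoly_def by (intro CollectI exI[of _ "{}"]) auto

lemma hpoly_add:
  assumes "p \<in> hpoly l" "q \<in> hpoly l"
  shows "(\<lambda>x. p x + q x) \<in> hpoly l"
proof -
  obtain A c where A: "finite A" "\<forall>\<alpha>\<in>A. (\<Sum>i\<in>UNIV. \<alpha> i) = l"
    and p: "p = (\<lambda>x. \<Sum>\<alpha>\<in>A. c \<alpha> * (\<Prod>i\<in>UNIV. (x $ i) ^ \<alpha> i))"
    using assms(1) unfolding hpoly_def by blast
  obtain B b where B: "finite B" "\<forall>\<alpha>\<in>B. (\<Sum>i\<in>UNIV. \<alpha> i) = l"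
    and q: "q = (\<lambda>x. \<Sum>\<alpha>\<in>B. b \<alpha> * (\<Prod>i\<in>UNIV. (x $ i) ^ \<alpha> i))"
    using assms(2) unfolding hpoly_def by blast
  \<comment> \<open>The coefficient functions are arbitrary off their index sets, so they are cut to
    0 there before being added.\<close>
  have "(\<lambda>x. p x + q x) = (\<lambda>x. \<Sum>\<alpha>\<in>A \<union> B.
      ((if \<alpha> \<in> A then c \<alpha> else 0) + (if \<alpha> \<in> B then b \<alpha> else 0)) * (\<Prod>i\<in>UNIV. (x $ i) ^ \<alpha> i))"
  proof
    fix x :: "real^'a"
    have "p x = (\<Sum>\<alpha>\<in>A \<union> B. (if \<alpha> \<in> A then c \<alpha> else 0) * (\<Prod>i\<in>UNIV. (x $ i) ^ \<alpha> i))"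
      unfolding p using A(1) B(1) by (intro sum.mono_neutral_cong_left) auto
    moreover have "q x = (\<Sum>\<alpha>\<in>A \<union> B. (if \<alpha> \<in> B then b \<alpha> else 0) * (\<Prod>i\<in>UNIV. (x $ i) ^ \<alpha> i))"
      unfolding q using A(1) B(1) by (intro sum.mono_neutral_cong_left) auto
    ultimately show "p x + q x = (\<Sum>\<alpha>\<in>A \<union> B.
      ((if \<alpha> \<in> A then c \<alpha> else 0) + (if \<alpha> \<in> B then b \<alpha> else 0)) * (\<Prod>i\<in>UNIV. (x $ i) ^ \<alpha> i))"
      by (simp only: distrib_right sum.distrib)
  qed
  then show ?thesis
    unfolding hpoly_def using A B
    by (intro CollectI exI[of _ "A \<union> B"] exI[of _ "\<lambda>\<alpha>. (if \<alpha> \<in> A then c \<alpha> else 0) + (if \<alpha> \<in> B then b \<alpha> else 0)"]) auto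
qed

lemma hpoly_sum:
  "finite I \<Longrightarrow> (\<And>i. i \<in> I \<Longrightarrow> f i \<in> hpoly l) \<Longrightarrow> (\<lambda>x. \<Sum>i\<in>I. f i x) \<in> hpoly l"
  by (induction I rule: finite_induct) (auto simp: hpoly_zero hpoly_add)

lemma hpoly_mult:
  assumes "p \<in> hpoly k" "q \<in> hpoly l"
  shows "(\<lambda>x. p x * q x) \<in> hpoly (k + l)"
proof -
  obtain A c where A: "finite A" "\<forall>\<alpha>\<in>A. (\<Sum>i\<in>UNIV. \<alpha> i) = k"
    and p: "p = (\<lambda>x. \<Sum>\<alpha>\<in>A. c \<alpha> * (\<Prod>i\<in>UNIV. (x $ i) ^ \<alpha> i))"
    using assms(1) unfolding hpoly_def by blast
  obtain B b where B: "finite B" "\<forall>\<alpha>\<in>B. (\<Sum>i\<in>UNIV. \<alpha> i) = l"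
    and q: "q = (\<lambda>x. \<Sum>\<alpha>\<in>B. b \<alpha> * (\<Prod>i\<in>UNIV. (x $ i) ^ \<alpha> i))"
    using assms(2) unfolding hpoly_def by blast
  have "(\<lambda>x. p x * q x) = (\<lambda>x. \<Sum>\<alpha>\<in>A. \<Sum>\<beta>\<in>B. c \<alpha> * b \<beta> * (\<Prod>i\<in>UNIV. (x $ i) ^ (\<alpha> i + \<beta> i)))"
    unfolding p q sum_product by (simp add: power_add prod.distrib mult_ac)
  moreover have "(\<lambda>x. \<Sum>\<alpha>\<in>A. \<Sum>\<beta>\<in>B. c \<alpha> * b \<beta> * (\<Prod>i\<in>UNIV. (x $ i) ^ (\<alpha> i + \<beta> i))) \<in> hpoly (k + l)"
    using A B by (intro hpoly_sum hpoly_monomial) (auto simp: sum.distrib)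
  ultimately show ?thesis by simp
qed

lemma hpoly_const: "(\<lambda>x. c) \<in> hpoly 0"
  using hpoly_monomial[of "\<lambda>_. 0" 0 c] by simp

lemma hpoly_cmult: "p \<in> hpoly l \<Longrightarrow> (\<lambda>x. c * p x) \<in> hpoly l"
  using hpoly_mult[OF hpoly_const] by fastforce

lemma hpoly_nth: "(\<lambda>x::real^'n::finite. x $ i) \<in> hpoly 1"
proof -
  have "(\<Prod>j\<in>UNIV. (x $ j) ^ (if j = i then 1 else 0)) = x $ i" for x :: "real^'n"
  proof -
    have "(\<Prod>j\<in>UNIV. (x $ j) ^ (if j = i then 1 else 0)) = (\<Prod>j\<in>UNIV. if j = i then x $ j else 1)"
      by (rule prod.cong) auto
    then show ?thesis by simp
  qed
  then show ?thesis
    using hpoly_monomial[of "\<lambda>j. if j = i then 1 else 0" 1 1] by simp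
qed

lemma hpoly_inner: "(\<lambda>x::real^'n::finite. x \<bullet> y) \<in> hpoly 1"
proof -
  have "(\<lambda>x. x \<bullet> y) = (\<lambda>x. \<Sum>i\<in>UNIV. y $ i * x $ i)"
    by (simp add: inner_vec_def mult.commute)
  then show ?thesis
    by (simp only:) (intro hpoly_sum hpoly_cmult hpoly_nth finite)
qed

lemma hpoly_norm2: "(\<lambda>x::real^'n::finite. x \<bullet> x) \<in> hpoly 2"
proof -
  have "(\<lambda>x::real^'n. x $ i * x $ i) \<in> hpoly 2" for i
    using hpoly_mult[OF hpoly_nth hpoly_nth, of i i] by (simp add: numeral_2_eq_2)
  then show ?thesis
    by (simp add: inner_vec_def hpoly_sum)
qed

lemma hpoly_zonal_poly: "zonal_poly a y n \<in> hpoly n"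
proof (induction n rule: less_induct)
  case (less n)
  consider "n = 0" | "n = Suc 0" | k where "n = Suc (Suc k)" by (metis not0_implies_Suc)
  then show ?case
  proof cases
    case 1
    have "zonal_poly a y 0 = (\<lambda>x. 1)" by auto
    then show ?thesis using 1 by (simp add: hpoly_const)
  next
    case 2
    have "zonal_poly a y (Suc 0) = (\<lambda>x. 2 * a * (x \<bullet> y))" by auto
    then show ?thesis using 2 hpoly_cmult[OF hpoly_inner] by simp
  next
    case 3
    have "(\<lambda>x. (x \<bullet> y) * zonal_poly a y (Suc k) x) \<in> hpoly n"
      using hpoly_mult[OF hpoly_inner less, of "Suc k"] 3 by simp
    moreover have "(\<lambda>x. (x \<bullet> x) * zonal_poly a y k x) \<in> hpoly n"
      using hpoly_mult[OF hpoly_norm2 less, of k] 3 by simp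
    ultimately show ?thesis
      unfolding 3 zonal_poly_Suc_Suc_fun by (intro hpoly_add hpoly_cmult)
  qed
qed

lemma rpf_hpoly: "p \<in> hpoly l \<Longrightarrow> real_polynomial_function p"
  unfolding hpoly_def
  by (auto intro!: real_polynomial_function_sum real_polynomial_function_prod
      real_polynomial_function_power rpf_mult rpf_const rpf_nth)

lemma homog_hpoly: "p \<in> hpoly l \<Longrightarrow> homog l p"
  unfolding hpoly_def homog_def
  by (auto simp: power_mult_distrib prod.distrib power_sum[symmetric] sum_distrib_left mult_ac intro!: sum.cong)

lemma deriv_deriv_eq_dir_deriv:
  fixes p :: "'a::real_normed_vector \<Rightarrow> real"
  assumes p: "real_polynomial_function p"
  shows "deriv (deriv (\<lambda>t. p (x + t *\<^sub>R v))) 0 = dir_deriv v (dir_deriv v p) x"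
proof -
  have "deriv (\<lambda>t. p (x + t *\<^sub>R v)) t = dir_deriv v p (x + t *\<^sub>R v)" for t
    by (rule DERIV_imp_deriv, rule DERIV_dir_deriv[OF p]) (auto intro!: derivative_eq_intros)
  then have "deriv (\<lambda>t. p (x + t *\<^sub>R v)) = (\<lambda>t. dir_deriv v p (x + t *\<^sub>R v))" by auto
  then show ?thesis by (simp add: dir_deriv_def)
qed

lemma hom_harm_poly_iff: "p \<in> hom_harm_poly l \<longleftrightarrow> p \<in> hpoly l \<and> (\<forall>x. lap p x = 0)"
proof -
  have "p \<in> hom_harm_poly l \<longleftrightarrow>
      p \<in> hpoly l \<and> (\<forall>x. (\<Sum>i\<in>UNIV. deriv (deriv (\<lambda>t. p (x + t *\<^sub>R axis i 1))) 0) = 0)"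
    unfolding hom_harm_poly_def hpoly_def by blast
  then show ?thesis
    using deriv_deriv_eq_dir_deriv[OF rpf_hpoly[of p l]] by (auto simp: lap_def)
qed

lemma hom_harm_poly_harmonic: "p \<in> hom_harm_poly l \<Longrightarrow> harmonic l p"
  using rpf_hpoly homog_hpoly by (auto simp: hom_harm_poly_iff harmonic_def)

section \<open>Spherical harmonics\<close>

lemma sph_harmE:
  assumes "g \<in> sph_harm l"
  obtains p where "harmonic l p" "\<And>x. norm x = 1 \<Longrightarrow> g x = p x" "\<And>x. norm x \<noteq> 1 \<Longrightarrow> g x = 0"
  using assms hom_harm_poly_harmonic unfolding sph_harm_def by (fastforce simp: sphere_def)

lemma sph_harm_zero: "(\<lambda>x::real^'n::finite. 0) \<in> sph_harm l"
proof -
  have "lap (\<lambda>x. 0 * 1) x = 0" for x :: "real^'n"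
    unfolding lap_cmult[OF rpf_const] by simp
  then have "(\<lambda>x::real^'n. 0) \<in> hom_harm_poly l"
    by (simp add: hom_harm_poly_iff hpoly_zero)
  then show ?thesis unfolding sph_harm_def by (intro CollectI bexI) auto
qed

lemma sph_harm_add:
  assumes "f \<in> sph_harm l" "g \<in> sph_harm l"
  shows "(\<lambda>x. f x + g x) \<in> sph_harm l"
proof -
  obtain p q where "p \<in> hom_harm_poly l" "f = (\<lambda>x. if x \<in> sphere 0 1 then p x else 0)"
    and "q \<in> hom_harm_poly l" "g = (\<lambda>x. if x \<in> sphere 0 1 then q x else 0)"
    using assms unfolding sph_harm_def by blast
  then show ?thesis unfolding sph_harm_def
    by (intro CollectI bexI[of _ "\<lambda>x. p x + q x"])
      (auto simp: hom_harm_poly_iff hpoly_add lap_add rpf_hpoly)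
qed

lemma sph_harm_cmult:
  assumes "f \<in> sph_harm l"
  shows "(\<lambda>x. c * f x) \<in> sph_harm l"
proof -
  obtain p where "p \<in> hom_harm_poly l" "f = (\<lambda>x. if x \<in> sphere 0 1 then p x else 0)"
    using assms unfolding sph_harm_def by blast
  then show ?thesis unfolding sph_harm_def
    by (intro CollectI bexI[of _ "\<lambda>x. c * p x"])
      (auto simp: hom_harm_poly_iff hpoly_cmult lap_cmult rpf_hpoly)
qed

lemma sph_harm_diff:
  assumes "f \<in> sph_harm l" "g \<in> sph_harm l"
  shows "(\<lambda>x. f x - g x) \<in> sph_harm l"
  using sph_harm_add[OF assms(1) sph_harm_cmult[OF assms(2), of "-1"]] by simp

lemma sph_harm_sum:
  "finite I \<Longrightarrow> (\<And>i. i \<in> I \<Longrightarrow> f i \<in> sph_harm l) \<Longrightarrow> (\<lambda>x. \<Sum>i\<in>I. f i x) \<in> sph_harm l"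
  by (induction I rule: finite_induct) (auto simp: sph_harm_zero sph_harm_add)

lemma continuous_on_sph_harm: "g \<in> sph_harm l \<Longrightarrow> continuous_on (sphere 0 1) g"
  by (erule sph_harmE, rule continuous_on_eq[OF continuous_on_rpf]) (auto simp: harmonic_def)

abbreviation zonal :: "nat \<Rightarrow> real^'n::finite \<Rightarrow> real^'n \<Rightarrow> real" where
  "zonal k y x \<equiv> G (CARD('n) - 1) k (x \<bullet> y)"

text \<open>On the unit sphere the Gegenbauer polynomial in x . y agrees with the solid harmonic
  \<open>zonal_poly\<close>, up to the normalization at 1.\<close>

lemma zonal_sph_harm:
  fixes y :: "real^'n::finite"
  assumes n: "CARD('n) \<ge> 3" and y: "norm y = 1"
  shows "(\<lambda>x. if x \<in> sphere 0 1 then zonal k y x else 0) \<in> sph_harm k"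
proof -
  define a where "a = (real (CARD('n) - 1) - 1) / 2"
  have a: "real CARD('n) = 2 * a + 2"
    using n by (simp add: a_def of_nat_diff field_simps)
  define p where "p = (\<lambda>x. (1 / gegenbauer a k 1) * zonal_poly a y k x)"
  have "p \<in> hom_harm_poly k"
    unfolding p_def hom_harm_poly_iff
    by (intro conjI allI hpoly_cmult hpoly_zonal_poly) (simp only: lap_cmult[OF rpf_zonal_poly] lap_zonal_poly[OF y a] mult_zero_right)
  moreover have "zonal k y x = p x" if "x \<in> sphere 0 1" for x
    using that by (simp add: p_def G_def zonal_poly_eq_gegenbauer a_def)
  ultimately show ?thesis
    unfolding sph_harm_def by (intro CollectI bexI[of _ p]) auto
qed

lemma continuous_on_zonal: "continuous_on S (\<lambda>x. zonal k y x)"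
  unfolding poly_Gpoly[symmetric] by (rule continuous_on_rpf) (rule rpf_poly_inner)

lemma funk_hecke_zonal:
  fixes y :: "real^'n::finite"
  assumes n: "CARD('n) \<ge> 3" and y: "norm y = 1" and g: "g \<in> sph_harm l"
  shows "(LINT x|sigma_d TYPE('n). zonal k y x * g x)
    = fh_multiplier (real CARD('n)) (Gpoly (CARD('n) - 1) k) l * g y"
proof -
  from g obtain p where p: "harmonic l p" "\<And>x. norm x = 1 \<Longrightarrow> g x = p x"
    by (rule sph_harmE) blast
  have "(LINT x|sigma_d TYPE('n). zonal k y x * g x)
      = (LINT x|sigma_d TYPE('n). poly (Gpoly (CARD('n) - 1) k) (x \<bullet> y) * p x)"
    by (rule Bochner_Integration.integral_cong) (use p in \<open>auto simp: poly_Gpoly\<close>)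
  also have "\<dots> = fh_multiplier (real CARD('n)) (Gpoly (CARD('n) - 1) k) l * g y"
    using funk_hecke[OF n y p(1)] p(2)[OF y] by simp
  finally show ?thesis .
qed

lemma zonal_self: "CARD('n::finite) \<ge> 3 \<Longrightarrow> norm (y::real^'n) = 1 \<Longrightarrow> zonal k y y = 1"
  using G_one[of "CARD('n) - 1" k] by (simp add: norm_eq_1)

lemma integral_zonal_zonal:
  fixes y z :: "real^'n::finite"
  assumes n: "CARD('n) \<ge> 3" and y: "norm y = 1" and z: "norm z = 1"
  shows "(LINT x|sigma_d TYPE('n). zonal k y x * zonal l z x)
    = fh_multiplier (real CARD('n)) (Gpoly (CARD('n) - 1) k) l * zonal l z y"
proof -
  have "(LINT x|sigma_d TYPE('n). zonal k y x * zonal l z x)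
    = (LINT x|sigma_d TYPE('n). zonal k y x * (if x \<in> sphere 0 1 then zonal l z x else 0))"
    by (rule Bochner_Integration.integral_cong) auto
  then show ?thesis
    using funk_hecke_zonal[OF n y zonal_sph_harm[OF n z]] y by simp
qed

text \<open>The integral of a product of two zonal functions with the same pole can be evaluated by
  Funk-Hecke from either factor, so the multiplier is symmetric in \<open>k\<close> and
  \<open>l\<close>. For the polynomial of smaller degree it vanishes.\<close>

lemma fh_multiplier_Gpoly_orthogonal:
  assumes n: "CARD('n::finite) \<ge> 3" and kl: "k \<noteq> l"
  shows "fh_multiplier (real CARD('n)) (Gpoly (CARD('n) - 1) k) l = 0"
proof -
  have lt: "fh_multiplier (real CARD('n)) (Gpoly (CARD('n) - 1) i) j = 0" if "i < j" for i j
    using that n degree_Gpoly[of "CARD('n) - 1" i] by (intro fh_multiplier_degree_less) simp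
  let ?y = "axis undefined 1 :: real^'n"
  have y: "norm ?y = 1" by simp
  have "fh_multiplier (real CARD('n)) (Gpoly (CARD('n) - 1) k) l
      = fh_multiplier (real CARD('n)) (Gpoly (CARD('n) - 1) l) k"
    using integral_zonal_zonal[OF n y y, of k l] integral_zonal_zonal[OF n y y, of l k] zonal_self[OF n y]
    by (simp add: mult.commute)
  then show ?thesis using kl lt[of k l] lt[of l k] by linarith
qed

text \<open>The squared L2 norm of a zonal function of degree \<open>k\<close>. It equals both h_k^2
  and 1/N(d,k), which is how averages, dimensions and kernels get linked.\<close>

definition zonal_sq :: "'n::finite itself \<Rightarrow> nat \<Rightarrow> real" where
  "zonal_sq _ k = fh_multiplier (real CARD('n)) (Gpoly (CARD('n) - 1) k) k"

lemma zonal_sq_pos: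
  assumes n: "CARD('n::finite) \<ge> 3"
  shows "zonal_sq TYPE('n) k > 0"
proof -
  let ?y = "axis undefined 1 :: real^'n"
  have y: "norm ?y = 1" by simp
  have eq: "zonal_sq TYPE('n) k = (LINT x|sigma_d TYPE('n). zonal k ?y x * zonal k ?y x)"
    using integral_zonal_zonal[OF n y y, of k k] zonal_self[OF n y] by (simp add: zonal_sq_def)
  have "zonal_sq TYPE('n) k \<ge> 0" unfolding eq by (rule integral_nonneg_AE) auto
  moreover have "zonal_sq TYPE('n) k \<noteq> 0"
  proof
    assume "zonal_sq TYPE('n) k = 0"
    then have "zonal k ?y ?y * zonal k ?y ?y = 0"
      unfolding eq by (intro sigma_d_integral_zero_imp[of "\<lambda>x. zonal k ?y x * zonal k ?y x"] continuous_intros continuous_on_zonal) auto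
    then show False using zonal_self[OF n y] by simp
  qed
  ultimately show ?thesis by simp
qed

lemma zonal_sq_eq_hsq:
  assumes n: "CARD('n::finite) \<ge> 3"
  shows "zonal_sq TYPE('n) k = hsq (CARD('n) - 1) k"
proof -
  let ?y = "axis undefined 1 :: real^'n"
  have y: "norm ?y = 1" by simp
  have "hsq (CARD('n) - 1) k = avg (CARD('n) - 1) (poly (Gpoly (CARD('n) - 1) k * Gpoly (CARD('n) - 1) k))"
  proof -
    have "(\<lambda>t. (G d k t)\<^sup>2) = poly (Gpoly d k * Gpoly d k)" for d
      by (simp add: fun_eq_iff poly_Gpoly power2_eq_square)
    then show ?thesis by (simp only: hsq_def)
  qed
  also have "\<dots> = (LINT x|sigma_d TYPE('n). zonal k ?y x * zonal k ?y x)"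
    unfolding avg_poly_eq_integral[OF n y] by (simp add: poly_Gpoly)
  also have "\<dots> = zonal_sq TYPE('n) k"
    using integral_zonal_zonal[OF n y y, of k k] zonal_self[OF n y] by (simp add: zonal_sq_def)
  finally show ?thesis ..
qed

lemma sph_harm_zero_outside: "g \<in> sph_harm l \<Longrightarrow> norm x \<noteq> 1 \<Longrightarrow> g x = 0"
  by (erule sph_harmE) blast

text \<open>On the sphere this is full support of the measure together with continuity; off the
  sphere members of \<open>sph_harm\<close> are 0 by their definition. Equality of functions, as
  uniqueness in \<open>Hproj\<close> demands, can thus be tested by an integral.\<close>

lemma sph_harm_eq_zero:
  fixes g :: "real^'n::finite \<Rightarrow> real"
  assumes g: "g \<in> sph_harm l" and 0: "(LINT x|sigma_d TYPE('n). g x * g x) = 0"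
  shows "g x = 0"
proof (cases "norm x = 1")
  case True
  then have "g x * g x = 0"
    using sigma_d_integral_zero_imp[of "\<lambda>x. g x * g x" x] 0 continuous_on_sph_harm[OF g]
    by (auto intro!: continuous_intros)
  then show ?thesis by simp
qed (use sph_harm_zero_outside[OF g] in auto)

section \<open>Orthonormal bases and the addition theorem\<close>

definition orthonormal_set :: "nat \<Rightarrow> (real^'n::finite \<Rightarrow> real) set \<Rightarrow> bool" where
  "orthonormal_set l B \<longleftrightarrow> finite B \<and> B \<subseteq> sph_harm l \<and>
     (\<forall>f\<in>B. \<forall>g\<in>B. (LINT x|sigma_d TYPE('n). f x * g x) = (if f = g then 1 else 0))"

lemma integrable_sph_harm_mult:
  fixes f g :: "real^'n::finite \<Rightarrow> real"
  assumes "continuous_on (sphere 0 1) f" "continuous_on (sphere 0 1) g"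
  shows "integrable (sigma_d TYPE('n)) (\<lambda>x. f x * g x)"
  by (intro integrable_sigma_d continuous_intros assms)

lemma integral_sum_orthonormal:
  fixes B :: "(real^'n::finite \<Rightarrow> real) set"
  assumes B: "orthonormal_set l B" and b: "b \<in> B"
  shows "(LINT x|sigma_d TYPE('n). (\<Sum>f\<in>B. u f * f x) * b x) = u b"
proof -
  have cont: "continuous_on (sphere 0 1) f" if "f \<in> B" for f
    using B that continuous_on_sph_harm by (auto simp: orthonormal_set_def)
  have fin: "finite B" using B by (simp add: orthonormal_set_def)
  have "(LINT x|sigma_d TYPE('n). (\<Sum>f\<in>B. u f * f x) * b x)
      = (LINT x|sigma_d TYPE('n). (\<Sum>f\<in>B. u f * (f x * b x)))"
    by (simp add: sum_distrib_right mult.assoc)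
  also have "\<dots> = (\<Sum>f\<in>B. u f * (LINT x|sigma_d TYPE('n). f x * b x))"
    using integrable_sph_harm_mult cont b by (subst Bochner_Integration.integral_sum) auto
  also have "\<dots> = (\<Sum>f\<in>B. if f = b then u f else 0)"
    using B b by (intro sum.cong) (auto simp: orthonormal_set_def)
  also have "\<dots> = u b"
    using fin b by simp
  finally show ?thesis .
qed

text \<open>Bessel's inequality for the zonal function with pole \<open>y\<close>: by Funk-Hecke its
  coefficient against \<open>b\<close> is kappa b(y), and its squared norm is kappa =
  \<open>zonal_sq\<close>. Dividing by kappa leaves a bound that holds for every orthonormal
  set.\<close>

lemma bessel_zonal:
  fixes B :: "(real^'n::finite \<Rightarrow> real) set"
  assumes n: "CARD('n) \<ge> 3" and B: "orthonormal_set l B" and y: "norm y = 1"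
  shows "zonal_sq TYPE('n) l * (\<Sum>b\<in>B. (b y)\<^sup>2) \<le> 1"
proof -
  let ?k = "zonal_sq TYPE('n) l" and ?I = "\<lambda>f. LINT x|sigma_d TYPE('n). f x"
  let ?p = "\<lambda>x. \<Sum>b\<in>B. b y * b x" and ?z = "zonal l y"
  have fin: "finite B" using B by (simp add: orthonormal_set_def)
  have sh: "b \<in> sph_harm l" if "b \<in> B" for b using B that by (auto simp: orthonormal_set_def)
  have cont: "continuous_on (sphere 0 1) b" if "b \<in> B" for b
    using sh[OF that] by (rule continuous_on_sph_harm)
  have cp: "continuous_on (sphere 0 1) ?p" by (intro continuous_intros cont)
  have cz: "continuous_on (sphere 0 1) ?z" by (rule continuous_on_zonal)
  have zb: "?I (\<lambda>x. ?z x * b x) = ?k * b y" if "b \<in> B" for b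
    using funk_hecke_zonal[OF n y sh[OF that], of l] by (simp add: zonal_sq_def)
  have zz: "?I (\<lambda>x. ?z x * ?z x) = ?k"
    using integral_zonal_zonal[OF n y y, of l l] zonal_self[OF n y] by (simp add: zonal_sq_def)
  have expand: "?I (\<lambda>x. f x * ?p x) = (\<Sum>b\<in>B. b y * ?I (\<lambda>x. f x * b x))"
    if f: "continuous_on (sphere 0 1) f" for f
  proof -
    have "?I (\<lambda>x. f x * ?p x) = ?I (\<lambda>x. \<Sum>b\<in>B. b y * (f x * b x))"
      by (simp add: sum_distrib_left mult_ac)
    also have "\<dots> = (\<Sum>b\<in>B. b y * ?I (\<lambda>x. f x * b x))"
      using integrable_sph_harm_mult[OF f cont] by (subst Bochner_Integration.integral_sum) auto
    finally show ?thesis .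
  qed
  have zp: "?I (\<lambda>x. ?z x * ?p x) = ?k * (\<Sum>b\<in>B. (b y)\<^sup>2)"
    using expand[OF cz] zb by (simp add: power2_eq_square sum_distrib_left mult_ac)
  have pp: "?I (\<lambda>x. ?p x * ?p x) = (\<Sum>b\<in>B. (b y)\<^sup>2)"
    using expand[OF cp] integral_sum_orthonormal[OF B, of _ "\<lambda>b. b y"] by (simp add: power2_eq_square)
  have "0 \<le> ?I (\<lambda>x. (?z x - ?k * ?p x)\<^sup>2)"
    by (rule integral_nonneg_AE) auto
  also have "\<dots> = ?I (\<lambda>x. ?z x * ?z x - 2 * ?k * (?z x * ?p x) + ?k\<^sup>2 * (?p x * ?p x))"
    by (rule Bochner_Integration.integral_cong) (auto simp: power2_eq_square algebra_simps)
  also have "\<dots> = ?I (\<lambda>x. ?z x * ?z x) - 2 * ?k * ?I (\<lambda>x. ?z x * ?p x) + ?k\<^sup>2 * ?I (\<lambda>x. ?p x * ?p x)"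
    using integrable_sph_harm_mult[OF cz cz] integrable_sph_harm_mult[OF cz cp]
      integrable_sph_harm_mult[OF cp cp] by simp
  also have "\<dots> = ?k * (1 - ?k * (\<Sum>b\<in>B. (b y)\<^sup>2))"
    unfolding zz zp pp by (simp add: power2_eq_square algebra_simps)
  finally show ?thesis
    using zonal_sq_pos[OF n, of l] by (simp add: zero_le_mult_iff)
qed

lemma integral_sum_squares_orthonormal:
  fixes B :: "(real^'n::finite \<Rightarrow> real) set"
  assumes B: "orthonormal_set l B"
  shows "(LINT y|sigma_d TYPE('n). (\<Sum>b\<in>B. (b y)\<^sup>2)) = real (card B)"
proof -
  have "(LINT y|sigma_d TYPE('n). (\<Sum>b\<in>B. (b y)\<^sup>2)) = (\<Sum>b\<in>B. LINT y|sigma_d TYPE('n). b y * b y)"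
    unfolding power2_eq_square using B
    by (intro Bochner_Integration.integral_sum integrable_sph_harm_mult continuous_on_sph_harm)
      (auto simp: orthonormal_set_def)
  also have "\<dots> = (\<Sum>b\<in>B. 1)"
    using B by (intro sum.cong) (auto simp: orthonormal_set_def)
  finally show ?thesis by simp
qed

lemma continuous_sum_squares_orthonormal:
  "orthonormal_set l B \<Longrightarrow> continuous_on (sphere 0 1) (\<lambda>y. \<Sum>b\<in>B. (b y)\<^sup>2)"
  by (intro continuous_intros continuous_on_sph_harm) (auto simp: orthonormal_set_def)

text \<open>Integrating Bessel's inequality over the pole counts the elements of \<open>B\<close>;
  this proves finite dimension without constructing a basis first.\<close>

lemma card_orthonormal_le:
  fixes B :: "(real^'n::finite \<Rightarrow> real) set"
  assumes n: "CARD('n) \<ge> 3" and B: "orthonormal_set l B"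
  shows "zonal_sq TYPE('n) l * real (card B) \<le> 1"
proof -
  let ?s = "\<lambda>y::real^'n. \<Sum>b\<in>B. (b y)\<^sup>2"
  have "(LINT y|sigma_d TYPE('n). zonal_sq TYPE('n) l * ?s y) \<le> (LINT y|sigma_d TYPE('n). 1)"
    using bessel_zonal[OF n B]
    by (intro integral_mono_AE integrable_sigma_d continuous_on_mult continuous_on_const
        continuous_sum_squares_orthonormal[OF B] AE_I2) auto
  then show ?thesis using integral_sum_squares_orthonormal[OF B] by simp
qed

text \<open>The Bessel inequality bounds the size of orthonormal sets, and one of maximal size is a basis.\<close>
lemma orthonormal_basis_exists:
  assumes n: "CARD('n::finite) \<ge> 3"
  obtains B :: "(real^'n \<Rightarrow> real) set" where "orthonormal_set l B"
    and "\<And>q x. q \<in> sph_harm l \<Longrightarrow> q x = (\<Sum>b\<in>B. (LINT x|sigma_d TYPE('n). q x * b x) * b x)"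
proof -
  let ?I = "\<lambda>f. LINT x|sigma_d TYPE('n). f x"
  define P where "P m \<longleftrightarrow> (\<exists>B :: (real^'n \<Rightarrow> real) set. orthonormal_set l B \<and> card B = m)" for m
  have "P 0" unfolding P_def by (rule exI[of _ "{}"]) (simp add: orthonormal_set_def)
  moreover have "m \<le> nat \<lceil>1 / zonal_sq TYPE('n) l\<rceil>" if "P m" for m
  proof -
    have "zonal_sq TYPE('n) l * real m \<le> 1" using that card_orthonormal_le[OF n] by (auto simp: P_def)
    then have "real m \<le> 1 / zonal_sq TYPE('n) l" using zonal_sq_pos[OF n, of l] by (simp add: field_simps)
    then show ?thesis by linarith
  qed
  ultimately obtain m where m: "P m" and max: "\<And>k. P k \<Longrightarrow> k \<le> m"
    using Nat.ex_has_greatest_nat[of P 0 "nat \<lceil>1 / zonal_sq TYPE('n) l\<rceil>"] by blast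
  then obtain B :: "(real^'n \<Rightarrow> real) set" where B: "orthonormal_set l B" and card: "card B = m"
    by (auto simp: P_def)
  have fin: "finite B" using B by (simp add: orthonormal_set_def)
  have "q x = (\<Sum>b\<in>B. ?I (\<lambda>x. q x * b x) * b x)" if q: "q \<in> sph_harm l" for q x
  proof -
    let ?p = "\<lambda>x. \<Sum>b\<in>B. ?I (\<lambda>x. q x * b x) * b x"
    define r where "r = (\<lambda>x. q x - ?p x)"
    have ps: "?p \<in> sph_harm l"
      using B by (intro sph_harm_sum sph_harm_cmult) (auto simp: orthonormal_set_def)
    have r: "r \<in> sph_harm l"
      unfolding r_def by (rule sph_harm_diff[OF q ps])
    have rb: "?I (\<lambda>x. r x * b x) = 0" if b: "b \<in> B" for b
    proof -
      have cb: "continuous_on (sphere 0 1) b"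
        using B b continuous_on_sph_harm by (auto simp: orthonormal_set_def)
      have "?I (\<lambda>x. r x * b x) = ?I (\<lambda>x. q x * b x - ?p x * b x)"
        by (simp add: r_def left_diff_distrib)
      also have "\<dots> = ?I (\<lambda>x. q x * b x) - ?I (\<lambda>x. ?p x * b x)"
        by (intro Bochner_Integration.integral_diff integrable_sph_harm_mult continuous_on_sph_harm[OF q]
            continuous_on_sph_harm[OF ps] cb)
      also have "\<dots> = 0"
        using integral_sum_orthonormal[OF B b] by simp
      finally show ?thesis .
    qed
    have "?I (\<lambda>x. r x * r x) = 0"
    proof (rule ccontr)
      assume ne: "?I (\<lambda>x. r x * r x) \<noteq> 0"
      have "?I (\<lambda>x. r x * r x) \<ge> 0" by (rule integral_nonneg_AE) auto
      with ne have pos: "?I (\<lambda>x. r x * r x) > 0" by linarith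
      \<comment> \<open>If the remainder \<open>r\<close> were nonzero, scaling it by
        \<open>c\<close> and adjoining it to \<open>B\<close> would give a larger orthonormal
        set.\<close>
      define c where "c = 1 / sqrt (?I (\<lambda>x. r x * r x))"
      define r' where "r' = (\<lambda>x. c * r x)"
      have r': "r' \<in> sph_harm l" unfolding r'_def by (rule sph_harm_cmult[OF r])
      have r'b: "?I (\<lambda>x. r' x * b x) = 0" "?I (\<lambda>x. b x * r' x) = 0" if "b \<in> B" for b
        using rb[OF that] by (simp_all add: r'_def mult_ac)
      have "?I (\<lambda>x. r' x * r' x) = c * c * ?I (\<lambda>x. r x * r x)"
        by (simp add: r'_def mult_ac)
      also have "\<dots> = 1" using pos by (simp add: c_def)
      finally have r'r': "?I (\<lambda>x. r' x * r' x) = 1" .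
      then have "r' \<notin> B" using r'b by fastforce
      moreover have "orthonormal_set l (insert r' B)"
        using B r' r'b r'r' \<open>r' \<notin> B\<close> unfolding orthonormal_set_def by auto
      ultimately have "P (Suc m)"
        unfolding P_def using card fin by (intro exI[of _ "insert r' B"]) auto
      then show False using max[of "Suc m"] by simp
    qed
    then have "r x = 0" by (rule sph_harm_eq_zero[OF r])
    then show ?thesis by (simp add: r_def)
  qed
  with B show ?thesis by (rule that)
qed

interpretation funs: vector_space "\<lambda>(c::real) (f::real^'n::finite \<Rightarrow> real) x. c * f x"
  by standard (auto simp: fun_eq_iff algebra_simps)

lemma sum_fun_apply: "(\<Sum>b\<in>B. f b) x = (\<Sum>b\<in>B. f b x :: real)"
  by (induction B rule: infinite_finite_induct) auto

text \<open>\<open>Ndim\<close> is an abstract dimension, so \<open>B\<close> has to be seen to be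
  independent and spanning. Integrating a linear relation against \<open>b\<close> isolates the
  coefficient of \<open>b\<close>.\<close>

lemma Ndim_eq_card:
  fixes B :: "(real^'n::finite \<Rightarrow> real) set"
  assumes B: "orthonormal_set l B"
    and basis: "\<And>q x. q \<in> sph_harm l \<Longrightarrow> q x = (\<Sum>b\<in>B. (LINT x|sigma_d TYPE('n). q x * b x) * b x)"
  shows "Ndim TYPE('n) l = card B"
proof -
  have fin: "finite B" and sub: "B \<subseteq> sph_harm l" using B by (auto simp: orthonormal_set_def)
  have "funs.independent B"
    unfolding funs.dependent_finite[OF fin]
  proof clarify
    fix u b assume "(\<Sum>v\<in>B. (\<lambda>x. u v * v x)) = 0" and b: "b \<in> B" "u b \<noteq> 0"
    then have "(\<Sum>v\<in>B. u v * v x) = 0" for x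
      by (metis (no_types, lifting) sum.cong sum_fun_apply zero_fun_apply)
    then have "(LINT x|sigma_d TYPE('n). (\<Sum>f\<in>B. u f * f x) * b x) = 0" by simp
    then show False using integral_sum_orthonormal[OF B b(1), of u] b(2) by simp
  qed
  moreover have "sph_harm l \<subseteq> funs.span B"
  proof
    fix q :: "real^'n \<Rightarrow> real" assume q: "q \<in> sph_harm l"
    have "q = (\<Sum>b\<in>B. (\<lambda>x. (LINT x|sigma_d TYPE('n). q x * b x) * b x))"
      unfolding fun_eq_iff sum_fun_apply by (intro allI basis[OF q])
    also have "\<dots> \<in> funs.span B"
      by (intro funs.span_sum funs.span_scale funs.span_base)
    finally show "q \<in> funs.span B" .
  qed
  ultimately show ?thesis
    unfolding Ndim_def using funs.dim_unique[OF sub] by blast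
qed

text \<open>Expand the zonal function with pole \<open>y\<close> in an orthonormal basis; Funk-Hecke
  computes the coefficient of \<open>b\<close> as \<open>zonal_sq\<close> times b(y).\<close>

lemma addition_theorem:
  assumes n: "CARD('n::finite) \<ge> 3"
  obtains B :: "(real^'n \<Rightarrow> real) set" where "finite B"
    and "\<And>b. b \<in> B \<Longrightarrow> continuous_on (sphere 0 1) b"
    and "\<And>x y. norm x = 1 \<Longrightarrow> norm y = 1 \<Longrightarrow> zonal l y x = zonal_sq TYPE('n) l * (\<Sum>b\<in>B. b x * b y)"
    and "zonal_sq TYPE('n) l * real (Ndim TYPE('n) l) = 1"
proof -
  obtain B :: "(real^'n \<Rightarrow> real) set" where B: "orthonormal_set l B"
    and basis: "\<And>q x. q \<in> sph_harm l \<Longrightarrow> q x = (\<Sum>b\<in>B. (LINT x|sigma_d TYPE('n). q x * b x) * b x)"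
    using orthonormal_basis_exists[OF n] by blast
  have add: "zonal l y x = zonal_sq TYPE('n) l * (\<Sum>b\<in>B. b x * b y)" if x: "norm x = 1" and y: "norm y = 1" for x y :: "real^'n"
  proof -
    let ?q = "\<lambda>x. if x \<in> sphere 0 1 then zonal l y x else 0"
    have "(LINT x|sigma_d TYPE('n). ?q x * b x) = zonal_sq TYPE('n) l * b y" if "b \<in> B" for b
    proof -
      have "(LINT x|sigma_d TYPE('n). ?q x * b x) = (LINT x|sigma_d TYPE('n). zonal l y x * b x)"
        by (rule Bochner_Integration.integral_cong) auto
      also have "\<dots> = zonal_sq TYPE('n) l * b y"
        using funk_hecke_zonal[OF n y, of b l l] B that by (auto simp: orthonormal_set_def zonal_sq_def)
      finally show ?thesis .
    qed
    then have "?q x = (\<Sum>b\<in>B. zonal_sq TYPE('n) l * b y * b x)"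
      using basis[OF zonal_sph_harm[OF n y], of x] by simp
    then show ?thesis using x by (simp add: sum_distrib_left mult_ac)
  qed
  \<comment> \<open>On the diagonal the zonal function is 1, so integrating over \<open>y\<close>
    relates \<open>zonal_sq\<close> to the size of the basis.\<close>
  have "(LINT y|sigma_d TYPE('n). zonal_sq TYPE('n) l * (\<Sum>b\<in>B. (b y)\<^sup>2)) = (LINT y|sigma_d TYPE('n). 1)"
  proof (rule Bochner_Integration.integral_cong)
    fix y assume "y \<in> space (sigma_d TYPE('n))"
    then have "norm y = 1" by simp
    then show "zonal_sq TYPE('n) l * (\<Sum>b\<in>B. (b y)\<^sup>2) = 1"
      using add[of y y] zonal_self[OF n, of y l] by (simp add: power2_eq_square)
  qed simp
  then have "zonal_sq TYPE('n) l * real (Ndim TYPE('n) l) = 1"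
    using integral_sum_squares_orthonormal[OF B] Ndim_eq_card[OF B basis] by simp
  moreover have "continuous_on (sphere 0 1) b" if "b \<in> B" for b
    using B that continuous_on_sph_harm by (auto simp: orthonormal_set_def)
  moreover have "finite B" using B by (simp add: orthonormal_set_def)
  ultimately show ?thesis
    using that[of B] add by blast
qed

text \<open>By the addition theorem the form is a positive multiple of the sum over \<open>b\<close>
  of (sum_i c_i b(x_i))^2.\<close>

lemma zonal_psd:
  fixes x :: "'i \<Rightarrow> real^'n::finite"
  assumes n: "CARD('n) \<ge> 3" and x: "\<And>i. i \<in> I \<Longrightarrow> norm (x i) = 1"
  shows "(\<Sum>i\<in>I. \<Sum>j\<in>I. c i * c j * zonal l (x j) (x i)) \<ge> 0"
proof -
  obtain B :: "(real^'n \<Rightarrow> real) set" where B: "finite B"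
    "\<And>b. b \<in> B \<Longrightarrow> continuous_on (sphere 0 1) b"
    "\<And>x y. norm x = 1 \<Longrightarrow> norm y = 1 \<Longrightarrow> zonal l y x = zonal_sq TYPE('n) l * (\<Sum>b\<in>B. b x * b y)"
    "zonal_sq TYPE('n) l * real (Ndim TYPE('n) l) = 1"
    by (rule addition_theorem[OF n, where l = l]) (rule that)
  have "(\<Sum>i\<in>I. \<Sum>j\<in>I. c i * c j * zonal l (x j) (x i))
      = (\<Sum>i\<in>I. \<Sum>j\<in>I. \<Sum>b\<in>B. zonal_sq TYPE('n) l * ((c i * b (x i)) * (c j * b (x j))))"
    by (intro sum.cong refl) (simp add: B(3)[OF x x] sum_distrib_left mult_ac del: One_nat_def)
  also have "\<dots> = (\<Sum>i\<in>I. \<Sum>b\<in>B. \<Sum>j\<in>I. zonal_sq TYPE('n) l * ((c i * b (x i)) * (c j * b (x j))))"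
    by (intro sum.cong refl sum.swap)
  also have "\<dots> = (\<Sum>b\<in>B. \<Sum>i\<in>I. \<Sum>j\<in>I. zonal_sq TYPE('n) l * ((c i * b (x i)) * (c j * b (x j))))"
    by (rule sum.swap)
  also have "\<dots> = (\<Sum>b\<in>B. zonal_sq TYPE('n) l * (\<Sum>i\<in>I. c i * b (x i))\<^sup>2)"
    unfolding power2_eq_square sum_product unfolding sum_distrib_left ..
  also have "\<dots> \<ge> 0"
    using zonal_sq_pos[OF n, of l] by (intro sum_nonneg mult_nonneg_nonneg) auto
  finally show ?thesis .
qed

section \<open>Linearization coefficients\<close>

text \<open>Multiplying three addition theorems writes the product of the kernels as a positive
  multiple of a sum of m(x) m(y), where m is a product of three basis functions. Integrated in both
  variables, each term is a square.\<close>

lemma avg_Gpoly3_nonneg: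
  assumes n: "CARD('n::finite) \<ge> 3"
  shows "avg (CARD('n) - 1) (\<lambda>t. G (CARD('n) - 1) l t * G (CARD('n) - 1) s t * G (CARD('n) - 1) k t) \<ge> 0"
    (is "?A \<ge> 0")
proof -
  let ?I = "\<lambda>f. LINT x|sigma_d TYPE('n). f x" and ?d = "CARD('n) - 1"
  obtain B1 :: "(real^'n \<Rightarrow> real) set" where B1: "finite B1"
    "\<And>b. b \<in> B1 \<Longrightarrow> continuous_on (sphere 0 1) b"
    "\<And>x y. norm x = 1 \<Longrightarrow> norm y = 1 \<Longrightarrow> zonal l y x = zonal_sq TYPE('n) l * (\<Sum>b\<in>B1. b x * b y)"
    "zonal_sq TYPE('n) l * real (Ndim TYPE('n) l) = 1"
    by (rule addition_theorem[OF n, where l = l]) (rule that)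
  obtain B2 :: "(real^'n \<Rightarrow> real) set" where B2: "finite B2"
    "\<And>b. b \<in> B2 \<Longrightarrow> continuous_on (sphere 0 1) b"
    "\<And>x y. norm x = 1 \<Longrightarrow> norm y = 1 \<Longrightarrow> zonal s y x = zonal_sq TYPE('n) s * (\<Sum>b\<in>B2. b x * b y)"
    "zonal_sq TYPE('n) s * real (Ndim TYPE('n) s) = 1"
    by (rule addition_theorem[OF n, where l = s]) (rule that)
  obtain B3 :: "(real^'n \<Rightarrow> real) set" where B3: "finite B3"
    "\<And>b. b \<in> B3 \<Longrightarrow> continuous_on (sphere 0 1) b"
    "\<And>x y. norm x = 1 \<Longrightarrow> norm y = 1 \<Longrightarrow> zonal k y x = zonal_sq TYPE('n) k * (\<Sum>b\<in>B3. b x * b y)"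
    "zonal_sq TYPE('n) k * real (Ndim TYPE('n) k) = 1"
    by (rule addition_theorem[OF n, where l = k]) (rule that)
  define K where "K = zonal_sq TYPE('n) l * zonal_sq TYPE('n) s * zonal_sq TYPE('n) k"
  have K: "K > 0" using zonal_sq_pos[OF n] by (simp add: K_def)
  define m where "m t x = fst t x * fst (snd t) x * snd (snd t) x"
    for t :: "(real^'n \<Rightarrow> real) \<times> (real^'n \<Rightarrow> real) \<times> (real^'n \<Rightarrow> real)" and x
  let ?T = "B1 \<times> B2 \<times> B3"
  have cm: "continuous_on (sphere 0 1) (m t)" if "t \<in> ?T" for t
    unfolding m_def using that B1(2) B2(2) B3(2) by (intro continuous_intros) auto
  have prod: "zonal l y x * zonal s y x * zonal k y x = K * (\<Sum>t\<in>?T. m t x * m t y)"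
    if "norm x = 1" "norm y = 1" for x y :: "real^'n"
  proof -
    have "(\<Sum>t\<in>?T. m t x * m t y)
        = (\<Sum>b1\<in>B1. \<Sum>b2\<in>B2. \<Sum>b3\<in>B3. (b1 x * b1 y) * ((b2 x * b2 y) * (b3 x * b3 y)))"
      by (simp add: m_def sum.cartesian_product case_prod_beta mult_ac)
    also have "\<dots> = (\<Sum>b\<in>B1. b x * b y) * ((\<Sum>b\<in>B2. b x * b y) * (\<Sum>b\<in>B3. b x * b y))"
      unfolding sum_product unfolding sum_distrib_left ..
    finally show ?thesis
      using B1(3)[OF that] B2(3)[OF that] B3(3)[OF that] by (simp add: K_def mult_ac)
  qed
  have A: "?A = K * (\<Sum>t\<in>?T. m t y * ?I (m t))" if y: "norm y = 1" for y :: "real^'n"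
  proof -
    have "?A = avg ?d (poly (Gpoly ?d l * Gpoly ?d s * Gpoly ?d k))"
      by (rule arg_cong[where f = "avg _"]) (simp add: fun_eq_iff poly_Gpoly)
    also have "\<dots> = ?I (\<lambda>x. zonal l y x * zonal s y x * zonal k y x)"
      unfolding avg_poly_eq_integral[OF n y] by (simp add: poly_Gpoly)
    also have "\<dots> = ?I (\<lambda>x. K * (\<Sum>t\<in>?T. m t y * m t x))"
      by (rule Bochner_Integration.integral_cong) (use prod y in \<open>auto simp: mult.commute\<close>)
    also have "\<dots> = K * (\<Sum>t\<in>?T. m t y * ?I (m t))"
      using integrable_sigma_d[OF cm] by (simp add: Bochner_Integration.integral_sum)
    finally show ?thesis .
  qed
  \<comment> \<open>The average does not depend on the pole \<open>y\<close>, so it may be averaged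
    over \<open>y\<close> once more.\<close>
  have "?A = ?I (\<lambda>y. ?A)" by simp
  also have "\<dots> = ?I (\<lambda>y. K * (\<Sum>t\<in>?T. m t y * ?I (m t)))"
    by (rule Bochner_Integration.integral_cong) (use A in auto)
  also have "\<dots> = K * (\<Sum>t\<in>?T. ?I (m t) * ?I (m t))"
    using integrable_sigma_d[OF cm] by (simp add: Bochner_Integration.integral_sum)
  also have "\<dots> \<ge> 0" using K by (intro mult_nonneg_nonneg sum_nonneg zero_le_square) auto
  finally show ?thesis .
qed

lemma Ccoef_nonneg:
  assumes n: "CARD('n::finite) \<ge> 3"
  shows "Ccoef (CARD('n) - 1) l s k \<ge> 0"
  unfolding Ccoef_def zonal_sq_eq_hsq[OF n, symmetric]
  using avg_Gpoly3_nonneg[OF n] zonal_sq_pos[OF n, of k] by (intro divide_nonneg_pos)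

lemma poly_in_span_Gpoly:
  assumes d: "d \<ge> 2" and p: "degree p \<le> m"
  shows "\<exists>b. p = (\<Sum>k\<le>m. smult (b k) (Gpoly d k))"
  using p
proof (induction m arbitrary: p)
  case 0
  have "degree (Gpoly d 0) = 0" by (rule degree_Gpoly[OF d])
  then obtain g where g: "Gpoly d 0 = [:g:]" by (rule degree_eq_zeroE)
  moreover have "g = 1" using poly_Gpoly[of d 0 1] G_one[OF d, of 0] g by simp
  moreover obtain c where "p = [:c:]" using 0 degree_eq_zeroE by blast
  ultimately show ?case by (intro exI[of _ "\<lambda>_. c"]) simp
next
  case (Suc m)
  let ?g = "Gpoly d (Suc m)"
  have g: "coeff ?g (Suc m) \<noteq> 0"
    using degree_Gpoly[OF d, of "Suc m"] by (metis degree_0 leading_coeff_0_iff nat.simps(3))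
  define c where "c = coeff p (Suc m) / coeff ?g (Suc m)"
  have "degree (p - smult c ?g) \<le> m"
  proof (rule degree_le, intro allI impI)
    fix i assume "m < i"
    then consider "i = Suc m" | "i > Suc m" by linarith
    then show "coeff (p - smult c ?g) i = 0"
    proof cases
      case 1
      then show ?thesis using g by (simp add: c_def)
    next
      case 2
      then show ?thesis using Suc.prems degree_Gpoly[OF d, of "Suc m"] by (simp add: coeff_eq_0)
    qed
  qed
  from Suc.IH[OF this] obtain b where b: "p - smult c ?g = (\<Sum>k\<le>m. smult (b k) (Gpoly d k))" by blast
  have "p = (\<Sum>k\<le>m. smult (b k) (Gpoly d k)) + smult c ?g"
    unfolding b[symmetric] by simp
  also have "\<dots> = (\<Sum>k\<le>Suc m. smult ((b(Suc m := c)) k) (Gpoly d k))"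
    by simp
  finally show ?case by blast
qed

text \<open>By degree the product lies in the span of the first \<open>M + 1\<close> polynomials,
  and orthogonality on the sphere identifies the coefficients. Any \<open>M\<close> from
  \<open>l + s\<close> on is allowed, so that one range of summation serves many pairs.\<close>

lemma Ccoef_linearization:
  assumes n: "CARD('n::finite) \<ge> 3" and M: "l + s \<le> M"
  shows "(\<Sum>k\<le>M. Ccoef (CARD('n) - 1) l s k * G (CARD('n) - 1) k t)
      = G (CARD('n) - 1) l t * G (CARD('n) - 1) s t"
proof -
  let ?d = "CARD('n) - 1" and ?I = "\<lambda>f. LINT x|sigma_d TYPE('n). f x"
  have d: "?d \<ge> 2" using n by simp
  let ?p = "Gpoly ?d l * Gpoly ?d s"
  have "degree ?p \<le> M"
    using degree_mult_le[of "Gpoly ?d l" "Gpoly ?d s"] degree_Gpoly[OF d] M by simp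
  then obtain b where b: "?p = (\<Sum>k\<le>M. smult (b k) (Gpoly ?d k))"
    using poly_in_span_Gpoly[OF d] by blast
  have pt: "G ?d l t * G ?d s t = (\<Sum>k\<le>M. b k * G ?d k t)" for t
    using arg_cong[OF b, of "\<lambda>p. poly p t"] by (simp add: poly_sum poly_Gpoly)
  have "Ccoef ?d l s k = b k" if k: "k \<le> M" for k
  proof -
    let ?y = "axis undefined 1 :: real^'n"
    have y: "norm ?y = 1" by simp
    have "avg ?d (\<lambda>t. G ?d l t * G ?d s t * G ?d k t) = avg ?d (poly (?p * Gpoly ?d k))"
      by (rule arg_cong[where f = "avg _"]) (simp add: fun_eq_iff poly_Gpoly)
    also have "\<dots> = ?I (\<lambda>x. poly (?p * Gpoly ?d k) (x \<bullet> ?y))"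
      by (rule avg_poly_eq_integral[OF n y])
    also have "\<dots> = ?I (\<lambda>x. \<Sum>j\<le>M. b j * (zonal j ?y x * zonal k ?y x))"
      unfolding poly_mult poly_Gpoly pt by (simp only: sum_distrib_right mult.assoc)
    also have "\<dots> = (\<Sum>j\<le>M. b j * ?I (\<lambda>x. zonal j ?y x * zonal k ?y x))"
      using integrable_sph_harm_mult[OF continuous_on_zonal continuous_on_zonal]
      by (subst Bochner_Integration.integral_sum) auto
    also have "\<dots> = (\<Sum>j\<le>M. if j = k then b j * zonal_sq TYPE('n) j else 0)"
      unfolding integral_zonal_zonal[OF n y y] zonal_self[OF n y]
      by (intro sum.cong refl) (simp add: zonal_sq_def fh_multiplier_Gpoly_orthogonal[OF n] del: One_nat_def)
    also have "\<dots> = b k * hsq ?d k"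
      using k by (simp add: zonal_sq_eq_hsq[OF n])
    finally show ?thesis
      using zonal_sq_pos[OF n, of k] by (simp add: Ccoef_def zonal_sq_eq_hsq[OF n])
  qed
  then show ?thesis unfolding pt by simp
qed

text \<open>Evaluate the linearization at t = 1, where every G is 1, and drop nonnegative
  terms.\<close>

lemma sum_Ccoef_le_one:
  assumes n: "CARD('n::finite) \<ge> 3"
  shows "(\<Sum>k\<le>K. Ccoef (CARD('n) - 1) l s k) \<le> 1"
proof -
  have "(\<Sum>k\<le>K. Ccoef (CARD('n) - 1) l s k) \<le> (\<Sum>k\<le>K + l + s. Ccoef (CARD('n) - 1) l s k)"
    by (intro sum_mono2 Ccoef_nonneg[OF n]) auto
  also have "\<dots> = 1"
    using Ccoef_linearization[OF n, of l s "K + l + s" 1] n by (simp add: G_one)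
  finally show ?thesis .
qed

section \<open>Schur squares of positive semidefinite matrices\<close>

lemma quadratic_form_insert:
  fixes M :: "'i \<Rightarrow> 'i \<Rightarrow> real"
  assumes "finite I" "a \<notin> I" and sym: "\<And>i. i \<in> I \<Longrightarrow> M i a = M a i"
  shows "(\<Sum>i\<in>insert a I. \<Sum>j\<in>insert a I. (c(a := t)) i * (c(a := t)) j * M i j)
    = t\<^sup>2 * M a a + 2 * t * (\<Sum>i\<in>I. c i * M a i) + (\<Sum>i\<in>I. \<Sum>j\<in>I. c i * c j * M i j)"
proof -
  have "(\<Sum>j\<in>insert a I. (c(a := t)) i * (c(a := t)) j * M i j)
      = (c(a := t)) i * t * M i a + (\<Sum>j\<in>I. (c(a := t)) i * c j * M i j)" for i
  proof -
    have "(\<Sum>j\<in>I. (c(a := t)) i * (c(a := t)) j * M i j) = (\<Sum>j\<in>I. (c(a := t)) i * c j * M i j)"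
      using assms(2) by (intro sum.cong) auto
    then show ?thesis using assms(1,2) by simp
  qed
  then have "(\<Sum>i\<in>insert a I. \<Sum>j\<in>insert a I. (c(a := t)) i * (c(a := t)) j * M i j)
    = (t * t * M a a + (\<Sum>j\<in>I. t * c j * M a j))
      + (\<Sum>i\<in>I. (c(a := t)) i * t * M i a + (\<Sum>j\<in>I. (c(a := t)) i * c j * M i j))"
    using assms(1,2) by simp
  also have "(\<Sum>i\<in>I. (c(a := t)) i * t * M i a + (\<Sum>j\<in>I. (c(a := t)) i * c j * M i j))
    = (\<Sum>i\<in>I. t * c i * M a i + (\<Sum>j\<in>I. c i * c j * M i j))"
    using assms(2) sym by (intro sum.cong) auto
  finally show ?thesis
    by (simp add: sum.distrib sum_distrib_left power2_eq_square mult.assoc)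
qed

text \<open>Induction with one Cholesky step: subtracting the rank-one part with entries v i v j
  clears the row of \<open>a\<close>, and what is left stays positive semidefinite. It matters that
  the number of vectors is |I|, since this number becomes the n in the final bound.\<close>

lemma psd_gram:
  fixes M :: "'i \<Rightarrow> 'i \<Rightarrow> real"
  assumes "finite I"
    and "\<And>i j. i \<in> I \<Longrightarrow> j \<in> I \<Longrightarrow> M i j = M j i"
    and "\<And>c. (\<Sum>i\<in>I. \<Sum>j\<in>I. c i * c j * M i j) \<ge> 0"
  shows "\<exists>u. \<forall>i\<in>I. \<forall>j\<in>I. M i j = (\<Sum>k\<in>I. u k i * u k j)"
  using assms
proof (induction I arbitrary: M rule: finite_induct)
  case (insert a I)
  have sym: "M i j = M j i" if "i \<in> insert a I" "j \<in> insert a I" for i j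
    using insert.prems(1) that by blast
  have psd: "t\<^sup>2 * M a a + 2 * t * (\<Sum>i\<in>I. c i * M a i) + (\<Sum>i\<in>I. \<Sum>j\<in>I. c i * c j * M i j) \<ge> 0" for c t
    using insert.prems(2)[of "c(a := t)"] quadratic_form_insert[OF insert.hyps(1,2), of M c t] sym by simp
  have Maa: "M a a \<ge> 0" using psd[of 1 "\<lambda>_. 0"] by simp
  \<comment> \<open>Cholesky step; if $M_{aa} = 0$, then $v = 0$ because of $x / 0 = 0$, and the row of $a$ vanishes.\<close>
  define v where "v i = M a i / sqrt (M a a)" for i
  have va: "M a i = v a * v i" if i: "i \<in> insert a I" for i
  proof (cases "M a a = 0")
    case False
    then show ?thesis using Maa by (simp add: v_def)
  next
    case True
    show ?thesis
    proof (cases "i = a")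
      case False
      then have iI: "i \<in> I" using i by simp
      let ?e = "\<lambda>j. if j = i then 1 else (0::real)"
      have l: "(\<Sum>j\<in>I. ?e j * M a j) = M a i"
        using iI insert.hyps(1) by (simp add: if_distrib[of "\<lambda>x. x * _"] cong: if_cong)
      define q where "q = (\<Sum>j\<in>I. \<Sum>k\<in>I. ?e j * ?e k * M j k)"
      have *: "2 * t * M a i + q \<ge> 0" for t
        using psd[of t ?e] True unfolding l q_def by simp
      have "M a i = 0"
      proof (rule ccontr)
        assume ne: "M a i \<noteq> 0"
        \<comment> \<open>With M a a = 0 the form is affine in \<open>t\<close>; this
          \<open>t\<close> gives it the value -1.\<close>
        show False using *[of "- (q + 1) / (2 * M a i)"] ne by (simp add: field_simps)
      qed
      then show ?thesis by (simp add: v_def)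
    qed (simp add: True v_def)
  qed
  define M' where "M' i j = M i j - v i * v j" for i j
  have "\<exists>u. \<forall>i\<in>I. \<forall>j\<in>I. M' i j = (\<Sum>k\<in>I. u k i * u k j)"
  proof (rule insert.IH)
    show "M' i j = M' j i" if "i \<in> I" "j \<in> I" for i j
      using sym[of i j] that by (simp add: M'_def)
    fix c :: "'i \<Rightarrow> real"
    let ?s = "\<Sum>i\<in>I. c i * v i"
    have s: "(\<Sum>i\<in>I. c i * M a i) = v a * ?s"
      using va by (simp add: sum_distrib_left mult_ac)
    have vv: "M a a = (v a)\<^sup>2" using va[of a] by (simp add: power2_eq_square)
    have "(\<Sum>i\<in>I. \<Sum>j\<in>I. c i * c j * M' i j) = (\<Sum>i\<in>I. \<Sum>j\<in>I. c i * c j * M i j) - ?s\<^sup>2"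
      by (simp add: M'_def power2_eq_square sum_product sum_subtractf algebra_simps)
    moreover have "(\<Sum>i\<in>I. \<Sum>j\<in>I. c i * c j * M i j) - ?s\<^sup>2 \<ge> 0"
    proof (cases "v a = 0")
      case True
      then have "M a a = 0" using vv by simp
      then have "?s = 0" by (simp add: v_def)
      then show ?thesis using psd[of 0 c] by simp
    next
      case False
      \<comment> \<open>Completing the square: this \<open>t\<close> minimizes the form of the
        extended matrix, and the minimum is the form of \<open>M'\<close>.\<close>
      have "(- ?s / v a)\<^sup>2 * M a a + 2 * (- ?s / v a) * (v a * ?s) = - ?s\<^sup>2"
        unfolding vv using False by (simp add: power2_eq_square)
      then show ?thesis using psd[of "- ?s / v a" c] unfolding s by linarith
    qed
    ultimately show "(\<Sum>i\<in>I. \<Sum>j\<in>I. c i * c j * M' i j) \<ge> 0" by simp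
  qed
  then obtain u where u: "\<And>i j. i \<in> I \<Longrightarrow> j \<in> I \<Longrightarrow> M' i j = (\<Sum>k\<in>I. u k i * u k j)" by blast
  \<comment> \<open>The row of \<open>a\<close> is carried by \<open>v\<close> alone, so the vectors
    of the smaller matrix are extended by 0 at \<open>a\<close>.\<close>
  define w where "w k i = (if k = a then v i else if i = a then 0 else u k i)" for k i
  have "M i j = (\<Sum>k\<in>insert a I. w k i * w k j)" if ij: "i \<in> insert a I" "j \<in> insert a I" for i j
  proof -
    have "(\<Sum>k\<in>insert a I. w k i * w k j) = v i * v j + (\<Sum>k\<in>I. w k i * w k j)"
      using insert.hyps by (simp add: w_def)
    also have "(\<Sum>k\<in>I. w k i * w k j) = M i j - v i * v j"
    proof (cases "i = a \<or> j = a")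
      case True
      then have "M i j = v i * v j"
      proof (cases "i = a")
        case True
        then show ?thesis using va[OF ij(2)] by simp
      next
        case False
        with True have "j = a" by simp
        then show ?thesis using va[OF ij(1)] sym[OF ij] by (simp add: mult.commute)
      qed
      moreover have "(\<Sum>k\<in>I. w k i * w k j) = 0"
        using True insert.hyps by (intro sum.neutral) (auto simp: w_def)
      ultimately show ?thesis by simp
    next
      case False
      then have "(\<Sum>k\<in>I. w k i * w k j) = (\<Sum>k\<in>I. u k i * u k j)"
        using insert.hyps by (intro sum.cong) (auto simp: w_def)
      then show ?thesis using False ij u[of i j] by (simp add: M'_def)
    qed
    finally show ?thesis by simp
  qed
  then show ?case by blast
qed simp

text \<open>Vyb\'iral's bound: in a Gram factorization by $|I|$ vectors $u_k$, the quadratic form of the Schur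
  square is $\sum_{k,k'} (\sum_i c_i u_k(i) u_{k'}(i))^2$; keep only the diagonal $k = k'$.\<close>
lemma schur_square_lower_bound:
  fixes M :: "'i \<Rightarrow> 'i \<Rightarrow> real"
  assumes fin: "finite I"
    and sym: "\<And>i j. i \<in> I \<Longrightarrow> j \<in> I \<Longrightarrow> M i j = M j i"
    and psd: "\<And>c. (\<Sum>i\<in>I. \<Sum>j\<in>I. c i * c j * M i j) \<ge> 0"
  shows "(\<Sum>i\<in>I. c i * M i i)\<^sup>2 \<le> (\<Sum>i\<in>I. \<Sum>j\<in>I. c i * c j * (M i j)\<^sup>2) * real (card I)"
proof -
  obtain u where "\<forall>i\<in>I. \<forall>j\<in>I. M i j = (\<Sum>k\<in>I. u k i * u k j)"
    using psd_gram[of I M, OF fin sym psd] by blast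
  then have u: "M i j = (\<Sum>k\<in>I. u k i * u k j)" if "i \<in> I" "j \<in> I" for i j
    using that by blast
  define A where "A k k' = (\<Sum>i\<in>I. c i * u k i * u k' i)" for k k'
  have diag: "(\<Sum>i\<in>I. c i * M i i) = (\<Sum>k\<in>I. A k k)"
  proof -
    have "(\<Sum>i\<in>I. c i * M i i) = (\<Sum>i\<in>I. \<Sum>k\<in>I. c i * u k i * u k i)"
      using u by (intro sum.cong refl) (simp add: sum_distrib_left mult.assoc)
    then show ?thesis unfolding A_def by (subst sum.swap)
  qed
  have "(\<Sum>i\<in>I. \<Sum>j\<in>I. c i * c j * (M i j)\<^sup>2)
      = (\<Sum>i\<in>I. \<Sum>j\<in>I. \<Sum>k\<in>I. \<Sum>k'\<in>I. (c i * u k i * u k' i) * (c j * u k j * u k' j))"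
  proof (intro sum.cong refl)
    fix i j assume "i \<in> I" "j \<in> I"
    then show "c i * c j * (M i j)\<^sup>2 = (\<Sum>k\<in>I. \<Sum>k'\<in>I. (c i * u k i * u k' i) * (c j * u k j * u k' j))"
      unfolding power2_eq_square u[OF \<open>i \<in> I\<close> \<open>j \<in> I\<close>] sum_product
      unfolding sum_distrib_left
      by (intro sum.cong refl) (simp add: mult_ac)
  qed
  also have "\<dots> = (\<Sum>i\<in>I. \<Sum>k\<in>I. \<Sum>k'\<in>I. \<Sum>j\<in>I. (c i * u k i * u k' i) * (c j * u k j * u k' j))"
  proof (rule sum.cong[OF refl])
    fix i
    have "(\<Sum>j\<in>I. \<Sum>k\<in>I. \<Sum>k'\<in>I. (c i * u k i * u k' i) * (c j * u k j * u k' j))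
        = (\<Sum>k\<in>I. \<Sum>j\<in>I. \<Sum>k'\<in>I. (c i * u k i * u k' i) * (c j * u k j * u k' j))"
      by (rule sum.swap)
    also have "\<dots> = (\<Sum>k\<in>I. \<Sum>k'\<in>I. \<Sum>j\<in>I. (c i * u k i * u k' i) * (c j * u k j * u k' j))"
      by (intro sum.cong refl sum.swap)
    finally show "(\<Sum>j\<in>I. \<Sum>k\<in>I. \<Sum>k'\<in>I. (c i * u k i * u k' i) * (c j * u k j * u k' j))
      = (\<Sum>k\<in>I. \<Sum>k'\<in>I. \<Sum>j\<in>I. (c i * u k i * u k' i) * (c j * u k j * u k' j))" .
  qed
  also have "\<dots> = (\<Sum>k\<in>I. \<Sum>i\<in>I. \<Sum>k'\<in>I. \<Sum>j\<in>I. (c i * u k i * u k' i) * (c j * u k j * u k' j))"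
    by (rule sum.swap)
  also have "\<dots> = (\<Sum>k\<in>I. \<Sum>k'\<in>I. \<Sum>i\<in>I. \<Sum>j\<in>I. (c i * u k i * u k' i) * (c j * u k j * u k' j))"
    by (intro sum.cong refl sum.swap)
  also have "\<dots> = (\<Sum>k\<in>I. \<Sum>k'\<in>I. (A k k')\<^sup>2)"
    unfolding power2_eq_square A_def sum_product ..
  finally have sq: "(\<Sum>i\<in>I. \<Sum>j\<in>I. c i * c j * (M i j)\<^sup>2) = (\<Sum>k\<in>I. \<Sum>k'\<in>I. (A k k')\<^sup>2)" .
  \<comment> \<open>Cauchy-Schwarz for the trace of \<open>A\<close>, a sum of |I| terms; afterwards
    the off-diagonal squares are added back.\<close>
  have "(\<Sum>k\<in>I. A k k)\<^sup>2 \<le> (\<Sum>k\<in>I. (A k k)\<^sup>2) * real (card I)"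
    by (rule sum_squared_le_sum_of_squares)
  also have "\<dots> \<le> (\<Sum>k\<in>I. \<Sum>k'\<in>I. (A k k')\<^sup>2) * real (card I)"
    using fin by (intro mult_right_mono sum_mono member_le_sum[of _ I "\<lambda>k'. (A _ k')\<^sup>2"]) auto
  finally show ?thesis unfolding diag sq .
qed

section \<open>Convolution sequences\<close>

text \<open>\<open>conv\<close> is an iterated \<open>suminf\<close>, which means something only
  once both levels converge; with \<open>C\<close> in [0,1] the terms are dominated by the product
  of two summable weights. The general \<open>C\<close> also covers partial sums of
  \<open>Ccoef\<close> over k.\<close>

lemma summable_conv:
  fixes \<mu> :: "nat \<Rightarrow> real" and C :: "nat \<Rightarrow> nat \<Rightarrow> real"
  assumes \<mu>: "\<And>k. \<mu> k \<ge> 0" "summable \<mu>" and C: "\<And>l s. 0 \<le> C l s" "\<And>l s. C l s \<le> 1"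
  shows "summable (\<lambda>s. C l s * \<mu> l * \<mu> s)" "summable (\<lambda>l. \<Sum>s. C l s * \<mu> l * \<mu> s)"
    and "0 \<le> (\<Sum>s. C l s * \<mu> l * \<mu> s)" "(\<Sum>s. C l s * \<mu> l * \<mu> s) \<le> \<mu> l * suminf \<mu>"
proof -
  have le: "C l s * \<mu> l * \<mu> s \<le> \<mu> l * \<mu> s" for l s
    using mult_right_mono[OF C(2), of "\<mu> l * \<mu> s" l s] \<mu>(1) by (simp add: mult.assoc)
  have nn: "0 \<le> C l s * \<mu> l * \<mu> s" for l s using C(1) \<mu>(1) by simp
  have inner: "summable (\<lambda>s. C l s * \<mu> l * \<mu> s)" for l
    by (rule summable_comparison_test'[OF summable_mult[OF \<mu>(2), of "\<mu> l"]]) (use le nn in simp)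
  have nn': "0 \<le> (\<Sum>s. C l s * \<mu> l * \<mu> s)" for l using nn by (intro suminf_nonneg inner)
  have le': "(\<Sum>s. C l s * \<mu> l * \<mu> s) \<le> \<mu> l * suminf \<mu>" for l
    using suminf_le[OF le inner summable_mult[OF \<mu>(2)], of l] suminf_mult[OF \<mu>(2), of "\<mu> l"] by simp
  show "summable (\<lambda>s. C l s * \<mu> l * \<mu> s)" by (rule inner)
  show "summable (\<lambda>l. \<Sum>s. C l s * \<mu> l * \<mu> s)"
    by (rule summable_comparison_test'[OF summable_mult2[OF \<mu>(2), of "suminf \<mu>"]]) (use nn' le' in simp)
  show "0 \<le> (\<Sum>s. C l s * \<mu> l * \<mu> s)" "(\<Sum>s. C l s * \<mu> l * \<mu> s) \<le> \<mu> l * suminf \<mu>"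
    by (rule nn', rule le')
qed

lemma Ccoef_le_one:
  assumes n: "CARD('n::finite) \<ge> 3"
  shows "Ccoef (CARD('n) - 1) l s k \<le> 1"
proof -
  have "Ccoef (CARD('n) - 1) l s k \<le> (\<Sum>k\<le>k. Ccoef (CARD('n) - 1) l s k)"
    by (intro member_le_sum Ccoef_nonneg[OF n]) auto
  then show ?thesis using sum_Ccoef_le_one[OF n, of l s k] by linarith
qed

text \<open>Nonnegativity of weights and linearization coefficients allows the double series to be
  cut off at \<open>M\<close>.\<close>

lemma conv_ge:
  assumes n: "CARD('n::finite) \<ge> 3" and \<mu>: "\<And>k. \<mu> k \<ge> 0" "summable \<mu>"
  shows "(\<Sum>l\<le>M. \<Sum>s\<le>M. Ccoef (CARD('n) - 1) l s k * \<mu> l * \<mu> s) \<le> conv (CARD('n) - 1) \<mu> \<mu> k"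
proof -
  note C = Ccoef_nonneg[OF n] Ccoef_le_one[OF n]
  note S = summable_conv[of \<mu> "\<lambda>l s. Ccoef (CARD('n) - 1) l s k", OF \<mu> C]
  have "(\<Sum>l\<le>M. \<Sum>s\<le>M. Ccoef (CARD('n) - 1) l s k * \<mu> l * \<mu> s)
     \<le> (\<Sum>l\<le>M. \<Sum>s. Ccoef (CARD('n) - 1) l s k * \<mu> l * \<mu> s)"
    using C(1) \<mu>(1) by (intro sum_mono sum_le_suminf S(1)) auto
  also have "\<dots> \<le> conv (CARD('n) - 1) \<mu> \<mu> k"
    unfolding conv_def using S(3) by (intro sum_le_suminf S(2)) auto
  finally show ?thesis .
qed

lemma conv_nonneg:
  assumes n: "CARD('n::finite) \<ge> 3" and \<mu>: "\<And>k. \<mu> k \<ge> 0" "summable \<mu>"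
  shows "conv (CARD('n) - 1) \<mu> \<mu> k \<ge> 0"
  unfolding conv_def
  by (intro suminf_nonneg summable_conv \<mu> Ccoef_nonneg[OF n] Ccoef_le_one[OF n])

text \<open>After moving the finite sum over k inside both series, the coefficients \<open>D\<close>
  are at most 1, and the double series is bounded by a product.\<close>

lemma sum_conv_le:
  assumes n: "CARD('n::finite) \<ge> 3" and \<mu>: "\<And>k. \<mu> k \<ge> 0" "summable \<mu>"
  shows "(\<Sum>k\<le>K. conv (CARD('n) - 1) \<mu> \<mu> k) \<le> (suminf \<mu>)\<^sup>2"
proof -
  let ?C = "Ccoef (CARD('n) - 1)"
  define D where "D l s = (\<Sum>k\<le>K. ?C l s k)" for l s
  have D: "0 \<le> D l s" "D l s \<le> 1" for l s
    unfolding D_def using Ccoef_nonneg[OF n] sum_Ccoef_le_one[OF n] by (auto intro: sum_nonneg)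
  note S = summable_conv[of \<mu> "\<lambda>l s. ?C l s k" for k, OF \<mu> Ccoef_nonneg[OF n] Ccoef_le_one[OF n]]
  note T = summable_conv[of \<mu> D, OF \<mu> D]
  have "(\<Sum>k\<le>K. conv (CARD('n) - 1) \<mu> \<mu> k) = (\<Sum>l. \<Sum>k\<le>K. \<Sum>s. ?C l s k * \<mu> l * \<mu> s)"
    unfolding conv_def by (rule suminf_sum[symmetric]) (rule S(2))
  also have "\<dots> = (\<Sum>l. \<Sum>s. \<Sum>k\<le>K. ?C l s k * \<mu> l * \<mu> s)"
    by (intro suminf_cong suminf_sum[symmetric] S(1))
  also have "\<dots> = (\<Sum>l. \<Sum>s. D l s * \<mu> l * \<mu> s)"
    by (simp add: D_def sum_distrib_right)
  also have "\<dots> \<le> (\<Sum>l. \<mu> l * suminf \<mu>)"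
    by (intro suminf_le T(2,4) summable_mult2 \<mu>(2))
  also have "\<dots> = (suminf \<mu>)\<^sup>2"
    using suminf_mult2[OF \<mu>(2), of "suminf \<mu>"] by (simp add: power2_eq_square)
  finally show ?thesis .
qed

text \<open>Vybiral's bound for the truncated kernel \<open>K\<close>. Its diagonal is the partial
  sum of \<open>\<mu>\<close>, since zonal functions are 1 at their pole, and its square is expanded
  by the linearization up to degree 2M.\<close>

lemma conv_quadratic_form_ge:
  fixes x :: "nat \<Rightarrow> real^'n::finite"
  assumes n: "CARD('n) \<ge> 3" and \<mu>: "\<And>k. \<mu> k \<ge> 0" "summable \<mu>"
    and x: "\<And>j. j < m \<Longrightarrow> norm (x j) = 1"
  shows "((\<Sum>j<m. c j) * (\<Sum>l\<le>M. \<mu> l))\<^sup>2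
    \<le> (\<Sum>k\<le>2 * M. conv (CARD('n) - 1) \<mu> \<mu> k * (\<Sum>i<m. \<Sum>j<m. c i * c j * zonal k (x j) (x i))) * real m"
proof -
  let ?d = "CARD('n) - 1"
  let ?C = "Ccoef ?d"
  define q where "q k = (\<Sum>i<m. \<Sum>j<m. c i * c j * zonal k (x j) (x i))" for k
  have q: "q k \<ge> 0" for k unfolding q_def using x by (intro zonal_psd[OF n]) auto
  define K where "K i j = (\<Sum>l\<le>M. \<mu> l * zonal l (x j) (x i))" for i j
  have Ksym: "K i j = K j i" for i j by (simp add: K_def inner_commute)
  have Kpsd: "(\<Sum>i<m. \<Sum>j<m. b i * b j * K i j) \<ge> 0" for b
  proof -
    have "(\<Sum>i<m. \<Sum>j<m. b i * b j * K i j)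
        = (\<Sum>i<m. \<Sum>j<m. \<Sum>l\<le>M. \<mu> l * (b i * b j * zonal l (x j) (x i)))"
      unfolding K_def by (simp add: sum_distrib_left mult_ac)
    also have "\<dots> = (\<Sum>i<m. \<Sum>l\<le>M. \<Sum>j<m. \<mu> l * (b i * b j * zonal l (x j) (x i)))"
      by (intro sum.cong refl sum.swap)
    also have "\<dots> = (\<Sum>l\<le>M. \<Sum>i<m. \<Sum>j<m. \<mu> l * (b i * b j * zonal l (x j) (x i)))"
      by (rule sum.swap)
    also have "\<dots> = (\<Sum>l\<le>M. \<mu> l * (\<Sum>i<m. \<Sum>j<m. b i * b j * zonal l (x j) (x i)))"
      by (simp add: sum_distrib_left)
    also have "\<dots> \<ge> 0"
      using x \<mu>(1) by (intro sum_nonneg mult_nonneg_nonneg zonal_psd[OF n]) auto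
    finally show ?thesis .
  qed
  have "(\<Sum>j<m. c j * K j j) = (\<Sum>j<m. c j) * (\<Sum>l\<le>M. \<mu> l)"
  proof -
    have "K j j = (\<Sum>l\<le>M. \<mu> l)" if "j < m" for j
      using zonal_self[OF n x[OF that]] by (simp add: K_def)
    then show ?thesis by (simp add: sum_distrib_right)
  qed
  then have "((\<Sum>j<m. c j) * (\<Sum>l\<le>M. \<mu> l))\<^sup>2 \<le> (\<Sum>i<m. \<Sum>j<m. c i * c j * (K i j)\<^sup>2) * real m"
    using schur_square_lower_bound[of "{..<m}" K c] Ksym Kpsd by simp
  also have "(\<Sum>i<m. \<Sum>j<m. c i * c j * (K i j)\<^sup>2)
      = (\<Sum>k\<le>2 * M. (\<Sum>l\<le>M. \<Sum>s\<le>M. ?C l s k * \<mu> l * \<mu> s) * q k)"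
  proof -
    have "(K i j)\<^sup>2 = (\<Sum>k\<le>2 * M. (\<Sum>l\<le>M. \<Sum>s\<le>M. ?C l s k * \<mu> l * \<mu> s) * zonal k (x j) (x i))" for i j
    proof -
      have "(K i j)\<^sup>2 = (\<Sum>l\<le>M. \<Sum>s\<le>M. \<mu> l * \<mu> s * (zonal l (x j) (x i) * zonal s (x j) (x i)))"
        unfolding K_def power2_eq_square sum_product by (intro sum.cong refl) (simp add: mult_ac)
      also have "\<dots> = (\<Sum>l\<le>M. \<Sum>s\<le>M. \<Sum>k\<le>2 * M. ?C l s k * \<mu> l * \<mu> s * zonal k (x j) (x i))"
      proof (intro sum.cong refl)
        fix l s assume "l \<in> {..M}" "s \<in> {..M}"
        then have "l + s \<le> 2 * M" by simp
        note lin = Ccoef_linearization[OF n this, of "x i \<bullet> x j", symmetric]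
        show "\<mu> l * \<mu> s * (zonal l (x j) (x i) * zonal s (x j) (x i))
            = (\<Sum>k\<le>2 * M. ?C l s k * \<mu> l * \<mu> s * zonal k (x j) (x i))"
          unfolding lin sum_distrib_left by (simp only: mult_ac)
      qed
      also have "\<dots> = (\<Sum>l\<le>M. \<Sum>k\<le>2 * M. \<Sum>s\<le>M. ?C l s k * \<mu> l * \<mu> s * zonal k (x j) (x i))"
        by (intro sum.cong refl sum.swap)
      also have "\<dots> = (\<Sum>k\<le>2 * M. \<Sum>l\<le>M. \<Sum>s\<le>M. ?C l s k * \<mu> l * \<mu> s * zonal k (x j) (x i))"
        by (rule sum.swap)
      finally show ?thesis by (simp only: sum_distrib_right)
    qed
    then have "(\<Sum>i<m. \<Sum>j<m. c i * c j * (K i j)\<^sup>2)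
      = (\<Sum>i<m. \<Sum>j<m. \<Sum>k\<le>2 * M. (\<Sum>l\<le>M. \<Sum>s\<le>M. ?C l s k * \<mu> l * \<mu> s) * (c i * c j * zonal k (x j) (x i)))"
      by (simp only: sum_distrib_left[of "c _ * c _"]) (simp only: mult_ac)
    also have "\<dots> = (\<Sum>i<m. \<Sum>k\<le>2 * M. \<Sum>j<m. (\<Sum>l\<le>M. \<Sum>s\<le>M. ?C l s k * \<mu> l * \<mu> s) * (c i * c j * zonal k (x j) (x i)))"
      by (intro sum.cong refl sum.swap)
    also have "\<dots> = (\<Sum>k\<le>2 * M. \<Sum>i<m. \<Sum>j<m. (\<Sum>l\<le>M. \<Sum>s\<le>M. ?C l s k * \<mu> l * \<mu> s) * (c i * c j * zonal k (x j) (x i)))"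
      by (rule sum.swap)
    finally show ?thesis unfolding q_def by (simp only: sum_distrib_left[symmetric])
  qed
  \<comment> \<open>Each \<open>q k\<close> is nonnegative, so passing from the truncated
    coefficients to the full convolution only increases the sum.\<close>
  also have "\<dots> \<le> (\<Sum>k\<le>2 * M. conv ?d \<mu> \<mu> k * q k)"
    using conv_ge[OF n \<mu>] q by (intro sum_mono mult_right_mono) auto
  finally show ?thesis unfolding q_def by (simp add: mult_right_mono)
qed

section \<open>The worst-case function\<close>

text \<open>Resolves the definite description in \<open>Hproj\<close>: the difference of two
  candidates is itself a spherical harmonic and is orthogonal to itself, hence 0.\<close>

lemma Hproj_eq:
  fixes f g :: "real^'n::finite \<Rightarrow> real"
  assumes f: "continuous_on (sphere 0 1) f" and g: "g \<in> sph_harm l"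
    and orth: "\<And>h. h \<in> sph_harm l \<Longrightarrow> (LINT x|sigma_d TYPE('n). (f x - g x) * h x) = 0"
  shows "Hproj l f = g"
  unfolding Hproj_def
proof (rule the_equality)
  show "g \<in> sph_harm l \<and> (\<forall>h\<in>sph_harm l. (LINT x|sigma_d TYPE('n). (f x - g x) * h x) = 0)"
    using g orth by blast
  fix g' assume g': "g' \<in> sph_harm l \<and> (\<forall>h\<in>sph_harm l. (LINT x|sigma_d TYPE('n). (f x - g' x) * h x) = 0)"
  define h where "h = (\<lambda>x. g' x - g x)"
  have h: "h \<in> sph_harm l" unfolding h_def using g g' by (intro sph_harm_diff) auto
  note cont = continuous_on_sph_harm[OF g] continuous_on_sph_harm[OF conjunct1[OF g']] continuous_on_sph_harm[OF h]
  have "(LINT x|sigma_d TYPE('n). h x * h x)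
      = (LINT x|sigma_d TYPE('n). (f x - g x) * h x - (f x - g' x) * h x)"
    by (simp add: h_def algebra_simps)
  also have "\<dots> = (LINT x|sigma_d TYPE('n). (f x - g x) * h x) - (LINT x|sigma_d TYPE('n). (f x - g' x) * h x)"
    by (intro Bochner_Integration.integral_diff integrable_sph_harm_mult continuous_intros f cont)
  also have "\<dots> = 0" using orth[OF h] g' h by simp
  finally have "h x = 0" for x by (rule sph_harm_eq_zero[OF h])
  then show "g' = g" by (simp add: h_def fun_eq_iff)
qed

lemma G_zero [simp]: "G d 0 t = 1"
  by (simp add: G_def)

lemma integral_zonal:
  fixes y :: "real^'n::finite"
  assumes n: "CARD('n) \<ge> 3" and y: "norm y = 1"
  shows "(LINT x|sigma_d TYPE('n). zonal k y x) = (if k = 0 then 1 else 0)"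
proof (cases "k = 0")
  case False
  have "(LINT x|sigma_d TYPE('n). zonal k y x) = fh_multiplier (real CARD('n)) (Gpoly (CARD('n) - 1) k) 0"
    using integral_poly_inner[OF n y, of "Gpoly (CARD('n) - 1) k"] by (simp add: poly_Gpoly)
  then show ?thesis using fh_multiplier_Gpoly_orthogonal[OF n False] False by simp
qed simp

text \<open>The test function is the normalized representer of the error functional, truncated at degree $L$;
  its degree-$k$ part is $\tilde\lambda_k Z_k$. The truncation keeps all sums finite.\<close>
lemma quad_err_test_function:
  fixes x :: "nat \<Rightarrow> real^'n::finite" and lam c :: "nat \<Rightarrow> real" and L :: nat
  assumes n: "CARD('n) \<ge> 3" and x: "\<And>j. j < m \<Longrightarrow> norm (x j) = 1"
  defines "q k \<equiv> (\<Sum>i<m. \<Sum>j<m. c i * c j * zonal k (x j) (x i))"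
  defines "Q \<equiv> lam 0 * (1 - 2 * (\<Sum>j<m. c j)) + (\<Sum>k\<le>L. lam k * q k)"
  assumes Q: "Q > 0"
  shows "ereal (sqrt Q) \<le> (SUP f \<in> (Hball lam :: (real^'n \<Rightarrow> real) set).
          ereal \<bar>(LINT y|sigma_d TYPE('n). f y) - (\<Sum>j<m. c j * f (x j))\<bar>)"
proof -
  let ?I = "\<lambda>f. LINT x|sigma_d TYPE('n). f x"
  define e where "e = (axis undefined 1 :: real^'n)"
  have e: "norm e = 1" by (simp add: e_def)
  \<comment> \<open>Integration acts on degree \<open>k\<close> as \<open>\<delta> k\<close> times
    evaluation at any point, for which the auxiliary pole \<open>e\<close> is fixed. So
    \<open>Z k\<close> represents integration minus the rule with respect to the kernel G_k.\<close>
  define \<delta> where "\<delta> k = (if k = 0 then 1 else 0 :: real)" for k :: nat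
  define Z where "Z k y = \<delta> k * zonal k e y - (\<Sum>j<m. c j * zonal k (x j) y)" for k and y :: "real^'n"
  define Ze where "Ze k y = (if y \<in> sphere 0 1 then Z k y else 0)" for k y
  \<comment> \<open>The error functional applied to \<open>Z k\<close>; it is also the squared L2
    norm of \<open>Z k\<close> divided by \<open>zonal_sq\<close>.\<close>
  define r where "r k = \<delta> k * Z k e - (\<Sum>j<m. c j * Z k (x j))" for k
  \<comment> \<open>\<open>Q\<close> is both the squared norm and the error of the unscaled sum, so
    scaling by \<open>s\<close> leaves norm 1 and error sqrt Q.\<close>
  define s where "s = 1 / sqrt Q"
  have cZ: "continuous_on S (Z k)" for k S
    unfolding Z_def by (intro continuous_intros continuous_on_zonal)
  have Ze: "Ze k \<in> sph_harm k" for k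
  proof -
    have "Ze k = (\<lambda>y. \<delta> k * (if y \<in> sphere 0 1 then zonal k e y else 0)
        - (\<Sum>j\<in>{..<m}. c j * (if y \<in> sphere 0 1 then zonal k (x j) y else 0)))"
      by (auto simp: Ze_def Z_def fun_eq_iff)
    also have "\<dots> \<in> sph_harm k"
      using x by (intro sph_harm_diff sph_harm_sum sph_harm_cmult zonal_sph_harm[OF n] e) auto
    finally show ?thesis .
  qed
  have Zh: "?I (\<lambda>y. Z k y * h y) = fh_multiplier (real CARD('n)) (Gpoly (CARD('n) - 1) k) l * (\<delta> k * h e - (\<Sum>j<m. c j * h (x j)))"
    if h: "h \<in> sph_harm l" for h k l
  proof -
    have int: "integrable (sigma_d TYPE('n)) (\<lambda>x. zonal k y x * h x)" for y
      by (rule integrable_sph_harm_mult[OF continuous_on_zonal continuous_on_sph_harm[OF h]])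
    have "?I (\<lambda>y. Z k y * h y) = ?I (\<lambda>y. \<delta> k * (zonal k e y * h y) - (\<Sum>j<m. c j * (zonal k (x j) y * h y)))"
      by (simp only: Z_def left_diff_distrib sum_distrib_right mult.assoc)
    also have "\<dots> = \<delta> k * ?I (\<lambda>y. zonal k e y * h y) - (\<Sum>j<m. c j * ?I (\<lambda>y. zonal k (x j) y * h y))"
      using int by (subst Bochner_Integration.integral_diff) (auto simp: Bochner_Integration.integral_sum)
    also have "\<dots> = fh_multiplier (real CARD('n)) (Gpoly (CARD('n) - 1) k) l * (\<delta> k * h e - (\<Sum>j<m. c j * h (x j)))"
      using funk_hecke_zonal[OF n _ h, of _ k] e x
      by (simp add: sum_distrib_left sum_distrib_right algebra_simps del: One_nat_def)
    finally show ?thesis .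
  qed
  have ZeZ: "Ze k e = Z k e" "j < m \<Longrightarrow> Ze k (x j) = Z k (x j)" for k j
    using e x by (auto simp: Ze_def)
  have Z_orth: "?I (\<lambda>y. Z k y * h y) = 0" if "h \<in> sph_harm l" "k \<noteq> l" for h k l
    unfolding Zh[OF that(1)] fh_multiplier_Gpoly_orthogonal[OF n that(2)] by simp
  have ZZ: "?I (\<lambda>y. Z k y * Z k y) = zonal_sq TYPE('n) k * r k" for k
  proof -
    have "?I (\<lambda>y. Z k y * Z k y) = ?I (\<lambda>y. Z k y * Ze k y)"
      by (rule Bochner_Integration.integral_cong) (auto simp: Ze_def)
    also have "\<dots> = zonal_sq TYPE('n) k * r k"
      unfolding Zh[OF Ze] zonal_sq_def r_def using ZeZ by simp
    finally show ?thesis .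
  qed
  have IZ: "?I (Z k) = \<delta> k * Z k e" for k
  proof -
    have "?I (Z k) = \<delta> k * ?I (zonal k e) - (\<Sum>j<m. c j * ?I (zonal k (x j)))"
      unfolding Z_def using integrable_sigma_d[OF continuous_on_zonal]
      by (subst Bochner_Integration.integral_diff) (auto simp: Bochner_Integration.integral_sum)
    also have "\<dots> = \<delta> k * Z k e"
      using integral_zonal[OF n, of _ k] e x by (simp add: Z_def \<delta>_def del: One_nat_def)
    finally show ?thesis .
  qed
  have r: "r k = q k + (if k = 0 then 1 - 2 * (\<Sum>j<m. c j) else 0)" for k
  proof -
    have "(\<Sum>j<m. c j * Z k (x j)) = \<delta> k * (\<Sum>j<m. c j) - q k"
    proof -
      have "(\<Sum>j<m. c j * Z k (x j)) = (\<Sum>i<m. c i * \<delta> k * zonal k e (x i)) - q k"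
        unfolding Z_def q_def
        by (simp add: right_diff_distrib sum_subtractf sum_distrib_left mult_ac del: One_nat_def)
      also have "(\<Sum>i<m. c i * \<delta> k * zonal k e (x i)) = \<delta> k * (\<Sum>j<m. c j)"
        by (simp add: \<delta>_def)
      finally show ?thesis .
    qed
    then show ?thesis
      unfolding r_def by (simp add: \<delta>_def Z_def)
  qed
  have Qr: "Q = (\<Sum>k\<le>L. lam k * r k)"
  proof -
    have "(\<Sum>k\<le>L. lam k * r k)
        = (\<Sum>k\<le>L. lam k * q k + (if k = 0 then lam 0 * (1 - 2 * (\<Sum>j<m. c j)) else 0))"
      unfolding r by (intro sum.cong) (auto simp: algebra_simps)
    then show ?thesis unfolding Q_def by (simp add: sum.distrib)
  qed
  define f where "f y = s * (\<Sum>k\<le>L. lam k * Z k y)" for y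
  have cf: "continuous_on (sphere 0 1) f"
    unfolding f_def by (intro continuous_intros cZ)
  have proj: "Hproj l f = (\<lambda>y. (if l \<le> L then s * lam l else 0) * Ze l y)" for l
  proof (rule Hproj_eq[OF cf sph_harm_cmult[OF Ze]])
    fix h :: "real^'n \<Rightarrow> real" assume h: "h \<in> sph_harm l"
    let ?t = "if l \<le> L then s * lam l else 0"
    have int: "integrable (sigma_d TYPE('n)) (\<lambda>y. Z k y * h y)" for k
      by (rule integrable_sph_harm_mult[OF cZ continuous_on_sph_harm[OF h]])
    have "?I (\<lambda>y. (f y - ?t * Ze l y) * h y)
        = ?I (\<lambda>y. (\<Sum>k\<le>L. s * lam k * (Z k y * h y)) - ?t * (Z l y * h y))"
      by (rule Bochner_Integration.integral_cong)
        (auto simp: f_def Ze_def sum_distrib_left sum_distrib_right left_diff_distrib mult.assoc)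
    also have "\<dots> = (\<Sum>k\<le>L. s * lam k * ?I (\<lambda>y. Z k y * h y)) - ?t * ?I (\<lambda>y. Z l y * h y)"
      using int by (subst Bochner_Integration.integral_diff) (auto simp: Bochner_Integration.integral_sum)
    also have "(\<Sum>k\<le>L. s * lam k * ?I (\<lambda>y. Z k y * h y))
        = (\<Sum>k\<le>L. if k = l then s * lam l * ?I (\<lambda>y. Z l y * h y) else 0)"
      using Z_orth[OF h] by (intro sum.cong) auto
    also have "\<dots> - ?t * ?I (\<lambda>y. Z l y * h y) = 0"
      by simp
    finally show "?I (\<lambda>y. (f y - ?t * Ze l y) * h y) = 0" .
  qed
  have L2: "L2normsq (Hproj l f) = (if l \<le> L then (s * lam l)\<^sup>2 * (zonal_sq TYPE('n) l * r l) else 0)" for l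
  proof -
    have "L2normsq (Hproj l f) = ?I (\<lambda>y. (if l \<le> L then (s * lam l)\<^sup>2 else 0) * (Z l y * Z l y))"
      unfolding L2normsq_def proj
      by (rule Bochner_Integration.integral_cong) (auto simp: Ze_def power2_eq_square)
    then show ?thesis by (simp add: ZZ)
  qed
  have "Hnormsq lam f = (\<Sum>l\<le>L. ereal (s\<^sup>2 * (lam l * r l)))"
  proof -
    have "Hnormsq lam f = (\<Sum>l. ereal (if l \<le> L then s\<^sup>2 * (lam l * r l) else 0))"
      unfolding Hnormsq_def
    proof (rule suminf_cong)
      fix l
      obtain B :: "(real^'n \<Rightarrow> real) set" where "finite B"
        "\<And>b. b \<in> B \<Longrightarrow> continuous_on (sphere 0 1) b"
        "\<And>x y. norm x = 1 \<Longrightarrow> norm y = 1 \<Longrightarrow> zonal l y x = zonal_sq TYPE('n) l * (\<Sum>b\<in>B. b x * b y)"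
        and N: "zonal_sq TYPE('n) l * real (Ndim TYPE('n) l) = 1"
        by (rule addition_theorem[OF n, where l = l]) (rule that)
      \<comment> \<open>The dimension cancels against \<open>zonal_sq\<close>, and one factor
        \<open>lam l\<close> survives. In degrees with \<open>lam l = 0\<close> the component of
        \<open>f\<close> vanishes, which avoids the infinite branch of the norm.\<close>
      have "real (Ndim TYPE('n) l) / lam l * ((s * lam l)\<^sup>2 * (zonal_sq TYPE('n) l * r l))
          = (zonal_sq TYPE('n) l * real (Ndim TYPE('n) l)) * (s\<^sup>2 * (lam l * r l))" if "lam l \<noteq> 0"
        using that by (simp add: power2_eq_square)
      then show "(if lam l = 0 then if L2normsq (Hproj l f) = 0 then 0 else \<infinity>
          else ereal (real (Ndim TYPE('n) l) / lam l * L2normsq (Hproj l f)))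
        = ereal (if l \<le> L then s\<^sup>2 * (lam l * r l) else 0)"
        unfolding L2 N by auto
    qed
    also have "\<dots> = (\<Sum>l\<le>L. ereal (if l \<le> L then s\<^sup>2 * (lam l * r l) else 0))"
      by (rule suminf_finite) auto
    finally show ?thesis by simp
  qed
  also have "\<dots> = ereal (s\<^sup>2 * Q)"
    by (simp add: Qr sum_distrib_left)
  also have "s\<^sup>2 * Q = 1"
    using Q by (simp add: s_def power_divide)
  finally have "f \<in> Hball lam"
    using cf by (simp add: Hball_def one_ereal_def)
  then have "ereal \<bar>?I f - (\<Sum>j<m. c j * f (x j))\<bar> \<le> (SUP f \<in> (Hball lam :: (real^'n \<Rightarrow> real) set).
          ereal \<bar>?I f - (\<Sum>j<m. c j * f (x j))\<bar>)"
    by (rule SUP_upper)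
  moreover have "?I f - (\<Sum>j<m. c j * f (x j)) = sqrt Q"
  proof -
    have "?I f = s * (\<Sum>k\<le>L. lam k * ?I (Z k))"
      unfolding f_def using integrable_sigma_d[OF cZ] by (simp add: Bochner_Integration.integral_sum)
    moreover have "(\<Sum>j<m. c j * f (x j)) = s * (\<Sum>k\<le>L. lam k * (\<Sum>j<m. c j * Z k (x j)))"
    proof -
      have "(\<Sum>j<m. c j * f (x j)) = (\<Sum>j<m. \<Sum>k\<le>L. s * (lam k * (c j * Z k (x j))))"
        by (simp add: f_def sum_distrib_left mult_ac)
      also have "\<dots> = (\<Sum>k\<le>L. \<Sum>j<m. s * (lam k * (c j * Z k (x j))))"
        by (rule sum.swap)
      finally show ?thesis by (simp add: sum_distrib_left)
    qed
    ultimately have "?I f - (\<Sum>j<m. c j * f (x j)) = s * Q"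
      unfolding Qr r_def IZ by (simp add: right_diff_distrib sum_subtractf)
    then show ?thesis using Q by (simp add: s_def real_div_sqrt)
  qed
  ultimately show ?thesis using Q by simp
qed

theorem theorem4p2:
  fixes \<mu> \<nu> lam :: "nat \<Rightarrow> real" and n :: nat
  assumes dim: "CARD('n::finite) \<ge> 3"
    and mu_nonneg: "\<forall>k. \<mu> k \<ge> 0" and mu_l1: "summable \<mu>"
    and nu_nonneg: "\<forall>k. \<nu> k \<ge> 0" and nu_l1: "summable \<nu>"
    and lam_def: "lam = (\<lambda>k. conv (CARD('n) - 1) \<mu> \<mu> k + conv (CARD('n) - 1) \<nu> \<nu> k)"
    and lam_pos: "(\<Sum>l. lam l) > 0"
    and n_pos: "n \<ge> 1"
  shows "ereal (lam 0 * (1 - real n * lam 0 / (\<Sum>l. lam l))) \<le> (quad_err TYPE('n) lam n)\<^sup>2"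
proof -
  define B where "B = lam 0 * (1 - real n * lam 0 / (\<Sum>l. lam l))"
  define T where "T = (suminf \<mu>)\<^sup>2 + (suminf \<nu>)\<^sup>2"
  note mu = mu_nonneg[rule_format] mu_l1 and nu = nu_nonneg[rule_format] nu_l1
  have lam_nonneg: "lam k \<ge> 0" for k
    unfolding lam_def using conv_nonneg[OF dim mu, of k] conv_nonneg[OF dim nu, of k] by simp
  have part: "(\<Sum>k\<le>K. lam k) \<le> T" for K
    unfolding lam_def T_def using sum_conv_le[OF dim mu, of K] sum_conv_le[OF dim nu, of K]
    by (simp add: sum.distrib)
  have lt: "(\<Sum>k<K. lam k) \<le> T" for K
    using part[of K] lam_nonneg[of K] by (simp add: lessThan_Suc_atMost[symmetric])
  \<comment> \<open>Bounded partial sums make \<open>lam\<close> summable, so that its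
    \<open>suminf\<close> is the actual sum and is at most \<open>T\<close>.\<close>
  then have "summable lam" using lam_nonneg by (intro summableI_nonneg_bounded) auto
  then have LT: "(\<Sum>l. lam l) \<le> T" using lt by (intro suminf_le_const) auto
  have np: "real n > 0" using n_pos by simp
  show ?thesis
  proof (cases "B > 0")
    \<comment> \<open>A nonpositive bound lies below any square.\<close>
    case False
    have "0 \<le> (quad_err TYPE('n) lam n)\<^sup>2"
      by (cases "quad_err TYPE('n) lam n") (auto simp: power2_eq_square)
    moreover have "ereal B \<le> 0" using False by simp
    ultimately show ?thesis unfolding B_def by (rule order_trans[rotated])
  next
    case True
    have "ereal (sqrt B) \<le> quad_err TYPE('n) lam n"
      unfolding quad_err_def
    proof (rule INF_greatest)
      fix cx :: "(nat \<Rightarrow> real) \<times> (nat \<Rightarrow> real^'n)"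
      assume "cx \<in> {(c, x). \<forall>j<n. x j \<in> sphere 0 1}"
      then obtain c x where cx: "cx = (c, x)" and x: "\<And>j. j < n \<Longrightarrow> norm (x j) = 1"
        by (auto simp: case_prod_beta) (metis prod.collapse)
      let ?E = "SUP f \<in> (Hball lam :: (real^'n \<Rightarrow> real) set).
          ereal \<bar>(LINT y|sigma_d TYPE('n). f y) - (\<Sum>j<n. c j * f (x j))\<bar>"
      define S where "S = (\<Sum>j<n. c j)"
      define q where "q k = (\<Sum>i<n. \<Sum>j<n. c i * c j * zonal k (x j) (x i))" for k
      define Q where "Q L = lam 0 * (1 - 2 * S) + (\<Sum>k\<le>L. lam k * q k)" for L
      \<comment> \<open>Schur bounds for the kernels of \<open>\<mu>\<close> and
        \<open>\<nu>\<close> cut at degree \<open>M\<close>. Their squares reach degree 2M, which is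
        therefore the truncation of the test function.\<close>
      define R where "R M = lam 0 * (1 - 2 * S) + ((S * (\<Sum>l\<le>M. \<mu> l))\<^sup>2 + (S * (\<Sum>l\<le>M. \<nu> l))\<^sup>2) / real n" for M
      have "R M \<le> Q (2 * M)" for M
      proof -
        have "(S * (\<Sum>l\<le>M. \<mu> l))\<^sup>2 + (S * (\<Sum>l\<le>M. \<nu> l))\<^sup>2 \<le> (\<Sum>k\<le>2 * M. lam k * q k) * real n"
          using conv_quadratic_form_ge[where x = x and c = c and M = M and m = n, OF dim mu x]
            conv_quadratic_form_ge[where x = x and c = c and M = M and m = n, OF dim nu x]
          unfolding q_def[symmetric] S_def[symmetric] lam_def by (simp add: distrib_right sum.distrib)
        then show ?thesis using np by (simp add: R_def Q_def field_simps)
      qed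
      moreover have "ereal (sqrt (Q L)) \<le> ?E" if "Q L > 0" for L
        using quad_err_test_function[where x = x and c = c and m = n and lam = lam and L = L, OF dim x] that
        unfolding q_def[symmetric] S_def[symmetric] Q_def[symmetric] by blast
      ultimately have RE: "ereal (sqrt (R M)) \<le> ?E" if "R M > 0" for M
        using that by (meson ereal_less_eq(3) less_le_trans order_trans real_sqrt_le_iff)
      define R' where "R' = lam 0 * (1 - 2 * S) + ((S * suminf \<mu>)\<^sup>2 + (S * suminf \<nu>)\<^sup>2) / real n"
      have lim: "R \<longlonglongrightarrow> R'"
        unfolding R_def R'_def
        using summable_LIMSEQ'[OF mu_l1] summable_LIMSEQ'[OF nu_l1] np by (intro tendsto_intros) auto
      have "B \<le> R'"
      proof -
        let ?\<Lambda> = "\<Sum>l. lam l"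
        \<comment> \<open>Completing the square in the total weight \<open>S\<close>: the parabola
          is minimal at S = n lam_0 / sum lam, with minimum \<open>B\<close>.\<close>
        have "0 \<le> (S * ?\<Lambda> - real n * lam 0)\<^sup>2 / (real n * ?\<Lambda>)"
          using np lam_pos by simp
        also have "\<dots> = S\<^sup>2 * ?\<Lambda> / real n - 2 * lam 0 * S + real n * (lam 0)\<^sup>2 / ?\<Lambda>"
          using np lam_pos by (simp add: field_simps power2_eq_square)
        finally have "B \<le> lam 0 * (1 - 2 * S) + S\<^sup>2 * ?\<Lambda> / real n"
          by (simp add: B_def algebra_simps power2_eq_square)
        also have "\<dots> \<le> lam 0 * (1 - 2 * S) + S\<^sup>2 * T / real n"
          using LT np by (intro add_left_mono divide_right_mono mult_left_mono) auto
        also have "\<dots> = R'"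
          by (simp add: R'_def T_def power_mult_distrib distrib_left)
        finally show ?thesis .
      qed
      have "(\<lambda>M. ereal (sqrt (R M))) \<longlonglongrightarrow> ereal (sqrt R')"
        using lim by (intro tendsto_intros)
      \<comment> \<open>The test function can be normalized only for a positive squared norm; since
        \<open>B > 0\<close>, this is so for all large \<open>M\<close>.\<close>
      moreover have "\<forall>\<^sub>F M in sequentially. R M > 0"
        using \<open>B \<le> R'\<close> True by (intro order_tendstoD(1)[OF lim]) linarith
      then have "\<exists>N. \<forall>M\<ge>N. ereal (sqrt (R M)) \<le> ?E"
        using RE unfolding eventually_sequentially by blast
      ultimately have "ereal (sqrt R') \<le> ?E" by (rule LIMSEQ_le_const2)
      moreover have "ereal (sqrt B) \<le> ereal (sqrt R')" using \<open>B \<le> R'\<close> by simp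
      ultimately show "ereal (sqrt B) \<le> (SUP f \<in> (Hball lam :: (real^'n \<Rightarrow> real) set).
          ereal \<bar>(LINT y|sigma_d TYPE('n). f y) - (\<Sum>j<n. fst cx j * f (snd cx j))\<bar>)"
        unfolding cx fst_conv snd_conv by (rule order_trans[rotated])
    qed
    moreover have "0 \<le> ereal (sqrt B)" using True by simp
    ultimately have "ereal (sqrt B) * ereal (sqrt B) \<le> quad_err TYPE('n) lam n * quad_err TYPE('n) lam n"
      by (intro ereal_mult_mono')
    moreover have "ereal (sqrt B) * ereal (sqrt B) = ereal B" using True by simp
    ultimately show ?thesis unfolding B_def by (simp add: power2_eq_square)
  qed
qed

end
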